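(* Let $E \subset \mathbb{H}$ be a closed $3$-regular set, and assume that for every admissible kernel $K$ the singular integral $T_K$ is bounded on $L^{2}(\mathcal{H}^{3}|_{E})$. Then $E$ satisfies the weak geometric lemma for vertical $\beta$-numbers: for every $\epsilon > 0$ there exists a constant $C \geq 1$ such that $$\int_{0}^{R} \mathcal{H}^{3}(\{p \in E \cap B(p_{0},R) : \beta_{E}(p,r) \geq \epsilon\}) \, \frac{dr}{r} \leq C R^{3}$$ for all $p_{0} \in E$ and all $R > 0$.
   Context: The first Heisenberg group is $\mathbb{H} = (\mathbb{R}^{3},\cdot)$ with group law $(x,y,t)\cdot(x',y',t') = (x+x',y+y',t+t'+\tfrac12(xy'-yx'))$. Put $\|(x,y,t)\| = ((x^2+y^2)^2+16t^2)^{1/4}$ and $d(p,q) = \|q^{-1}\cdot p\|$, a metric on $\mathbb{H}$. $B(p,r)$ denotes the open $d$-ball, and Hausdorff measures $\mathcal{H}^{s}$, diameters and distances are taken with respect to $d$. $\mathcal{H}^{3}|_E$ is the restriction of $\mathcal{H}^3$ to $E$. An $\mathcal{H}^{3}$-measurable set $E \subset \mathbb{H}$ is $3$-regular if there is a constant $A \geq 1$ such that $r^{3}/A \leq \mathcal{H}^{3}(E \cap B(p,r)) \leq A r^{3}$ for all $p \in E$ and $0 < r \leq \operatorname{diam}(E)$. For $p=(x,y,t)$ write $\overline{p} = (-x,-y,t)$. The horizontal gradient is $\nabla_{\mathbb{H}} = (X,Y)$, where $X = \partial_x - \tfrac{y}{2}\partial_t$ and $Y = \partial_y + \tfrac{x}{2}\partial_t$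 are the left-invariant horizontal vector fields; $\nabla_{\mathbb{H}}^{j}K$ is the collection of all $j$-fold iterated horizontal derivatives of $K$. A smooth function $K \colon \mathbb{H}\setminus\{0\} \to \mathbb{R}$ is an admissible kernel if it is horizontally antisymmetric, that is, $K(\overline{p}) = -K(p)$ for all $p \in \mathbb{H}\setminus\{0\}$, and if for every $j \in \{0,1,2,\ldots\}$ there is a constant $C(j)$ with $|\nabla_{\mathbb{H}}^{j}K(p)| \leq C(j)\|p\|^{-3-j}$ for all $p \in \mathbb{H}\setminus\{0\}$. For an admissible kernel $K$ and $\epsilon>0$ define $T_{K,\epsilon}\nu(p) = \int_{\{\|q^{-1}\cdot p\|>\epsilon\}} K(q^{-1}\cdot p)\,d\nu(q)$ for complex Borel measures $\nu$ of finite total variation. For a positive locally finite Borel measure $\mu$, "$T_K$ is bounded on $L^2(\mu)$" means that there is a constant $C \geq 1$, independent of $\epsilon>0$, such that $\|T_{K,\epsilon}(f\mu)\|_{L^2(\mu)} \leq C\|f\|_{L^2(\mu)}$ for all $f \in L^1(\mu)\cap L^2(\mu)$. A vertical plane is a (left) translate of a $2$-dimensional linear plane in $\mathbb{R}^3$ containing the $t$-axis. The vertical $\beta$-number is $\beta_E(p,r) = \inf_{\mathbb{W}} \sup_{y \in B(p,r)\cap E} d(y,\mathbb{W})/r$, where the infimum is over all vertical planes $\mathbb{W}$ and $d(y,\mathbb{W})$ is the distance from $y$ to $\mathbb{W}$. *)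

theory Defs
  imports "HOL-Analysis.Analysis"
begin

section \<open>Hausdorff measures on metric spaces\<close>

text \<open>
  The library's \<^const>\<open>diameter\<close> is real-valued and unspecified on unbounded sets, whereas
  here the diameter may be infinite.
\<close>

definition ediam :: "'a::metric_space set \<Rightarrow> ennreal" where
  "ediam S = (SUP x\<in>S. SUP y\<in>S. ennreal (dist x y))"

text \<open>
  No normalising constant is used. The case distinction only matters for \<open>s = 0\<close>,
  where \<open>0 ^ 0 = 1\<close>.
\<close>

definition hausdorff_gauge :: "nat \<Rightarrow> 'a::metric_space set \<Rightarrow> ennreal" where
  "hausdorff_gauge s S = (if S = {} then 0 else ediam S ^ s)"

definition hausdorff_pre :: "nat \<Rightarrow> real \<Rightarrow> 'a::metric_space set \<Rightarrow> ennreal" where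
  "hausdorff_pre s \<delta> A =
     (INF U \<in> {U :: nat \<Rightarrow> 'a set. A \<subseteq> (\<Union>i. U i) \<and> (\<forall>i. ediam (U i) \<le> ennreal \<delta>)}.
        \<Sum>i. hausdorff_gauge s (U i))"

text \<open>This is the outer measure, so that sets not known to be Borel can be measured.\<close>

definition hausdorff :: "nat \<Rightarrow> 'a::metric_space set \<Rightarrow> ennreal" where
  "hausdorff s A = (SUP \<delta>\<in>{0<..}. hausdorff_pre s \<delta> A)"

definition hausdorff_measure :: "nat \<Rightarrow> 'a::metric_space measure" where
  "hausdorff_measure s = measure_of UNIV (sets borel) (hausdorff s)"

text \<open>
  \<^const>\<open>measure_of\<close> returns the zero measure if its argument is not countably additive.
  The rest of this section shows that this does not happen: the Hausdorff outer measure is a metric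
  outer measure, so Borel sets satisfy the Caratheodory condition.
\<close>

lemma ediam_mono: "S \<subseteq> T \<Longrightarrow> ediam S \<le> ediam T"
  unfolding ediam_def by (intro SUP_mono) (meson SUP_subset_mono order_refl subsetD)

lemma dist_le_ediam: "x \<in> S \<Longrightarrow> y \<in> S \<Longrightarrow> ennreal (dist x y) \<le> ediam S"
  unfolding ediam_def by (meson SUP_upper2 order_refl)

lemma hausdorff_gauge_mono: "S \<subseteq> T \<Longrightarrow> hausdorff_gauge s S \<le> hausdorff_gauge s T"
  unfolding hausdorff_gauge_def using ediam_mono[of S T] by (auto intro: power_mono)

lemma hausdorff_pre_le:
  assumes "A \<subseteq> (\<Union>i. U i)" "\<And>i. ediam (U i) \<le> ennreal \<delta>"
  shows "hausdorff_pre s \<delta> A \<le> (\<Sum>i. hausdorff_gauge s (U i))"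
  unfolding hausdorff_pre_def using assms by (intro INF_lower) auto

lemma hausdorff_pre_mono: "A \<subseteq> B \<Longrightarrow> hausdorff_pre s \<delta> A \<le> hausdorff_pre s \<delta> B"
  unfolding hausdorff_pre_def by (intro INF_superset_mono) auto

lemma hausdorff_pre_antimono: "\<delta> \<le> \<delta>' \<Longrightarrow> hausdorff_pre s \<delta>' A \<le> hausdorff_pre s \<delta> A"
  unfolding hausdorff_pre_def
  by (intro INF_superset_mono) (auto intro: order_trans ennreal_leI)

lemma hausdorff_pre_empty: "hausdorff_pre s \<delta> {} = 0"
  using hausdorff_pre_le[of "{}" "\<lambda>_. {}" \<delta> s]
  by (simp add: ediam_def bot_ennreal hausdorff_gauge_def)

lemma hausdorff_pre_countable:
  "hausdorff_pre s \<delta> (\<Union>n. A n) \<le> (\<Sum>n. hausdorff_pre s \<delta> (A n))"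
proof (rule ennreal_le_epsilon)
  fix e :: real
  assume fin: "(\<Sum>n. hausdorff_pre s \<delta> (A n)) < top" and e: "0 < e"
  have "\<exists>U. A n \<subseteq> (\<Union>i::nat. U i) \<and> (\<forall>i. ediam (U i) \<le> ennreal \<delta>) \<and>
          (\<Sum>i. hausdorff_gauge s (U i)) \<le> hausdorff_pre s \<delta> (A n) + ennreal (e * (1/2) ^ Suc n)" for n
  proof -
    define c where "c = hausdorff_pre s \<delta> (A n) + ennreal (e * (1/2) ^ Suc n)"
    have "hausdorff_pre s \<delta> (A n) < top"
      using fin ennreal_suminf_lessD by blast
    moreover have "0 < ennreal (e * (1/2) ^ Suc n)" using e by simp
    ultimately have "hausdorff_pre s \<delta> (A n) < c"
      unfolding c_def using ennreal_add_left_cancel_less[of "hausdorff_pre s \<delta> (A n)" 0] by auto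
    then obtain U :: "nat \<Rightarrow> 'a set" where "A n \<subseteq> (\<Union>i. U i)" "\<forall>i. ediam (U i) \<le> ennreal \<delta>"
      "(\<Sum>i. hausdorff_gauge s (U i)) < c"
      unfolding hausdorff_pre_def INF_less_iff by blast
    then show ?thesis unfolding c_def[symmetric] by (intro exI[of _ U]) auto
  qed
  then obtain U where U: "\<And>n. A n \<subseteq> (\<Union>i::nat. U n i)" "\<And>n i. ediam (U n i) \<le> ennreal \<delta>"
    "\<And>n. (\<Sum>i. hausdorff_gauge s (U n i)) \<le> hausdorff_pre s \<delta> (A n) + ennreal (e * (1/2) ^ Suc n)"
    by metis
  define V where "V k = (case prod_decode k of (n, i) \<Rightarrow> U n i)" for k
  have "hausdorff_pre s \<delta> (\<Union>n. A n) \<le> (\<Sum>k. hausdorff_gauge s (V k))"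
  proof (rule hausdorff_pre_le)
    show "\<Union> (range A) \<subseteq> \<Union> (range V)"
    proof
      fix x assume "x \<in> \<Union> (range A)"
      then obtain n i where "x \<in> U n i" using U(1) by blast
      then have "x \<in> V (prod_encode (n, i))" by (simp add: V_def)
      then show "x \<in> \<Union> (range V)" by blast
    qed
  qed (auto simp: V_def U(2) split: prod.split)
  also have "\<dots> = (\<Sum>k. (\<lambda>(n,i). hausdorff_gauge s (U n i)) (prod_decode k))"
    by (simp add: V_def case_prod_unfold)
  also have "\<dots> = (\<Sum>n. \<Sum>i. hausdorff_gauge s (U n i))"
    by (rule suminf_ennreal_2dimen) simp
  also have "\<dots> \<le> (\<Sum>n. hausdorff_pre s \<delta> (A n) + ennreal (e * (1/2) ^ Suc n))"
    by (intro suminf_le U(3)) auto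
  also have "\<dots> = (\<Sum>n. hausdorff_pre s \<delta> (A n)) + (\<Sum>n. ennreal (e * (1/2) ^ Suc n))"
    by (rule suminf_add[symmetric]) auto
  also have "(\<Sum>n. ennreal (e * (1/2) ^ Suc n)) = ennreal e"
  proof (rule suminf_ennreal_eq)
    show "(\<lambda>n. e * (1/2) ^ Suc n) sums e"
      using sums_mult[OF power_half_series, of e] by simp
  qed (use e in auto)
  finally show "hausdorff_pre s \<delta> (\<Union>n. A n) \<le> (\<Sum>n. hausdorff_pre s \<delta> (A n)) + ennreal e" .
qed

lemma hausdorff_pre_le_hausdorff: "0 < \<delta> \<Longrightarrow> hausdorff_pre s \<delta> A \<le> hausdorff s A"
  unfolding hausdorff_def by (rule SUP_upper) simp

lemma hausdorff_mono: "A \<subseteq> B \<Longrightarrow> hausdorff s A \<le> hausdorff s B"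
  unfolding hausdorff_def by (intro SUP_mono) (auto intro: hausdorff_pre_mono)

lemma hausdorff_empty [simp]: "hausdorff s {} = 0"
  unfolding hausdorff_def by (simp add: hausdorff_pre_empty)

lemma hausdorff_countable: "hausdorff s (\<Union>n. A n) \<le> (\<Sum>n. hausdorff s (A n))"
proof -
  have "hausdorff_pre s \<delta> (\<Union>n. A n) \<le> (\<Sum>n. hausdorff s (A n))" if "0 < \<delta>" for \<delta>
    using hausdorff_pre_countable[of s \<delta> A]
      suminf_le[OF hausdorff_pre_le_hausdorff[OF that, of s "A n" for n] summableI summableI]
    by (rule order_trans)
  then show ?thesis unfolding hausdorff_def[of s "\<Union>n. A n"] by (intro SUP_least) auto
qed

lemma outer_measure_space_hausdorff: "outer_measure_space UNIV (hausdorff s)"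
  unfolding outer_measure_space_def positive_def increasing_def countably_subadditive_def
  by (auto intro: hausdorff_mono hausdorff_countable)

lemma hausdorff_Un: "hausdorff s (A \<union> B) \<le> hausdorff s A + hausdorff s B"
proof -
  have "(\<Union>n::nat. if n = 0 then A else if n = 1 then B else {}) = A \<union> B"
    by (auto split: if_splits)
  then have "hausdorff s (A \<union> B) \<le> (\<Sum>n::nat. hausdorff s (if n = 0 then A else if n = 1 then B else {}))"
    using hausdorff_countable[of s "\<lambda>n. if n = 0 then A else if n = 1 then B else {}"] by simp
  also have "\<dots> = (\<Sum>n\<in>{0,1::nat}. hausdorff s (if n = 0 then A else if n = 1 then B else {}))"
    by (rule suminf_finite) auto
  finally show ?thesis by simp
qed

lemma hausdorff_separated:
  assumes d: "0 < d" and sep: "\<And>x y. x \<in> S \<Longrightarrow> y \<in> T \<Longrightarrow> d \<le> dist x y"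
  shows "hausdorff s S + hausdorff s T \<le> hausdorff s (S \<union> T)"
proof -
  have small: "hausdorff_pre s \<delta> S + hausdorff_pre s \<delta> T \<le> hausdorff_pre s \<delta> (S \<union> T)"
    if \<delta>: "0 < \<delta>" "\<delta> < d" for \<delta>
    unfolding hausdorff_pre_def[of s \<delta> "S \<union> T"]
  proof (rule INF_greatest)
    fix U :: "nat \<Rightarrow> 'a set"
    assume "U \<in> {U. S \<union> T \<subseteq> (\<Union>i. U i) \<and> (\<forall>i. ediam (U i) \<le> ennreal \<delta>)}"
    then have U: "S \<union> T \<subseteq> (\<Union>i. U i)" "\<And>i. ediam (U i) \<le> ennreal \<delta>" by auto
    have "hausdorff_pre s \<delta> S \<le> (\<Sum>i. hausdorff_gauge s (U i \<inter> S))"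
      using U by (intro hausdorff_pre_le) (auto intro: order_trans[OF ediam_mono])
    moreover have "hausdorff_pre s \<delta> T \<le> (\<Sum>i. hausdorff_gauge s (U i \<inter> T))"
      using U by (intro hausdorff_pre_le) (auto intro: order_trans[OF ediam_mono])
    ultimately have "hausdorff_pre s \<delta> S + hausdorff_pre s \<delta> T
        \<le> (\<Sum>i. hausdorff_gauge s (U i \<inter> S)) + (\<Sum>i. hausdorff_gauge s (U i \<inter> T))"
      by (rule add_mono)
    also have "\<dots> = (\<Sum>i. hausdorff_gauge s (U i \<inter> S) + hausdorff_gauge s (U i \<inter> T))"
      by (rule suminf_add) auto
    also have "\<dots> \<le> (\<Sum>i. hausdorff_gauge s (U i))"
    proof (intro suminf_le summableI)
      fix i
      have "U i \<inter> S = {} \<or> U i \<inter> T = {}"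
      proof (rule ccontr)
        assume "\<not> ?thesis"
        then obtain x y where xy: "x \<in> U i" "x \<in> S" "y \<in> U i" "y \<in> T" by blast
        have "ennreal (dist x y) \<le> ennreal \<delta>"
          using dist_le_ediam[OF xy(1,3)] U(2)[of i] by (rule order_trans)
        then show False using sep[OF xy(2,4)] \<delta> by (simp add: ennreal_le_iff)
      qed
      then show "hausdorff_gauge s (U i \<inter> S) + hausdorff_gauge s (U i \<inter> T) \<le> hausdorff_gauge s (U i)"
        using hausdorff_gauge_mono[of "U i \<inter> S" "U i" s] hausdorff_gauge_mono[of "U i \<inter> T" "U i" s]
        by (auto simp: hausdorff_gauge_def[of s "{}"])
    qed
    finally show "hausdorff_pre s \<delta> S + hausdorff_pre s \<delta> T \<le> (\<Sum>i. hausdorff_gauge s (U i))" .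
  qed
  have bound: "hausdorff_pre s a S + hausdorff_pre s b T \<le> hausdorff s (S \<union> T)" if "0 < a" "0 < b" for a b
  proof -
    define m where "m = min (min a b) (d/2)"
    have m: "0 < m" "m \<le> a" "m \<le> b" "m < d" using that d by (auto simp: m_def)
    have "hausdorff_pre s a S + hausdorff_pre s b T \<le> hausdorff_pre s m S + hausdorff_pre s m T"
      using m by (intro add_mono hausdorff_pre_antimono)
    also have "\<dots> \<le> hausdorff_pre s m (S \<union> T)" using m by (intro small)
    also have "\<dots> \<le> hausdorff s (S \<union> T)" using m by (intro hausdorff_pre_le_hausdorff)
    finally show ?thesis .
  qed
  have "hausdorff s S + hausdorff s T =
      (SUP a\<in>{0<..}. SUP b\<in>{0<..}. hausdorff_pre s a S + hausdorff_pre s b T)"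
    by (simp add: hausdorff_def ennreal_SUP_add_left[symmetric] ennreal_SUP_add_right[symmetric])
  also have "\<dots> \<le> hausdorff s (S \<union> T)" by (intro SUP_least bound) auto
  finally show ?thesis .
qed

lemma hausdorff_annuli_sum:
  fixes f :: "'a::metric_space \<Rightarrow> real" and a :: "nat \<Rightarrow> real"
  assumes lip: "\<And>x y. f x - f y \<le> dist x y" and a: "\<And>i j. i < j \<Longrightarrow> a j < a i"
  defines "R \<equiv> \<lambda>k. {x. a (Suc k) < f x \<and> f x \<le> a k}"
  shows "(\<Sum>k<n. hausdorff s (X \<inter> R (2 * k + p))) \<le> hausdorff s (\<Union>k<n. X \<inter> R (2 * k + p))"
proof (induction n)
  case (Suc n)
  define d where "d = (if n = 0 then 1 else a (2 * n + p - 1) - a (2 * n + p))"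
  have d: "0 < d" using a[of "2 * n + p - 1" "2 * n + p"] by (auto simp: d_def)
  have sep: "d \<le> dist x y"
    if x: "x \<in> (\<Union>k<n. X \<inter> R (2 * k + p))" and y: "y \<in> X \<inter> R (2 * n + p)" for x y
  proof -
    obtain k where k: "k < n" "a (Suc (2 * k + p)) < f x" using x by (auto simp: R_def)
    have "a (2 * n + p - 1) \<le> a (Suc (2 * k + p))"
    proof (cases "Suc (2 * k + p) = 2 * n + p - 1")
      case False
      then show ?thesis using k(1) by (intro less_imp_le a) linarith
    qed simp
    moreover have "f y \<le> a (2 * n + p)" using y by (simp add: R_def)
    ultimately have "d \<le> f x - f y" using k by (simp add: d_def)
    then show ?thesis using lip[of x y] by linarith
  qed
  have "(\<Sum>k<Suc n. hausdorff s (X \<inter> R (2 * k + p)))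
      \<le> hausdorff s (\<Union>k<n. X \<inter> R (2 * k + p)) + hausdorff s (X \<inter> R (2 * n + p))"
    using Suc.IH by (simp add: add_mono)
  also have "\<dots> \<le> hausdorff s ((\<Union>k<n. X \<inter> R (2 * k + p)) \<union> (X \<inter> R (2 * n + p)))"
    by (rule hausdorff_separated[OF d sep])
  finally show ?case by (simp add: lessThan_Suc Un_commute)
qed simp

lemma hausdorff_closed_caratheodory:
  fixes C :: "'a::metric_space set"
  assumes C: "closed C"
  shows "hausdorff s (X \<inter> C) + hausdorff s (X - C) \<le> hausdorff s X"
proof (cases "C = {} \<or> hausdorff s X = \<infinity>")
  case False
  then have ne: "C \<noteq> {}" and fin: "hausdorff s X < \<infinity>" by (auto simp: top.not_eq_extremum)
  define f where "f x = infdist x C" for x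
  define a where "a n = 1 / (real n + 1)" for n
  define R where "R k = {x. a (Suc k) < f x \<and> f x \<le> a k}" for k
  define Y where "Y n = {x. a n < f x}" for n
  have lip: "f x - f y \<le> dist x y" for x y
    unfolding f_def using infdist_triangle[of x C y] by simp
  have a: "a j < a i" if "i < j" for i j
    using that unfolding a_def by (intro divide_strict_left_mono) auto
  have a0: "0 < a n" for n by (simp add: a_def)
  have parity: "(\<Sum>k<n. hausdorff s (X \<inter> R (2 * k + p))) \<le> hausdorff s X" for n p
    using hausdorff_annuli_sum[where f = f and a = a and n = n and s = s and X = X and p = p, OF lip a, folded R_def]
      hausdorff_mono[of "\<Union>k<n. X \<inter> R (2 * k + p)" X s] by (auto intro: order_trans)
  have split: "(\<Sum>k<2 * n. g k) = (\<Sum>k<n. g (2 * k + 0)) + (\<Sum>k<n. g (2 * k + 1))"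
    for g :: "nat \<Rightarrow> ennreal" and n
    by (induction n) (simp_all add: ac_simps)
  define S where "S = (\<Sum>k. hausdorff s (X \<inter> R k))"
  have "S \<le> hausdorff s X + hausdorff s X"
    unfolding S_def
  proof (rule suminf_le_const[OF summableI])
    fix n
    have "(\<Sum>k<n. hausdorff s (X \<inter> R k)) \<le> (\<Sum>k<2 * n. hausdorff s (X \<inter> R k))"
      by (rule sum_mono2) auto
    also have "\<dots> \<le> hausdorff s X + hausdorff s X"
      unfolding split by (intro add_mono parity)
    finally show "(\<Sum>k<n. hausdorff s (X \<inter> R k)) \<le> hausdorff s X + hausdorff s X" .
  qed
  also have "\<dots> < \<infinity>" using fin by simp
  finally have S: "S \<noteq> \<infinity>" by simp
  have tail: "hausdorff s (X \<inter> C) + hausdorff s (X - C) + (\<Sum>k<n. hausdorff s (X \<inter> R k)) \<le> hausdorff s X + S" for n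
  proof -
    have sub: "X - C \<subseteq> X \<inter> Y n \<union> (\<Union>k. X \<inter> R (k + n))"
    proof
      fix x assume x: "x \<in> X - C"
      have fx: "0 < f x"
        using x C ne unfolding f_def
        by (metis DiffD2 in_closed_iff_infdist_zero infdist_nonneg less_eq_real_def)
      show "x \<in> X \<inter> Y n \<union> (\<Union>k. X \<inter> R (k + n))"
      proof (cases "a n < f x")
        case False
        obtain m where m: "a m < f x"
          using reals_Archimedean[OF fx] by (auto simp: a_def inverse_eq_divide add.commute)
        define l where "l = (LEAST m. a m < f x)"
        have l: "a l < f x" unfolding l_def by (rule LeastI[of "\<lambda>m. a m < f x", OF m])
        have "n < l"
        proof (rule ccontr)
          assume "\<not> n < l"
          then have "a n \<le> a l" using a[of l n] by (cases "l = n") auto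
          then show False using l False by simp
        qed
        moreover have "\<not> a (l - 1) < f x"
          using \<open>n < l\<close> not_less_Least[of "l - 1" "\<lambda>m. a m < f x"] unfolding l_def[symmetric] by simp
        ultimately have "x \<in> R ((l - 1 - n) + n)" using l by (simp add: R_def)
        then show ?thesis using x by blast
      qed (use x in \<open>auto simp: Y_def\<close>)
    qed
    have sep: "a n \<le> dist x y" if "x \<in> X \<inter> C" "y \<in> X \<inter> Y n" for x y
      using that infdist_le[of x C y] by (simp add: Y_def f_def dist_commute)
    have "hausdorff s (X - C) \<le> hausdorff s (X \<inter> Y n) + hausdorff s (\<Union>k. X \<inter> R (k + n))"
      using hausdorff_mono[OF sub] hausdorff_Un by (rule order_trans)
    also have "\<dots> \<le> hausdorff s (X \<inter> Y n) + (\<Sum>k. hausdorff s (X \<inter> R (k + n)))"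
      by (intro add_left_mono hausdorff_countable)
    finally have "hausdorff s (X \<inter> C) + hausdorff s (X - C) + (\<Sum>k<n. hausdorff s (X \<inter> R k))
        \<le> hausdorff s (X \<inter> C) + (hausdorff s (X \<inter> Y n) + (\<Sum>k. hausdorff s (X \<inter> R (k + n))))
            + (\<Sum>k<n. hausdorff s (X \<inter> R k))"
      by (intro add_mono order_refl)
    also have "\<dots> = (hausdorff s (X \<inter> C) + hausdorff s (X \<inter> Y n)) + S"
      unfolding S_def
      by (subst suminf_offset[of "\<lambda>k. hausdorff s (X \<inter> R k)" n]) (simp_all only: summableI ac_simps)
    also have "\<dots> \<le> hausdorff s (X \<inter> C \<union> X \<inter> Y n) + S"
      by (intro add_right_mono hausdorff_separated[OF a0 sep])
    also have "\<dots> \<le> hausdorff s X + S"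
      by (intro add_right_mono hausdorff_mono) auto
    finally show ?thesis .
  qed
  have "hausdorff s (X \<inter> C) + hausdorff s (X - C) + S
      = (SUP n. hausdorff s (X \<inter> C) + hausdorff s (X - C) + (\<Sum>k<n. hausdorff s (X \<inter> R k)))"
    unfolding S_def suminf_eq_SUP by (rule ennreal_SUP_add_right) simp
  also have "\<dots> \<le> hausdorff s X + S" by (intro SUP_least tail)
  finally show ?thesis using S by (simp add: add.commute[of _ S] ennreal_add_left_cancel_le)
qed auto

lemma measure_space_hausdorff: "measure_space UNIV (sets borel) (hausdorff s)"
proof -
  interpret P: sigma_algebra UNIV "UNIV :: 'a set set" using sigma_algebra_Pow[of UNIV] by simp
  let ?L = "lambda_system UNIV UNIV (hausdorff s) :: 'a set set"
  have L: "measure_space UNIV ?L (hausdorff s)"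
    by (rule P.caratheodory_lemma[OF outer_measure_space_hausdorff])
  then interpret L: sigma_algebra UNIV ?L by (simp add: measure_space_def)
  have "C \<in> ?L" if "closed C" for C :: "'a set"
    unfolding P.lambda_system_eq
    using hausdorff_closed_caratheodory[OF that] hausdorff_Un[of s "X \<inter> C" "X - C" for X]
    by (auto simp: Int_Diff_Un intro!: antisym)
  then have "{S. open S} \<subseteq> ?L"
    using L.compl_sets by (metis Compl_eq_Diff_UNIV closed_Compl double_complement mem_Collect_eq subsetI)
  then have "sets borel \<subseteq> ?L"
    unfolding sets_borel by (rule L.sigma_sets_subset)
  then show ?thesis
    using L sets.sigma_algebra_axioms[of "borel :: 'a measure"]
    by (auto simp: measure_space_def countably_additive_def positive_def)
qed

lemma sets_hausdorff_measure [simp, measurable_cong]: "sets (hausdorff_measure s) = sets borel"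
  unfolding hausdorff_measure_def by (simp add: sets.sigma_sets_eq[of borel, simplified])

lemma space_hausdorff_measure [simp]: "space (hausdorff_measure s) = UNIV"
  unfolding hausdorff_measure_def by simp

lemma emeasure_hausdorff_measure:
  "A \<in> sets borel \<Longrightarrow> emeasure (hausdorff_measure s) A = hausdorff s A"
  by (rule emeasure_measure_of_sigma[of UNIV "sets borel" "hausdorff s" A, folded hausdorff_measure_def])
    (use measure_space_hausdorff[of s] in \<open>auto simp: measure_space_def\<close>)


section \<open>The first Heisenberg group\<close>

text \<open>
  The Heisenberg group is a separate type, so that \<^const>\<open>dist\<close>, \<^const>\<open>ball\<close>,
  \<^const>\<open>infdist\<close>, \<^const>\<open>closed\<close>, \<^const>\<open>borel\<close> and the Hausdorff
  measures refer to the metric \<open>d\<close>. The non-commutative group structure is an instance of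
  \<^class>\<open>group_add\<close>: \<open>p + q\<close> is the group product, \<open>0\<close> the identity and
  \<open>- p\<close> the inverse.
\<close>

datatype heis = Heis (hx: real) (hy: real) (ht: real)

instantiation heis :: group_add
begin

definition zero_heis :: heis where
  "0 = Heis 0 0 0"

definition plus_heis :: "heis \<Rightarrow> heis \<Rightarrow> heis" where
  "p + q = Heis (hx p + hx q) (hy p + hy q) (ht p + ht q + (hx p * hy q - hy p * hx q) / 2)"

definition uminus_heis :: "heis \<Rightarrow> heis" where
  "- p = Heis (- hx p) (- hy p) (- ht p)"

definition minus_heis :: "heis \<Rightarrow> heis \<Rightarrow> heis" where
  "p - q = p + (- q)" for p q :: heis

instance
  by standard (auto simp: zero_heis_def plus_heis_def uminus_heis_def minus_heis_def field_simps)

end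

definition knorm :: "heis \<Rightarrow> real" where
  "knorm p = root 4 (((hx p)\<^sup>2 + (hy p)\<^sup>2)\<^sup>2 + 16 * (ht p)\<^sup>2)"

lemma knorm_power2: "(knorm p)\<^sup>2 = cmod (Complex ((hx p)\<^sup>2 + (hy p)\<^sup>2) (4 * ht p))"
proof -
  let ?u = "((hx p)\<^sup>2 + (hy p)\<^sup>2)\<^sup>2 + 16 * (ht p)\<^sup>2"
  have "((knorm p)\<^sup>2)\<^sup>2 = root 4 ?u ^ 4" by (simp add: knorm_def flip: power_mult)
  also have "\<dots> = ?u" by (rule real_root_pow_pos2) auto
  finally have "(knorm p)\<^sup>2 = sqrt ?u" by (metis real_sqrt_abs2 abs_of_nonneg power2_eq_square zero_le_power2)
  then show ?thesis by (simp add: cmod_def power_mult_distrib)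
qed

lemma knorm_nonneg [simp]: "0 \<le> knorm p"
  by (simp add: knorm_def)

lemma knorm_uminus [simp]: "knorm (- p) = knorm p"
  by (simp add: knorm_def uminus_heis_def)

lemma knorm_eq_0_iff: "knorm p = 0 \<longleftrightarrow> p = 0"
proof -
  have "knorm p = 0 \<longleftrightarrow> Complex ((hx p)\<^sup>2 + (hy p)\<^sup>2) (4 * ht p) = 0"
    using knorm_power2[of p] by (metis norm_eq_zero power_eq_0_iff zero_less_numeral)
  also have "\<dots> \<longleftrightarrow> p = 0"
    by (cases p) (auto simp: zero_heis_def complex_eq_iff sum_power2_eq_zero_iff)
  finally show ?thesis .
qed

lemma knorm_triangle: "knorm (p + q) \<le> knorm p + knorm q"
proof (rule power2_le_imp_le)
  obtain x y t where p: "p = Heis x y t" by (cases p)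
  obtain x' y' t' where q: "q = Heis x' y' t'" by (cases q)
  define z z' a b where "z = Complex x y" and "z' = Complex x' y'"
    and "a = Complex (x\<^sup>2 + y\<^sup>2) (4 * t)" and "b = Complex (x'\<^sup>2 + y'\<^sup>2) (4 * t')"
  have a: "cmod a = (knorm p)\<^sup>2" and b: "cmod b = (knorm q)\<^sup>2"
    by (simp_all add: a_def b_def p q knorm_power2)
  have "(cmod z)\<^sup>2 \<le> cmod a"
    using complex_Re_le_cmod[of a] by (simp add: z_def a_def cmod_power2)
  then have z: "cmod z \<le> knorm p" unfolding a by (rule power2_le_imp_le) simp
  have "(cmod z')\<^sup>2 \<le> cmod b"
    using complex_Re_le_cmod[of b] by (simp add: z'_def b_def cmod_power2)
  then have z': "cmod z' \<le> knorm q" unfolding b by (rule power2_le_imp_le) simp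
  have "(knorm (p + q))\<^sup>2 = cmod (a + b + 2 * (cnj z * z'))"
    unfolding knorm_power2
    by (rule arg_cong[of _ _ cmod])
      (simp add: p q plus_heis_def a_def b_def z_def z'_def complex_eq_iff power2_eq_square field_simps)
  also have "\<dots> \<le> cmod a + cmod b + 2 * (cmod z * cmod z')"
    by (intro order_trans[OF norm_triangle_ineq] add_mono norm_triangle_ineq)
      (simp add: norm_mult)
  also have "\<dots> \<le> (knorm p)\<^sup>2 + (knorm q)\<^sup>2 + 2 * (knorm p * knorm q)"
    unfolding a b using z z' by (intro add_mono mult_left_mono mult_mono) auto
  finally show "(knorm (p + q))\<^sup>2 \<le> (knorm p + knorm q)\<^sup>2"
    by (simp add: power2_sum algebra_simps)
qed simp

instantiation heis :: metric_space
begin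

definition dist_heis :: "heis \<Rightarrow> heis \<Rightarrow> real" where
  "dist p q = knorm (- q + p)"

definition uniformity_heis :: "(heis \<times> heis) filter" where
  "uniformity = (INF e\<in>{0<..}. principal {(p :: heis, q). dist p q < e})"

definition open_heis :: "heis set \<Rightarrow> bool" where
  "open U \<longleftrightarrow> (\<forall>p\<in>U. \<forall>\<^sub>F (p', q) in uniformity. p' = p \<longrightarrow> q \<in> U)" for U :: "heis set"

instance
proof
  fix p q r :: heis
  show "dist p q = 0 \<longleftrightarrow> p = q"
    by (metis dist_heis_def knorm_eq_0_iff add_eq_0_iff minus_minus neg_eq_iff_add_eq_0)
  have "dist p q \<le> dist r q + dist p r"
    using knorm_triangle[of "- q + r" "- r + p"] by (simp add: dist_heis_def add.assoc)
  moreover have "dist r q = dist q r"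
    using knorm_uminus[of "- q + r"] by (simp add: dist_heis_def minus_add)
  ultimately show "dist p q \<le> dist p r + dist q r" by simp
qed (simp_all add: uniformity_heis_def open_heis_def)

end


section \<open>Regular sets and vertical planes\<close>

text \<open>Measurability with respect to the Hausdorff measure is understood in the sense of Caratheodory.\<close>

definition three_regular :: "heis set \<Rightarrow> bool" where
  "three_regular E \<longleftrightarrow>
     E \<in> lambda_system UNIV UNIV (hausdorff 3) \<and>
     (\<exists>A\<ge>1. \<forall>p\<in>E. \<forall>r>0. ennreal r \<le> ediam E \<longrightarrow>
        ennreal (r ^ 3 / A) \<le> hausdorff 3 (E \<inter> ball p r) \<and>
        hausdorff 3 (E \<inter> ball p r) \<le> ennreal (A * r ^ 3))"

definition vertical_plane :: "heis set \<Rightarrow> bool" where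
  "vertical_plane W \<longleftrightarrow>
     (\<exists>V :: (real \<times> real \<times> real) set. \<exists>p.
        subspace V \<and> dim V = 2 \<and> (\<forall>t. (0, 0, t) \<in> V) \<and>
        W = (\<lambda>q. p + q) ` {q. (hx q, hy q, ht q) \<in> V})"

definition vertical_beta :: "heis set \<Rightarrow> heis \<Rightarrow> real \<Rightarrow> ennreal" where
  "vertical_beta E p r =
     (INF W\<in>{W. vertical_plane W}. SUP y\<in>ball p r \<inter> E. ennreal (infdist y W / r))"


section \<open>Admissible kernels\<close>

primrec Ck_on :: "nat \<Rightarrow> ('a::real_normed_vector \<Rightarrow> 'b::real_normed_vector) \<Rightarrow> 'a set \<Rightarrow> bool" where
  "Ck_on 0 f S \<longleftrightarrow> continuous_on S f"
| "Ck_on (Suc k) f S \<longleftrightarrow>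
     (\<forall>x\<in>S. f differentiable (at x)) \<and> (\<forall>v. Ck_on k (\<lambda>x. frechet_derivative f (at x) v) S)"

text \<open>The derivatives are taken in the whole space, so \<open>S\<close> is meant to be open.\<close>

definition smooth_on :: "('a::real_normed_vector \<Rightarrow> 'b::real_normed_vector) \<Rightarrow> 'a set \<Rightarrow> bool" where
  "smooth_on f S \<longleftrightarrow> (\<forall>k. Ck_on k f S)"

definition vf_X :: "(heis \<Rightarrow> real) \<Rightarrow> heis \<Rightarrow> real" where
  "vf_X K p = deriv (\<lambda>x. K (Heis x (hy p) (ht p))) (hx p)
     - hy p / 2 * deriv (\<lambda>t. K (Heis (hx p) (hy p) t)) (ht p)"

definition vf_Y :: "(heis \<Rightarrow> real) \<Rightarrow> heis \<Rightarrow> real" where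
  "vf_Y K p = deriv (\<lambda>y. K (Heis (hx p) y (ht p))) (hy p)
     + hx p / 2 * deriv (\<lambda>t. K (Heis (hx p) (hy p) t)) (ht p)"

primrec horizontal_derivs :: "nat \<Rightarrow> (heis \<Rightarrow> real) \<Rightarrow> (heis \<Rightarrow> real) set" where
  "horizontal_derivs 0 K = {K}"
| "horizontal_derivs (Suc j) K = vf_X ` horizontal_derivs j K \<union> vf_Y ` horizontal_derivs j K"

definition hconj :: "heis \<Rightarrow> heis" where
  "hconj p = Heis (- hx p) (- hy p) (ht p)"

text \<open>
  Kernels are total functions whose value at the identity is irrelevant. The size of the collection
  of \<open>j\<close>-fold derivatives is measured by its largest member; as the collection has at most
  \<open>2 ^ j\<close> members, any other norm gives the same notion.
\<close>

definition admissible_kernel :: "(heis \<Rightarrow> real) \<Rightarrow> bool" where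
  "admissible_kernel K \<longleftrightarrow>
     smooth_on (\<lambda>(x, y, t). K (Heis x y t)) (- {(0, 0, 0)}) \<and>
     (\<forall>p. p \<noteq> 0 \<longrightarrow> K (hconj p) = - K p) \<and>
     (\<forall>j. \<exists>C. \<forall>D\<in>horizontal_derivs j K. \<forall>p. p \<noteq> 0 \<longrightarrow>
        \<bar>D p\<bar> \<le> C * knorm p powr (- 3 - real j))"


section \<open>Singular integrals\<close>

text \<open>
  Complex measures \<open>\<nu>\<close> only occur in the form \<open>\<nu> = f \<mu>\<close> with
  \<open>f\<close> integrable, for which \<open>d\<nu>(q) = f(q) d\<mu>(q)\<close>.
\<close>

definition truncated_sio ::
  "(heis \<Rightarrow> real) \<Rightarrow> real \<Rightarrow> heis measure \<Rightarrow> (heis \<Rightarrow> complex) \<Rightarrow> heis \<Rightarrow> complex" where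
  "truncated_sio K \<epsilon> \<mu> f p = (LINT q:{q. knorm (- q + p) > \<epsilon>}|\<mu>. K (- q + p) *\<^sub>R f q)"

definition in_L2 :: "'a measure \<Rightarrow> ('a \<Rightarrow> complex) \<Rightarrow> bool" where
  "in_L2 \<mu> f \<longleftrightarrow> f \<in> borel_measurable \<mu> \<and> integrable \<mu> (\<lambda>x. (cmod (f x))\<^sup>2)"

definition L2_norm :: "'a measure \<Rightarrow> ('a \<Rightarrow> complex) \<Rightarrow> real" where
  "L2_norm \<mu> f = sqrt (LINT x|\<mu>. (cmod (f x))\<^sup>2)"

definition sio_bounded_L2 :: "(heis \<Rightarrow> real) \<Rightarrow> heis measure \<Rightarrow> bool" where
  "sio_bounded_L2 K \<mu> \<longleftrightarrow>
     (\<exists>C\<ge>1. \<forall>\<epsilon>>0. \<forall>f. integrable \<mu> f \<and> in_L2 \<mu> f \<longrightarrow>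
        in_L2 \<mu> (truncated_sio K \<epsilon> \<mu> f) \<and>
        L2_norm \<mu> (truncated_sio K \<epsilon> \<mu> f) \<le> C * L2_norm \<mu> f)"

text \<open>The restriction of \<open>\<H>\<^sup>3\<close> to a Borel set \<open>E\<close>, as a Borel measure on the whole space.\<close>

definition hausdorff3_on :: "heis set \<Rightarrow> heis measure" where
  "hausdorff3_on E = density (hausdorff_measure 3) (indicator E)"

lemma emeasure_hausdorff3_on:
  assumes "E \<in> sets borel" "A \<in> sets borel"
  shows "emeasure (hausdorff3_on E) A = hausdorff 3 (E \<inter> A)"
proof -
  have "emeasure (hausdorff3_on E) A
      = (\<integral>\<^sup>+p. indicator E p * indicator A p \<partial>hausdorff_measure 3)"
    unfolding hausdorff3_on_def using assms by (intro emeasure_density) auto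
  also have "\<dots> = (\<integral>\<^sup>+p. indicator (E \<inter> A) p \<partial>hausdorff_measure 3)"
    by (simp add: indicator_inter_arith)
  also have "\<dots> = hausdorff 3 (E \<inter> A)"
    using assms by (simp add: emeasure_hausdorff_measure sets.Int)
  finally show ?thesis .
qed

end

theory Submission
  imports Defs
begin

text \<open>
  Let \<open>\<psi>\<close> be a smooth horizontally antisymmetric bump supported in an annulus and \<open>\<psi>\<^sub>j\<close> its
  rescaling to scale \<open>2\<^sup>j\<close>. Every series \<open>\<Sum> s\<^sub>j \<psi>\<^sub>j\<close> with bounded coefficients is an admissible kernel,
  so a suitable choice of signs together with a gliding hump argument turns the hypothesis into
  a Carleson estimate for the square function \<open>\<Sum> |\<psi>\<^sub>j * \<mu>|\<^sup>2\<close>. If \<open>\<psi>\<^sub>j * \<mu>\<close> is small near a point for finitely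
  many well-chosen \<open>\<psi>\<close> then \<open>E\<close> is there almost invariant under the maps \<open>q \<mapsto> u \<cdot> \<sigma>(u\<^sup>-\<^sup>1 \<cdot> q)\<close> with
  \<open>u \<in> E\<close>, where \<open>\<sigma>(x,y,t) = (-x,-y,t)\<close>. Products of two such maps are left translations. If \<open>E\<close> is not
  close to a vertical plane they generate a lattice, whose growth is four-dimensional and
  contradicts 3-regularity. Hence large \<open>\<beta>\<close>-numbers force \<open>\<psi>\<^sub>j * \<mu>\<close> to be large for one of the \<open>\<psi>\<close>.
\<close>

section \<open>Geometry of the Heisenberg group\<close>

text \<open>The hypothesis is qualitative: each kernel comes with its own L2 constant, and nothing
  relates the constants of different kernels. For this reason one bad sign sequence has to be
  assembled from many finite windows, and finite windows must be visible to the truncations. The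
  bumps are therefore supported strictly inside one dyadic annulus: a truncation at a dyadic radius
  then cuts no summand, and the difference of two truncations of one kernel is exactly a finite sum.

  A second obstacle is that a convolution which is large at a single centre is invisible in L2.
  Asymmetry has to be stable under moving the centre; reflections depend continuously on it, and a
  finite bump family obtained by compactness serves a whole ball of centres at once.

  Dimension four enters because heights scale quadratically: with \<open>i\<close> and
  \<open>j\<close> up to \<open>n\<close> the index \<open>k\<close> may run up to
  \<open>n ^ 2\<close>, so \<open>n ^ 4\<close> points at mutual distance of order \<open>r\<close>
  lie in a ball of radius of order \<open>n * r\<close>, where 3-regularity leaves room for about
  \<open>n ^ 3\<close>.\<close>

lemma heis_arith [simp]:
  "Heis x y t + Heis x' y' t' = Heis (x + x') (y + y') (t + t' + (x * y' - x' * y) / 2)"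
  "- Heis x y t = Heis (- x) (- y) (- t)"
  by (simp_all add: plus_heis_def uminus_heis_def algebra_simps)

lemma heis_sel_arith [simp]:
  "hx (p + q) = hx p + hx q" "hy (p + q) = hy p + hy q"
  "ht (p + q) = ht p + ht q + (hx p * hy q - hx q * hy p) / 2"
  "hx (- p) = - hx p" "hy (- p) = - hy p" "ht (- p) = - ht p"
  "hx (p - q) = hx p - hx q" "hy (p - q) = hy p - hy q"
  "ht (p - q) = ht p - ht q - (hx p * hy q - hx q * hy p) / 2"
  "hx 0 = 0" "hy 0 = 0" "ht 0 = 0"
  by (simp_all add: plus_heis_def uminus_heis_def minus_heis_def zero_heis_def algebra_simps
      diff_divide_distrib)

lemma hconj_sel [simp]: "hx (hconj p) = - hx p" "hy (hconj p) = - hy p" "ht (hconj p) = ht p"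
  by (simp_all add: hconj_def)

lemma heis_eqI: "hx p = hx q \<Longrightarrow> hy p = hy q \<Longrightarrow> ht p = ht q \<Longrightarrow> p = q"
  by (simp add: heis.expand)

lemma hconj_plus: "hconj (p + q) = hconj p + hconj q"
  by (simp add: heis.expand)

lemma hconj_uminus: "hconj (- p) = - hconj p"
  by (simp add: heis.expand)

lemma hconj_hconj [simp]: "hconj (hconj p) = p"
  by (simp add: heis.expand)

lemma knorm_hconj [simp]: "knorm (hconj p) = knorm p"
  by (simp add: knorm_def)

section \<open>Dilations and size estimates for the gauge\<close>

definition dil :: "real \<Rightarrow> heis \<Rightarrow> heis" where
  "dil l p = Heis (l * hx p) (l * hy p) (l\<^sup>2 * ht p)"

lemma dil_sel [simp]: "hx (dil l p) = l * hx p" "hy (dil l p) = l * hy p" "ht (dil l p) = l\<^sup>2 * ht p"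
  by (simp_all add: dil_def)

lemma dil_plus: "dil l (p + q) = dil l p + dil l q"
  by (simp add: heis.expand power2_eq_square algebra_simps)

lemma dil_uminus: "dil l (- p) = - dil l p"
  by (simp add: heis.expand)

lemma dil_hconj: "dil l (hconj p) = hconj (dil l p)"
  by (simp add: heis.expand)

lemma knorm_dil: "knorm (dil l p) = \<bar>l\<bar> * knorm p"
proof -
  have "((l * hx p)\<^sup>2 + (l * hy p)\<^sup>2)\<^sup>2 + 16 * (l\<^sup>2 * ht p)\<^sup>2
      = \<bar>l\<bar> ^ 4 * (((hx p)\<^sup>2 + (hy p)\<^sup>2)\<^sup>2 + 16 * (ht p)\<^sup>2)"
    by (simp add: algebra_simps power2_eq_square power4_eq_xxxx)
  moreover have "root 4 (\<bar>l\<bar> ^ 4) = \<bar>l\<bar>" by (rule real_root_power_cancel) auto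
  ultimately show ?thesis by (simp add: knorm_def real_root_mult)
qed

lemma knorm_pow4: "knorm p ^ 4 = ((hx p)\<^sup>2 + (hy p)\<^sup>2)\<^sup>2 + 16 * (ht p)\<^sup>2"
  unfolding knorm_def by (rule real_root_pow_pos2) auto

lemma horizontal_le_knorm: "sqrt ((hx p)\<^sup>2 + (hy p)\<^sup>2) \<le> knorm p"
proof (rule power_le_imp_le_base[where n = 3])
  have "sqrt ((hx p)\<^sup>2 + (hy p)\<^sup>2) ^ 4 = ((hx p)\<^sup>2 + (hy p)\<^sup>2)\<^sup>2"
    using power_mult[of "sqrt ((hx p)\<^sup>2 + (hy p)\<^sup>2)" 2 2] by simp
  also have "\<dots> \<le> knorm p ^ 4" by (simp add: knorm_pow4)
  finally show "sqrt ((hx p)\<^sup>2 + (hy p)\<^sup>2) ^ Suc 3 \<le> knorm p ^ Suc 3" by simp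
qed simp

lemma abs_hx_le_knorm: "\<bar>hx p\<bar> \<le> knorm p" and abs_hy_le_knorm: "\<bar>hy p\<bar> \<le> knorm p"
  using horizontal_le_knorm[of p] real_sqrt_sum_squares_ge1[of "hx p" "hy p"]
    real_sqrt_sum_squares_ge2[of "hy p" "hx p"]
    real_sqrt_ge_abs1[of "hx p" "hy p"] real_sqrt_ge_abs2[of "hy p" "hx p"] by linarith+

lemma abs_ht_le_knorm: "4 * \<bar>ht p\<bar> \<le> (knorm p)\<^sup>2"
proof (rule power2_le_imp_le)
  have "(4 * \<bar>ht p\<bar>)\<^sup>2 \<le> knorm p ^ 4" by (simp add: knorm_pow4 power_mult_distrib)
  then show "(4 * \<bar>ht p\<bar>)\<^sup>2 \<le> ((knorm p)\<^sup>2)\<^sup>2" by (simp flip: power_mult)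
qed simp

text \<open>Triangle inequality for the factorisation of \<open>p\<close> into a horizontal and a
  central element. The root of the height is the source of the square roots in the error estimates
  below.\<close>

lemma knorm_le: "knorm p \<le> sqrt ((hx p)\<^sup>2 + (hy p)\<^sup>2) + 2 * sqrt \<bar>ht p\<bar>"
proof -
  have a: "knorm (Heis (hx p) (hy p) 0) = sqrt ((hx p)\<^sup>2 + (hy p)\<^sup>2)"
  proof (rule power_eq_imp_eq_base[where n = 4])
    show "knorm (Heis (hx p) (hy p) 0) ^ 4 = sqrt ((hx p)\<^sup>2 + (hy p)\<^sup>2) ^ 4"
      using power_mult[of "sqrt ((hx p)\<^sup>2 + (hy p)\<^sup>2)" 2 2] by (simp add: knorm_pow4)
  qed auto
  have b: "knorm (Heis 0 0 (ht p)) = 2 * sqrt \<bar>ht p\<bar>"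
  proof (rule power_eq_imp_eq_base[where n = 4])
    show "knorm (Heis 0 0 (ht p)) ^ 4 = (2 * sqrt \<bar>ht p\<bar>) ^ 4"
      using power_mult[of "sqrt \<bar>ht p\<bar>" 2 2] by (simp add: knorm_pow4 power_mult_distrib)
  qed auto
  have "p = Heis (hx p) (hy p) 0 + Heis 0 0 (ht p)" by (simp add: heis.expand)
  then show ?thesis using knorm_triangle a b by metis
qed

lemma dist_plus_left [simp]: "dist (g + p) (g + q) = dist p (q :: heis)"
proof -
  have "- (g + q) + (g + p) = - q + p" by (rule heis_eqI) (simp_all add: field_simps)
  then show ?thesis by (simp add: dist_heis_def)
qed

lemma dist_hconj [simp]: "dist (hconj p) (hconj q) = dist p q"
  by (metis dist_heis_def hconj_plus hconj_uminus knorm_hconj)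

text \<open>A measure that annihilates all horizontally antisymmetric kernels centred at \<open>u\<close>
  is invariant under the following isometric involution.\<close>

definition hsym :: "heis \<Rightarrow> heis \<Rightarrow> heis" where
  "hsym u v = u + hconj (- u + v)"

lemma dist_hsym [simp]: "dist (hsym u p) (hsym u q) = dist p q"
  by (simp add: hsym_def)

lemma hsym_hsym [simp]: "hsym u (hsym u v) = v"
  by (simp add: hsym_def hconj_plus hconj_uminus add.assoc flip: add.assoc[of "- u" u])

lemma hsym_self [simp]: "hsym u u = u"
  by (simp add: hsym_def heis.expand)

lemma hsym_plus_left: "hsym (p + u) (p + v) = p + hsym u v"
  by (rule heis_eqI) (simp_all add: hsym_def field_simps)

text \<open>A convolution at \<open>u\<close> sees the point \<open>q\<close> through
  \<open>- q + u\<close>. Reflecting \<open>q\<close> in \<open>u\<close> applies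
  \<open>hconj\<close> to this argument, so an antisymmetrized bump compares the mass near a point
  with the mass near its mirror image.\<close>

lemma uminus_hsym: "- hsym u v + u = hconj (- v + u)"
  by (simp add: hsym_def minus_add hconj_plus hconj_uminus add.assoc)

text \<open>Only the horizontal part is reflected. If \<open>v\<close> lies in \<open>E\<close> and
  \<open>hsym u v\<close> is far from \<open>E\<close>, then \<open>hsym u v\<close> is in
  particular far from \<open>v\<close>, and this identity keeps \<open>u\<close> away from
  \<open>v\<close>; the bumps need such a lower bound.\<close>

lemma dist_hsym_right:
  "dist (hsym u v) v = 2 * sqrt ((hx (- v + u))\<^sup>2 + (hy (- v + u))\<^sup>2)"
proof -
  define w where "w = - v + u"
  have "- v + hsym u v = w + hconj (- w)"
    by (simp add: w_def hsym_def minus_add add.assoc)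
  also have "\<dots> = Heis (2 * hx w) (2 * hy w) 0" by (simp add: heis.expand)
  finally have "dist (hsym u v) v = knorm (Heis (2 * hx w) (2 * hy w) 0)"
    by (simp add: dist_heis_def)
  also have "\<dots> = 2 * sqrt ((hx w)\<^sup>2 + (hy w)\<^sup>2)"
  proof (rule power_eq_imp_eq_base[where n = 4])
    show "knorm (Heis (2 * hx w) (2 * hy w) 0) ^ 4 = (2 * sqrt ((hx w)\<^sup>2 + (hy w)\<^sup>2)) ^ 4"
      using power_mult[of "sqrt ((hx w)\<^sup>2 + (hy w)\<^sup>2)" 2 2]
      by (simp add: knorm_pow4 power_mult_distrib)
         (simp add: power2_eq_square power4_eq_xxxx algebra_simps)
  qed auto
  finally show ?thesis by (simp add: w_def)
qed

text \<open>Reflections depend on the centre only with Hoelder exponent 1/2: shifting the centre by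
  \<open>h\<close> adds a height of order \<open>s * l\<close>, coming from the commutator of
  \<open>h\<close> with \<open>- u + v\<close>, and the gauge takes roots of heights.\<close>

lemma dist_hsym_centre:
  assumes h: "dist u' u \<le> s" and a: "dist u v \<le> l"
  shows "dist (hsym u' v) (hsym u v) \<le> 2 * s + 4 * sqrt (s * (l + s))"
proof -
  define h a where "h = - u + u'" and "a = - u + v"
  have u': "u' = u + h" by (simp add: h_def flip: add.assoc)
  have kh: "knorm h \<le> s" using h by (simp add: dist_heis_def h_def)
  have ka: "knorm a \<le> l" using a
    by (metis a_def dist_commute dist_heis_def)
  have s0: "0 \<le> s" and l0: "0 \<le> l" using kh ka knorm_nonneg order_trans by blast+
  define w where "w = - hsym u v + hsym u' v"
  have w: "w = - hconj a + (h + (hconj (- h) + hconj a))"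
    by (rule heis_eqI) (simp_all add: w_def hsym_def u' a_def field_simps)
  have wx: "hx w = 2 * hx h" and wy: "hy w = 2 * hy h"
    and wt: "ht w = 2 * (hx a * hy h - hx h * hy a)"
    unfolding w by (simp_all add: field_simps)
  have "sqrt ((hx w)\<^sup>2 + (hy w)\<^sup>2) = 2 * sqrt ((hx h)\<^sup>2 + (hy h)\<^sup>2)"
  proof -
    have "(hx w)\<^sup>2 + (hy w)\<^sup>2 = 4 * ((hx h)\<^sup>2 + (hy h)\<^sup>2)"
      by (simp add: wx wy power2_eq_square)
    then show ?thesis by (simp only: real_sqrt_mult real_sqrt_four)
  qed
  also have "\<dots> \<le> 2 * s" using horizontal_le_knorm[of h] kh by simp
  finally have 1: "sqrt ((hx w)\<^sup>2 + (hy w)\<^sup>2) \<le> 2 * s" .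
  have "\<bar>hx a * hy h - hx h * hy a\<bar> \<le> \<bar>hx a\<bar> * \<bar>hy h\<bar> + \<bar>hx h\<bar> * \<bar>hy a\<bar>"
    by (metis abs_mult abs_triangle_ineq4)
  also have "\<dots> \<le> l * s + s * l"
    using abs_hx_le_knorm[of a] abs_hy_le_knorm[of a] abs_hx_le_knorm[of h] abs_hy_le_knorm[of h] kh ka s0 l0
    by (intro add_mono mult_mono) auto
  finally have "\<bar>ht w\<bar> \<le> 2 * (l * s + s * l)" by (simp add: wt abs_mult)
  also have "\<dots> \<le> 4 * (s * (l + s))" using s0 by (simp add: distrib_left mult.commute)
  finally have "\<bar>ht w\<bar> \<le> 4 * (s * (l + s))" .
  then have "sqrt \<bar>ht w\<bar> \<le> sqrt (4 * (s * (l + s)))" by simp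
  also have "\<dots> = 2 * sqrt (s * (l + s))" by (subst real_sqrt_mult) simp
  finally have "knorm w \<le> 2 * s + 4 * sqrt (s * (l + s))" using knorm_le[of w] 1 by linarith
  then show ?thesis by (simp add: w_def dist_heis_def)
qed

subsection \<open>Topology\<close>

lemma continuous_hx: "continuous_on UNIV hx" and continuous_hy: "continuous_on UNIV hy"
proof -
  have "\<bar>hx p - hx q\<bar> \<le> dist p q \<and> \<bar>hy p - hy q\<bar> \<le> dist p q" for p q
    using abs_hx_le_knorm[of "- q + p"] abs_hy_le_knorm[of "- q + p"] by (simp add: dist_heis_def)
  then show "continuous_on UNIV hx" "continuous_on UNIV hy"
    unfolding continuous_on_iff dist_real_def by (meson le_less_trans)+
qed

text \<open>Unlike \<open>hx\<close> and \<open>hy\<close>, \<open>ht\<close> is not Lipschitz. The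
  height of the group difference \<open>- p + q\<close> is controlled by the squared distance, and
  what remains is bilinear in the horizontal coordinates.\<close>

lemma continuous_ht: "continuous_on UNIV ht"
  unfolding continuous_on_def
proof
  fix p :: heis
  let ?F = "at p within UNIV"
  have x: "(hx \<longlongrightarrow> hx p) ?F" and y: "(hy \<longlongrightarrow> hy p) ?F"
    using continuous_hx continuous_hy by (auto simp: continuous_on_def)
  have "((\<lambda>q. (dist q p)\<^sup>2) \<longlongrightarrow> (dist p p)\<^sup>2) ?F" by (intro tendsto_intros)
  then have "((\<lambda>q. (dist q p)\<^sup>2) \<longlongrightarrow> 0) ?F" by simp
  moreover have "norm (ht (- p + q)) \<le> (dist q p)\<^sup>2" for q
    using abs_ht_le_knorm[of "- p + q"] unfolding dist_heis_def real_norm_def by linarith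
  ultimately have L: "((\<lambda>q. ht (- p + q)) \<longlongrightarrow> 0) ?F"
    by (rule Lim_null_comparison[OF always_eventually[OF allI], rotated])
  have "((\<lambda>q. ht (- p + q) + ht p + (hx p * hy q - hx q * hy p) / 2)
      \<longlongrightarrow> 0 + ht p + (hx p * hy p - hx p * hy p) / 2) ?F"
    by (intro tendsto_intros x y L) simp
  moreover have "(\<lambda>q. ht (- p + q) + ht p + (hx p * hy q - hx q * hy p) / 2) = ht"
    by (rule ext) (simp add: field_simps)
  moreover have "0 + ht p + (hx p * hy p - hx p * hy p) / 2 = ht p" by simp
  ultimately show "(ht \<longlongrightarrow> ht p) ?F" by metis
qed

lemma borel_measurable_coord [measurable]:
  "hx \<in> borel_measurable borel" "hy \<in> borel_measurable borel" "ht \<in> borel_measurable borel"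
  using continuous_hx continuous_hy continuous_ht by (auto intro: borel_measurable_continuous_onI)

lemma knorm_tendsto_0:
  assumes "((\<lambda>z. hx (f z)) \<longlongrightarrow> 0) F" "((\<lambda>z. hy (f z)) \<longlongrightarrow> 0) F" "((\<lambda>z. ht (f z)) \<longlongrightarrow> 0) F"
  shows "((\<lambda>z. knorm (f z)) \<longlongrightarrow> 0) F"
proof (rule Lim_null_comparison)
  have "((\<lambda>z. sqrt ((hx (f z))\<^sup>2 + (hy (f z))\<^sup>2) + 2 * sqrt \<bar>ht (f z)\<bar>)
      \<longlongrightarrow> sqrt (0\<^sup>2 + 0\<^sup>2) + 2 * sqrt \<bar>0\<bar>) F"
    by (intro tendsto_intros assms)
  then show "((\<lambda>z. sqrt ((hx (f z))\<^sup>2 + (hy (f z))\<^sup>2) + 2 * sqrt \<bar>ht (f z)\<bar>) \<longlongrightarrow> 0) F" by simp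
qed (simp add: knorm_le)

text \<open>With the continuity of the coordinates this identifies the metric topology with the
  Euclidean one, so that compactness can be taken over from R^3.\<close>

lemma continuous_Heis: "continuous_on UNIV (\<lambda>(x, y, t). Heis x y t)"
  unfolding continuous_on_def
proof (clarify)
  fix x y t :: real
  let ?F = "at (x, y, t) within UNIV"
  have "((\<lambda>z. knorm (- Heis x y t + Heis (fst z) (fst (snd z)) (snd (snd z)))) \<longlongrightarrow> 0) ?F"
  proof (rule knorm_tendsto_0)
    have "((\<lambda>z. - t + snd (snd z) + (- x * fst (snd z) + fst z * y) / 2)
      \<longlongrightarrow> - t + snd (snd (x, y, t)) + (- x * fst (snd (x, y, t)) + fst (x, y, t) * y) / 2) ?F"
      by (intro tendsto_intros) simp
    then show "((\<lambda>z. ht (- Heis x y t + Heis (fst z) (fst (snd z)) (snd (snd z)))) \<longlongrightarrow> 0) ?F" by simp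
    have "((\<lambda>z. - x + fst z) \<longlongrightarrow> - x + fst (x, y, t)) ?F" by (intro tendsto_intros)
    then show "((\<lambda>z. hx (- Heis x y t + Heis (fst z) (fst (snd z)) (snd (snd z)))) \<longlongrightarrow> 0) ?F" by simp
    have "((\<lambda>z. - y + fst (snd z)) \<longlongrightarrow> - y + fst (snd (x, y, t))) ?F" by (intro tendsto_intros)
    then show "((\<lambda>z. hy (- Heis x y t + Heis (fst z) (fst (snd z)) (snd (snd z)))) \<longlongrightarrow> 0) ?F" by simp
  qed
  then show "((\<lambda>(x, y, t). Heis x y t) \<longlongrightarrow> Heis x y t) ?F"
    unfolding case_prod_beta' tendsto_dist_iff[of _ "Heis x y t"] dist_heis_def by simp
qed

lemma continuous_knorm_Heis: "continuous_on UNIV (\<lambda>(x, y, t). knorm (Heis x y t))"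
  unfolding knorm_def case_prod_beta' by (simp, intro continuous_intros)

lemma borel_measurable_left_translate:
  fixes g :: "real \<times> real \<times> real \<Rightarrow> real"
  assumes g: "g \<in> borel_measurable borel" and "sets M = sets borel"
  shows "(\<lambda>q. g (hx (- q + p), hy (- q + p), ht (- q + p))) \<in> borel_measurable M"
proof -
  have "(\<lambda>q. g (hx (- q + p), hy (- q + p), ht (- q + p))) \<in> borel_measurable borel"
    by (rule measurable_compose[OF _ g]) (simp add: borel_prod[symmetric])
  then show ?thesis using assms(2) by (simp cong: measurable_cong_sets)
qed

lemma closed_bounded_imp_compact_heis:
  fixes E :: "heis set"
  assumes "closed E" "bounded E"
  shows "compact E"
proof -
  obtain e where e: "\<And>p. p \<in> E \<Longrightarrow> dist 0 p \<le> e"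
    using assms(2) bounded_any_center[of E 0] by auto
  have k: "knorm p \<le> e" if "p \<in> E" for p
    using e[OF that] dist_commute[of 0 p] by (simp add: dist_heis_def)
  define B where "B = {- e..e} \<times> {- e..e} \<times> {- (e\<^sup>2)..e\<^sup>2}"
  have "compact ((\<lambda>(x, y, t). Heis x y t) ` B)"
    unfolding B_def
    by (intro compact_continuous_image continuous_on_subset[OF continuous_Heis] compact_Times) auto
  moreover have "E \<subseteq> (\<lambda>(x, y, t). Heis x y t) ` B"
  proof
    fix p assume p: "p \<in> E"
    have "(knorm p)\<^sup>2 \<le> e\<^sup>2" using k[OF p] by (intro power_mono) auto
    then have "\<bar>ht p\<bar> \<le> e\<^sup>2" using abs_ht_le_knorm[of p] by linarith
    then have "(hx p, hy p, ht p) \<in> B"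
      using k[OF p] abs_hx_le_knorm[of p] abs_hy_le_knorm[of p] by (auto simp: B_def)
    then show "p \<in> (\<lambda>(x, y, t). Heis x y t) ` B" by (force intro: image_eqI[where x = "(hx p, hy p, ht p)"])
  qed
  ultimately show ?thesis using assms(1) by (metis compact_Int_closed inf.absorb_iff2)
qed

section \<open>An algebra of smooth functions with bumps\<close>

text \<open>\<open>flat 0\<close> is the standard smooth function that vanishes to infinite order at
  0. The factors \<open>1 / s ^ n\<close> are there because its derivatives are combinations of
  these functions: the family is closed under differentiation up to linear combinations.\<close>

definition flat :: "nat \<Rightarrow> real \<Rightarrow> real" where
  "flat n s = (if s \<le> 0 then 0 else exp (- (1 / s)) / s ^ n)"

lemma flat_nonneg: "0 \<le> flat n s"
  by (simp add: flat_def)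

lemma flat_0_mono: "s \<le> t \<Longrightarrow> flat 0 s \<le> flat 0 t"
  by (auto simp: flat_def field_simps)

lemma flat_eq_0 [simp]: "s \<le> 0 \<Longrightarrow> flat n s = 0"
  by (simp add: flat_def)

lemma flat_pos: "0 < s \<Longrightarrow> 0 < flat n s"
  by (simp add: flat_def)

lemma flat_tendsto_0: "(flat n \<longlongrightarrow> 0) (at 0)"
  unfolding filterlim_at_split
proof
  have "\<forall>\<^sub>F s in at_left 0. flat n s = 0" unfolding eventually_at_left_field by (auto intro: exI[of _ "-1"])
  then show "(flat n \<longlongrightarrow> 0) (at_left 0)" by (rule tendsto_eventually)
  have "((\<lambda>s. inverse s ^ n / exp (inverse s)) \<longlongrightarrow> 0) (at_right (0::real))"
    using filterlim_compose[OF tendsto_power_div_exp_0[of n] filterlim_inverse_at_top_right] .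
  moreover have "\<forall>\<^sub>F s in at_right (0::real). inverse s ^ n / exp (inverse s) = flat n s"
    unfolding eventually_at_right_field
    by (intro exI[of _ 1]) (auto simp: flat_def exp_minus field_simps)
  ultimately show "(flat n \<longlongrightarrow> 0) (at_right 0)" by (rule Lim_transform_eventually)
qed

lemma DERIV_flat: "(flat n has_real_derivative flat (n + 2) s - real n * flat (n + 1) s) (at s)"
proof (rule linorder_cases[of s 0])
  assume "s < 0"
  then have "((\<lambda>_. 0) has_real_derivative 0) (at s)" "eventually (\<lambda>t. 0 = flat n t) (nhds s)"
    by (auto simp: flat_def intro!: eventually_nhds_in_open[of "{..<0}", THEN eventually_mono])
  then show ?thesis using \<open>s < 0\<close> DERIV_cong_ev[OF refl, of "\<lambda>_. 0" "flat n" s 0 0] by simp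
next
  assume s: "0 < s"
  have "((\<lambda>t. exp (- (1 / t)) / t ^ n) has_real_derivative
      (exp (- (1 / s)) * (1 / s\<^sup>2) * s ^ n - exp (- (1 / s)) * (real n * s ^ (n - 1))) / (s ^ n * s ^ n)) (at s)"
    using s by (auto intro!: derivative_eq_intros simp: power2_eq_square)
  moreover have "(exp (- (1 / s)) * (1 / s\<^sup>2) * s ^ n - exp (- (1 / s)) * (real n * s ^ (n - 1))) / (s ^ n * s ^ n)
      = flat (n + 2) s - real n * flat (n + 1) s"
    using s by (cases n) (auto simp: flat_def field_simps power2_eq_square)
  moreover have "eventually (\<lambda>t. exp (- (1 / t)) / t ^ n = flat n t) (nhds s)"
    using s by (auto simp: flat_def intro!: eventually_nhds_in_open[of "{0<..}", THEN eventually_mono])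
  ultimately show ?thesis using DERIV_cong_ev[OF refl, of "\<lambda>t. exp (- (1 / t)) / t ^ n" "flat n" s] by simp
next
  assume s: "s = 0"
  \<comment> \<open>At 0 the difference quotient of \<open>flat n\<close> is
    \<open>flat (n + 1)\<close> itself, whose limit is known.\<close>
  have "(flat n (0 + h) - flat n 0) / h = flat (n + 1) h" for h
    by (auto simp: flat_def)
  then show ?thesis using flat_tendsto_0[of "n + 1"] by (simp add: s DERIV_def)
qed

type_synonym real3 = "real \<times> real \<times> real"

text \<open>A syntactic class that contains the bumps and is closed under directional derivatives,
  so that iterated derivatives never leave it and can be handled by rule induction.\<close>

inductive elem_fun :: "(real3 \<Rightarrow> real) \<Rightarrow> bool" where
  const: "elem_fun (\<lambda>_. c)"
| linear: "bounded_linear f \<Longrightarrow> elem_fun f"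
| add: "elem_fun f \<Longrightarrow> elem_fun g \<Longrightarrow> elem_fun (\<lambda>x. f x + g x)"
| mult: "elem_fun f \<Longrightarrow> elem_fun g \<Longrightarrow> elem_fun (\<lambda>x. f x * g x)"
| flat: "elem_fun f \<Longrightarrow> elem_fun (\<lambda>x. flat n (f x))"

lemma elem_fun_cmult: "elem_fun f \<Longrightarrow> elem_fun (\<lambda>x. c * f x)"
  by (intro elem_fun.mult elem_fun.const)

lemma elem_fun_diff: "elem_fun f \<Longrightarrow> elem_fun g \<Longrightarrow> elem_fun (\<lambda>x. f x - g x)"
  using elem_fun.add[OF _ elem_fun_cmult[of g "-1"]] by simp

lemma elem_fun_coord:
  "elem_fun (\<lambda>x. fst x)" "elem_fun (\<lambda>x. fst (snd x))" "elem_fun (\<lambda>x. snd (snd x))"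
  by (auto intro!: elem_fun.linear bounded_linear_fst bounded_linear_snd
      bounded_linear_compose[OF bounded_linear_fst] bounded_linear_compose[OF bounded_linear_snd])

lemma elem_fun_compose_linear:
  assumes "elem_fun f" "bounded_linear l"
  shows "elem_fun (\<lambda>x. f (l x))"
  using assms(1)
  by induction (auto intro: elem_fun.intros bounded_linear_compose[OF _ assms(2)])

lemma elem_fun_has_derivative:
  assumes "elem_fun f"
  shows "\<exists>f'. (\<forall>x. (f has_derivative f' x) (at x)) \<and> (\<forall>v. elem_fun (\<lambda>x. f' x v))"
  using assms
proof induction
  case (const c)
  show ?case by (intro exI[of _ "\<lambda>_ _. 0"]) (auto intro: elem_fun.const)
next
  case (linear f)
  then show ?case
    by (intro exI[of _ "\<lambda>_. f"]) (auto intro: elem_fun.const bounded_linear_imp_has_derivative)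
next
  case (add f g)
  then obtain f' g' where "\<forall>x. (f has_derivative f' x) (at x)" "\<forall>v. elem_fun (\<lambda>x. f' x v)"
    "\<forall>x. (g has_derivative g' x) (at x)" "\<forall>v. elem_fun (\<lambda>x. g' x v)" by blast
  then show ?case
    by (intro exI[of _ "\<lambda>x v. f' x v + g' x v"]) (auto intro!: elem_fun.add has_derivative_add)
next
  case (mult f g)
  then obtain f' g' where fg: "\<forall>x. (f has_derivative f' x) (at x)" "\<forall>v. elem_fun (\<lambda>x. f' x v)"
    "\<forall>x. (g has_derivative g' x) (at x)" "\<forall>v. elem_fun (\<lambda>x. g' x v)" by blast
  then show ?case using mult.hyps
    by (intro exI[of _ "\<lambda>x v. f x * g' x v + f' x v * g x"])
       (auto intro!: elem_fun.add elem_fun.mult has_derivative_mult)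
next
  case (flat f n)
  then obtain f' where f: "\<forall>x. (f has_derivative f' x) (at x)" "\<forall>v. elem_fun (\<lambda>x. f' x v)" by blast
  have "((\<lambda>x. flat n (f x)) has_derivative
      (\<lambda>v. (flat (n + 2) (f x) - real n * flat (n + 1) (f x)) * f' x v)) (at x)" for x
    using has_derivative_compose[OF f(1)[rule_format, of x]
        DERIV_flat[of n "f x", unfolded has_field_derivative_def]] by simp
  then show ?case using f(2) flat.hyps
    by (intro exI[of _ "\<lambda>x v. (flat (n + 2) (f x) - real n * flat (n + 1) (f x)) * f' x v"])
       (auto intro!: elem_fun.mult elem_fun_diff elem_fun.flat elem_fun_cmult)
qed

lemma elem_fun_continuous:
  assumes "elem_fun f"
  shows "continuous_on UNIV f"
  using elem_fun_has_derivative[OF assms]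
  by (meson continuous_at_imp_continuous_on has_derivative_continuous)

text \<open>The scales of a lacunary sum accumulate at the origin, so a single elementary function
  cannot be expected to represent it; near any other point one does.\<close>

definition locally_elem :: "(real3 \<Rightarrow> real) \<Rightarrow> bool" where
  "locally_elem f \<longleftrightarrow> (\<forall>x. x \<noteq> 0 \<longrightarrow> (\<exists>U g. open U \<and> x \<in> U \<and> elem_fun g \<and> (\<forall>y\<in>U. f y = g y)))"

lemma locally_elem_derivative:
  assumes "locally_elem f"
  shows "\<And>x. x \<noteq> 0 \<Longrightarrow> f differentiable (at x)"
    and "locally_elem (\<lambda>x. frechet_derivative f (at x) v)"
proof -
  have *: "\<exists>U h. open U \<and> x \<in> U \<and> (\<forall>v. elem_fun (\<lambda>y. h y v)) \<and> (\<forall>y\<in>U. (f has_derivative h y) (at y))"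
    if x: "x \<noteq> 0" for x
  proof -
    obtain U g where U: "open U" "x \<in> U" "elem_fun g" "\<And>y. y \<in> U \<Longrightarrow> f y = g y"
      using assms x unfolding locally_elem_def by metis
    obtain h where h: "\<forall>x. (g has_derivative h x) (at x)" "\<forall>v. elem_fun (\<lambda>x. h x v)"
      using elem_fun_has_derivative[OF U(3)] by blast
    have "(f has_derivative h y) (at y)" if "y \<in> U" for y
      using has_derivative_transform_within_open[OF h(1)[rule_format] U(1) that] U(4) by metis
    then show ?thesis using U h by blast
  qed
  show "f differentiable (at x)" if "x \<noteq> 0" for x
    using *[OF that] by (metis differentiableI)
  show "locally_elem (\<lambda>x. frechet_derivative f (at x) v)"
    unfolding locally_elem_def
  proof (intro allI impI)
    fix x :: real3 assume "x \<noteq> 0"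
    then obtain U h where U: "open U" "x \<in> U" "\<forall>v. elem_fun (\<lambda>y. h y v)"
      "\<forall>y\<in>U. (f has_derivative h y) (at y)" using * by blast
    have "frechet_derivative f (at y) v = h y v" if "y \<in> U" for y
      using U(4) that by (metis frechet_derivative_at)
    then show "\<exists>U g. open U \<and> x \<in> U \<and> elem_fun g \<and> (\<forall>y\<in>U. frechet_derivative f (at y) v = g y)"
      using U by blast
  qed
qed

lemma locally_elem_smooth_on:
  assumes "locally_elem f"
  shows "smooth_on f (- {0})"
proof -
  have "Ck_on k f (- {0})" for k
    using assms
  proof (induction k arbitrary: f)
    case 0
    then have "\<forall>x\<in>- {0}. isCont f x"
      using locally_elem_derivative(1) differentiable_imp_continuous_within by blast
    then show ?case by (simp add: continuous_at_imp_continuous_on)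
  next
    case (Suc k)
    then show ?case using locally_elem_derivative[OF Suc.prems] by simp
  qed
  then show ?thesis by (simp add: smooth_on_def)
qed

section \<open>Approximate symmetry forces vertical flatness\<close>

locale regular_set =
  fixes E :: "heis set" and A :: real
  assumes closed: "closed E" and A_ge_1: "1 \<le> A"
    and lower: "\<And>p r. p \<in> E \<Longrightarrow> 0 < r \<Longrightarrow> ennreal r \<le> ediam E \<Longrightarrow>
      ennreal (r ^ 3 / A) \<le> hausdorff 3 (E \<inter> ball p r)"
    and upper: "\<And>p r. p \<in> E \<Longrightarrow> 0 < r \<Longrightarrow> ennreal r \<le> ediam E \<Longrightarrow>
      hausdorff 3 (E \<inter> ball p r) \<le> ennreal (A * r ^ 3)"

section \<open>From a large \<beta>-number to two independent horizontal directions\<close>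

lemma dist_plus_self [simp]: "dist p (p + u) = knorm u"
proof -
  have "- p + (p + u) = u" by (rule heis_eqI) (simp_all add: field_simps)
  then show ?thesis using dist_commute[of p "p + u"] by (simp only: dist_heis_def)
qed

text \<open>The symplectic form of the horizontal parts: the commutator of \<open>u\<close> and
  \<open>v\<close> is central of height \<open>omega u v\<close>.\<close>

definition omega :: "heis \<Rightarrow> heis \<Rightarrow> real" where
  "omega u v = hx u * hy v - hx v * hy u"

text \<open>The infimum in the \<beta>-number is tested on the plane through \<open>p\<close> with
  horizontal direction \<open>(c, s)\<close>, whose unit normal is \<open>(- s, c)\<close>.\<close>

lemma vertical_beta_off_plane:
  assumes r: "0 < r" and e: "0 < \<epsilon>" and beta: "ennreal \<epsilon> \<le> vertical_beta E p r"
    and cs: "c\<^sup>2 + s\<^sup>2 = 1"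
  shows "\<exists>v. p + v \<in> E \<and> knorm v < r \<and> \<epsilon> * r / 2 < \<bar>c * hy v - s * hx v\<bar>"
proof -
  define V where "V = {w :: real \<times> real \<times> real. (- s, c, 0) \<bullet> w = 0}"
  define W where "W = (\<lambda>q. p + q) ` {q. (hx q, hy q, ht q) \<in> V}"
  have "c \<noteq> 0 \<or> s \<noteq> 0" using cs by auto
  then have "(- s, c, 0) \<noteq> (0 :: real \<times> real \<times> real)" by (auto simp: zero_prod_def)
  then have "dim V = 2" unfolding V_def using dim_hyperplane[of "(- s, c, 0 :: real)"] by simp
  moreover have "subspace V" unfolding V_def by (rule subspace_hyperplane)
  ultimately have W: "vertical_plane W"
    unfolding vertical_plane_def
    by (intro exI[of _ V] exI[of _ p]) (auto simp: V_def W_def)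
  \<comment> \<open>Half of \<open>\<epsilon>\<close> is given away for a strict inequality, because
    the supremum need not be attained.\<close>
  have "ennreal (\<epsilon> / 2) < ennreal \<epsilon>" using e by (simp add: ennreal_less_iff)
  also have "\<dots> \<le> vertical_beta E p r" by (rule beta)
  also have "\<dots> \<le> (SUP y\<in>ball p r \<inter> E. ennreal (infdist y W / r))"
    unfolding vertical_beta_def using W by (intro INF_lower) auto
  finally obtain y where y: "y \<in> ball p r" "y \<in> E" "ennreal (\<epsilon> / 2) < ennreal (infdist y W / r)"
    unfolding less_SUP_iff by auto
  define v where "v = - p + y"
  have y_eq: "y = p + v" by (simp add: v_def flip: add.assoc)
  define k where "k = c * hy v - s * hx v"
  \<comment> \<open>The projection to the plane by right multiplication with a horizontal vector
    along the normal. By left invariance the distance is the length of that vector, the absolute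
    value of \<open>k\<close>.\<close>
  define v' where "v' = v + Heis (s * k) (- c * k) 0"
  have "(- s, c, 0) \<bullet> (hx v', hy v', ht v') = k - k * (c\<^sup>2 + s\<^sup>2)"
    by (simp add: v'_def k_def algebra_simps power2_eq_square)
  then have "p + v' \<in> W" by (simp add: W_def V_def cs)
  then have "infdist y W \<le> dist y (p + v')" by (rule infdist_le)
  also have "\<dots> = knorm (- v' + v)" by (simp add: y_eq dist_heis_def[of v])
  also have "- v' + v = Heis (- s * k) (c * k) 0"
    by (rule heis_eqI) (simp_all add: v'_def field_simps)
  also have "knorm (Heis (- s * k) (c * k) 0) \<le> sqrt ((hx (Heis (- s * k) (c * k) 0))\<^sup>2 + (hy (Heis (- s * k) (c * k) 0))\<^sup>2)"
    using knorm_le[of "Heis (- s * k) (c * k) 0"] by simp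
  also have "\<dots> \<le> sqrt ((c\<^sup>2 + s\<^sup>2) * k\<^sup>2)"
    by (simp add: power_mult_distrib algebra_simps)
  also have "\<dots> = \<bar>k\<bar>" by (simp add: cs)
  finally have "infdist y W \<le> \<bar>k\<bar>" .
  moreover have "\<epsilon> / 2 < infdist y W / r"
    using y(3) e r by (subst (asm) ennreal_less_iff) auto
  ultimately have "\<epsilon> * r / 2 < \<bar>k\<bar>" using r by (simp add: field_simps)
  moreover have "knorm v < r" using y(1) by (simp add: y_eq)
  ultimately show ?thesis using y(2) by (auto simp: y_eq k_def)
qed

lemma vertical_beta_two_directions:
  assumes r: "0 < r" and e: "0 < \<epsilon>" and beta: "ennreal \<epsilon> \<le> vertical_beta E p r"
  shows "\<exists>u v. p + u \<in> E \<and> p + v \<in> E \<and> knorm u < r \<and> knorm v < r \<and> \<epsilon>\<^sup>2 * r\<^sup>2 / 4 \<le> \<bar>omega u v\<bar>"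
proof -
  \<comment> \<open>Any vertical plane through \<open>p\<close> would do here: what matters is that
    the horizontal part of \<open>u\<close> is long.\<close>
  obtain u where u: "p + u \<in> E" "knorm u < r" "\<epsilon> * r / 2 < \<bar>hy u\<bar>"
    using vertical_beta_off_plane[OF assms, of 1 0] by auto
  define m where "m = sqrt ((hx u)\<^sup>2 + (hy u)\<^sup>2)"
  have m: "\<epsilon> * r / 2 < m" using u(3) real_sqrt_ge_abs2[of "hy u" "hx u"] unfolding m_def by linarith
  have m0: "0 < m" using m mult_pos_pos[OF e r] by linarith
  have "(hx u)\<^sup>2 + (hy u)\<^sup>2 = m\<^sup>2" by (simp add: m_def)
  then have "(hx u / m)\<^sup>2 + (hy u / m)\<^sup>2 = 1" using m0 by (simp add: power_divide flip: add_divide_distrib)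
  \<comment> \<open>This time the plane contains \<open>p + u\<close>, so the deviation of
    \<open>v\<close> from it, multiplied by \<open>m\<close>, is \<open>omega u v\<close>.\<close>
  then obtain v where v: "p + v \<in> E" "knorm v < r" "\<epsilon> * r / 2 < \<bar>hx u / m * hy v - hy u / m * hx v\<bar>"
    using vertical_beta_off_plane[OF assms] by blast
  have "hx u / m * hy v - hy u / m * hx v = omega u v / m"
    by (simp add: omega_def diff_divide_distrib mult.commute)
  then have w: "\<epsilon> * r / 2 * m < \<bar>omega u v\<bar>" using v(3) m0 by (simp add: field_simps)
  have "\<epsilon>\<^sup>2 * r\<^sup>2 / 4 = \<epsilon> * r / 2 * (\<epsilon> * r / 2)" by (simp add: power2_eq_square)
  also have "\<dots> \<le> \<epsilon> * r / 2 * m" using m e r by (intro mult_left_mono) auto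
  finally show ?thesis using u v w by fastforce
qed

section \<open>Words in reflections and the lattice they generate\<close>

lemma hsym_hsym_zero: "hsym c (hsym 0 g) = Heis (2 * hx c) (2 * hy c) 0 + g"
  by (rule heis_eqI) (simp_all add: hsym_def field_simps)

text \<open>The opposite order of the two reflections gives the inverse translation. In both orders
  \<open>ht c\<close> cancels, so the lattice is determined by horizontal parts alone.\<close>

lemma hsym_zero_hsym: "hsym 0 (hsym c g) = Heis (- 2 * hx c) (- 2 * hy c) 0 + g"
  by (rule heis_eqI) (simp_all add: hsym_def field_simps)

text \<open>Two symmetries compose to a left translation, so \<open>E\<close> nearly contains the orbit of \<open>p\<close>
  under a lattice; a lattice has four-dimensional growth.\<close>

lemma lattice_orbit_near:
  fixes E :: "heis set"
  assumes p: "p \<in> E" and u: "p + u \<in> E" "knorm u < r" and v: "p + v \<in> E" "knorm v < r"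
    and \<eta>: "\<eta> \<le> 1"
    and sym: "\<And>a b. a \<in> E \<inter> ball p (N * r) \<Longrightarrow> b \<in> E \<inter> ball p (N * r) \<Longrightarrow> \<exists>w\<in>E. dist w (hsym a b) < \<eta> * r"
    and N: "3 * real (8 * k + 2 * j + 2 * i) < N" "1 \<le> N"
  shows "\<exists>w\<in>E. dist w (p + Heis (2 * real i * hx u + 2 * real j * hx v) (2 * real i * hy u + 2 * real j * hy v)
       ((4 * real k + 2 * real i * real j) * omega u v)) \<le> real (8 * k + 2 * j + 2 * i) * \<eta> * r"
proof -
  have r: "0 < r" using u(2) knorm_nonneg[of u] by linarith
  \<comment> \<open>\<open>m\<close> counts reflections. The second bound keeps the orbit in the
    ball where \<open>sym\<close> applies: reflecting in a centre within \<open>r\<close> of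
    \<open>p\<close> and then making an error of at most \<open>r\<close> increases the distance
    from \<open>p\<close> by at most \<open>3 * r\<close>.\<close>
  define near where "near m g \<longleftrightarrow>
    (\<exists>w\<in>E. dist w (p + g) \<le> real m * \<eta> * r \<and> dist p w \<le> real m * 3 * r)" for m g
  have step: "near (Suc m) (hsym c g)"
    if m: "near m g" and c: "p + c \<in> E" "knorm c < r" and mN: "3 * real m < N" for m c g
  proof -
    obtain w where w: "w \<in> E" "dist w (p + g) \<le> real m * \<eta> * r" "dist p w \<le> real m * 3 * r"
      using m by (auto simp: near_def)
    have pc: "dist p (p + c) < r" using c(2) by simp
    have "real m * 3 * r < N * r" using mN r by (intro mult_strict_right_mono) auto
    moreover have "r \<le> N * r" using N(2) r by simp
    ultimately obtain w' where w': "w' \<in> E" "dist w' (hsym (p + c) w) < \<eta> * r"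
      using sym[of "p + c" w] c(1) w(1,3) pc by auto
    have "\<eta> * r \<le> r" using \<eta> r by simp
    have "dist w' (p + hsym c g) \<le> dist w' (hsym (p + c) w) + dist (hsym (p + c) w) (p + hsym c g)"
      by (rule dist_triangle)
    also have "dist (hsym (p + c) w) (p + hsym c g) = dist w (p + g)"
      by (simp flip: hsym_plus_left)
    finally have 1: "dist w' (p + hsym c g) \<le> real (Suc m) * \<eta> * r"
      using w(2) w'(2) by (simp add: algebra_simps)
    have "dist (p + c) (hsym (p + c) w) = dist (p + c) w"
      using dist_hsym[of "p + c" "p + c" w] by simp
    moreover have "dist (p + c) w \<le> dist p (p + c) + dist p w"
      by (metis dist_commute dist_triangle)
    moreover have "dist p w' \<le> dist p (p + c) + dist (p + c) (hsym (p + c) w) + dist w' (hsym (p + c) w)"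
      using dist_triangle[of p w' "p + c"] dist_triangle[of "p + c" w' "hsym (p + c) w"]
      unfolding dist_commute[of w'] by linarith
    ultimately have 2: "dist p w' \<le> real (Suc m) * 3 * r"
      using w(3) w'(2) pc \<open>\<eta> * r \<le> r\<close> by (simp add: algebra_simps)
    show ?thesis using w'(1) 1 2 by (auto simp: near_def)
  qed
  have step0: "near (Suc m) (hsym 0 g)" if "near m g" "3 * real m < N" for m g
    using step[of m g 0] that p r by (simp add: knorm_eq_0_iff[THEN iffD2])
  have plus: "near (m + 2) (Heis (2 * hx c) (2 * hy c) 0 + g)"
    and minus: "near (m + 2) (Heis (- 2 * hx c) (- 2 * hy c) 0 + g)"
    if "near m g" "p + c \<in> E" "knorm c < r" "3 * real (m + 2) \<le> N" for m g c
    using step[OF step0[OF that(1)] that(2,3)] step0[OF step[OF that(1-3)]] that(4)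
    by (simp_all add: hsym_hsym_zero hsym_zero_hsym)
  \<comment> \<open>The commutator of the doubled translations along \<open>u\<close> and
    \<open>v\<close> is central of height \<open>4 * omega u v\<close>. It takes four translations,
    hence eight reflections.\<close>
  have comm: "near (m + 8) (Heis 0 0 (t + 4 * omega u v))"
    if m: "near m (Heis 0 0 t)" "3 * real (m + 8) \<le> N" for m t
  proof -
    have "near (m + 2 + 2 + 2 + 2) (Heis (2 * hx u) (2 * hy u) 0 + (Heis (2 * hx v) (2 * hy v) 0 +
        (Heis (- 2 * hx u) (- 2 * hy u) 0 + (Heis (- 2 * hx v) (- 2 * hy v) 0 + Heis 0 0 t))))"
      using m u v by (intro plus minus) auto
    moreover have "m + 2 + 2 + 2 + 2 = m + 8" by simp
    ultimately show ?thesis by (simp only:) (simp add: omega_def algebra_simps)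
  qed
  have "near 0 (Heis 0 0 0)" using p by (auto simp: near_def simp flip: zero_heis_def)
  then have k: "near (8 * k') (Heis 0 0 (4 * real k' * omega u v))" if "k' \<le> k" for k'
    using that
  proof (induction k')
    case (Suc k')
    then show ?case using comm[of "8 * k'" "4 * real k' * omega u v"] N(1) by (simp add: algebra_simps)
  qed simp
  have j: "near (8 * k + 2 * j') (Heis (2 * real j' * hx v) (2 * real j' * hy v) (4 * real k * omega u v))"
    if "j' \<le> j" for j'
    using that
  proof (induction j')
    case (Suc j')
    then show ?case
      using plus[of "8 * k + 2 * j'" "Heis (2 * real j' * hx v) (2 * real j' * hy v) (4 * real k * omega u v)" v] v N(1)
      by (simp add: algebra_simps)
  qed (use k in simp)
  \<comment> \<open>Each left translation along \<open>u\<close> meets the horizontal part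
    \<open>2 * j\<close> times that of \<open>v\<close> collected so far and thereby adds the height
    \<open>2 * j * omega u v\<close>.\<close>
  have i: "near (8 * k + 2 * j + 2 * i')
      (Heis (2 * real i' * hx u + 2 * real j * hx v) (2 * real i' * hy u + 2 * real j * hy v)
       ((4 * real k + 2 * real i' * real j) * omega u v))" if "i' \<le> i" for i'
    using that
  proof (induction i')
    case (Suc i')
    then have "near (8 * k + 2 * j + 2 * i') (Heis (2 * real i' * hx u + 2 * real j * hx v)
        (2 * real i' * hy u + 2 * real j * hy v) ((4 * real k + 2 * real i' * real j) * omega u v))"
      by simp
    then have "near (8 * k + 2 * j + 2 * i' + 2) (Heis (2 * hx u) (2 * hy u) 0 +
        Heis (2 * real i' * hx u + 2 * real j * hx v) (2 * real i' * hy u + 2 * real j * hy v)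
          ((4 * real k + 2 * real i' * real j) * omega u v))"
      using u N(1) Suc.prems by (intro plus) auto
    moreover have "Heis (2 * hx u) (2 * hy u) 0 +
        Heis (2 * real i' * hx u + 2 * real j * hx v) (2 * real i' * hy u + 2 * real j * hy v)
          ((4 * real k + 2 * real i' * real j) * omega u v) =
        Heis (2 * real (Suc i') * hx u + 2 * real j * hx v) (2 * real (Suc i') * hy u + 2 * real j * hy v)
          ((4 * real k + 2 * real (Suc i') * real j) * omega u v)"
      by (rule heis_eqI) (simp_all add: omega_def field_simps)
    moreover have "8 * k + 2 * j + 2 * i' + 2 = 8 * k + 2 * j + 2 * Suc i'" by simp
    ultimately show ?case by (simp only:)
  qed (use j in simp)
  show ?thesis using i[of i] by (auto simp: near_def)
qed

text \<open>The product of \<open>i\<close> doubled translations along \<open>u\<close>,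
  \<open>j\<close> along \<open>v\<close> and \<open>k\<close> commutators of them; the mixed height
  \<open>2 * i * j\<close> is due to this order of the factors.\<close>

definition lattice_point :: "heis \<Rightarrow> heis \<Rightarrow> nat \<times> nat \<times> nat \<Rightarrow> heis" where
  "lattice_point u v = (\<lambda>(i, j, k).
     Heis (2 * real i * hx u + 2 * real j * hx v) (2 * real i * hy u + 2 * real j * hy v)
       ((4 * real k + 2 * real i * real j) * omega u v))"

lemma abs_nat_diff_ge_1: "i \<noteq> j \<Longrightarrow> 1 \<le> \<bar>real i - real j\<bar>"
  by (metis abs_minus_commute linorder_neqE_nat nat_less_real_le abs_ge_self le_diff_eq add.commute order_trans)

text \<open>If \<open>i\<close> or \<open>j\<close> differ, pairing the difference \<open>d\<close>
  with \<open>v\<close> or \<open>u\<close> in the symplectic form gives at least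
  \<open>2 * omega u v\<close> in absolute value, whereas the pairing is at most
  \<open>2 * r * knorm d\<close>. If only \<open>k\<close> differs, \<open>d\<close> is central and
  its height is at least four times that of \<open>omega u v\<close>.\<close>

lemma lattice_point_separated:
  assumes r: "0 < r" and e: "0 < \<epsilon>" "\<epsilon> \<le> 1" and u: "knorm u < r" and v: "knorm v < r"
    and w: "\<epsilon>\<^sup>2 * r\<^sup>2 / 4 \<le> \<bar>omega u v\<bar>" and ne: "a \<noteq> b"
  shows "\<epsilon>\<^sup>2 * r / 4 \<le> dist (lattice_point u v a) (lattice_point u v b)"
proof -
  obtain i j k i' j' k' where ab: "a = (i, j, k)" "b = (i', j', k')" by (cases a, cases b)
  define d where "d = - lattice_point u v b + lattice_point u v a"
  define x y where "x = real i - real i'" and "y = real j - real j'"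
  have dist: "dist (lattice_point u v a) (lattice_point u v b) = knorm d"
    by (simp add: dist_heis_def d_def)
  have dx: "hx d = 2 * x * hx u + 2 * y * hx v" and dy: "hy d = 2 * x * hy u + 2 * y * hy v"
    by (simp_all add: d_def lattice_point_def ab x_def y_def algebra_simps)
  have horiz: "\<epsilon>\<^sup>2 * r / 4 \<le> knorm d"
    if z: "1 \<le> \<bar>z\<bar>" and c: "knorm c < r" and eq: "\<bar>hx d * hy c - hx c * hy d\<bar> = 2 * \<bar>z\<bar> * \<bar>omega u v\<bar>" for z c
  proof -
    have "2 * \<bar>omega u v\<bar> \<le> 2 * \<bar>z\<bar> * \<bar>omega u v\<bar>" using z by (simp add: mult_le_cancel_right1)
    also have "\<dots> \<le> \<bar>hx d\<bar> * \<bar>hy c\<bar> + \<bar>hx c\<bar> * \<bar>hy d\<bar>"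
      unfolding eq[symmetric] by (metis abs_mult abs_triangle_ineq4)
    also have "\<dots> \<le> knorm d * r + r * knorm d"
      using abs_hx_le_knorm[of d] abs_hy_le_knorm[of d] abs_hx_le_knorm[of c] abs_hy_le_knorm[of c] c r
      by (intro add_mono mult_mono) auto
    also have "\<dots> = 2 * (knorm d * r)" by simp
    finally have "\<epsilon>\<^sup>2 * r\<^sup>2 / 4 \<le> knorm d * r" using w by linarith
    then have "\<epsilon>\<^sup>2 * r / 4 * r \<le> knorm d * r" by (simp add: power2_eq_square mult.assoc)
    then show ?thesis using r by simp
  qed
  show ?thesis
  proof (cases "i = i' \<and> j = j'")
    case False
    then consider "i \<noteq> i'" | "j \<noteq> j'" by blast
    then show ?thesis
    proof cases
      case 1
      have "hx d * hy v - hx v * hy d = 2 * x * omega u v"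
        by (simp add: dx dy omega_def algebra_simps)
      then have "\<bar>hx d * hy v - hx v * hy d\<bar> = 2 * \<bar>x\<bar> * \<bar>omega u v\<bar>" by (simp only: abs_mult abs_neg_numeral abs_numeral)
      moreover have "1 \<le> \<bar>x\<bar>" unfolding x_def by (rule abs_nat_diff_ge_1[OF 1])
      ultimately show ?thesis unfolding dist using horiz[OF _ v] by blast
    next
      case 2
      have "hx d * hy u - hx u * hy d = - 2 * y * omega u v"
        by (simp add: dx dy omega_def algebra_simps)
      then have "\<bar>hx d * hy u - hx u * hy d\<bar> = 2 * \<bar>y\<bar> * \<bar>omega u v\<bar>" by (simp only: abs_mult abs_neg_numeral abs_numeral)
      moreover have "1 \<le> \<bar>y\<bar>" unfolding y_def by (rule abs_nat_diff_ge_1[OF 2])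
      ultimately show ?thesis unfolding dist using horiz[OF _ u] by blast
    qed
  next
    case True
    then have k: "k \<noteq> k'" using ne ab by auto
    have "ht d = 4 * (real k - real k') * omega u v"
      using True by (simp add: d_def lattice_point_def ab algebra_simps)
    then have "\<bar>ht d\<bar> = 4 * (\<bar>real k - real k'\<bar> * \<bar>omega u v\<bar>)"
      by (simp only: abs_mult abs_numeral mult.assoc)
    then have "16 * (\<bar>real k - real k'\<bar> * \<bar>omega u v\<bar>) \<le> (knorm d)\<^sup>2"
      using abs_ht_le_knorm[of d] by simp
    moreover have "1 * \<bar>omega u v\<bar> \<le> \<bar>real k - real k'\<bar> * \<bar>omega u v\<bar>"
      using abs_nat_diff_ge_1[OF k] by (intro mult_right_mono) auto
    ultimately have "4 * (\<epsilon>\<^sup>2 * r\<^sup>2) \<le> (knorm d)\<^sup>2" using w by linarith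
    then have "(2 * \<epsilon> * r)\<^sup>2 \<le> (knorm d)\<^sup>2" by (simp add: power_mult_distrib)
    then have 1: "2 * \<epsilon> * r \<le> knorm d" by (rule power2_le_imp_le) simp
    have "\<epsilon> * \<epsilon> \<le> 1 * \<epsilon>" using e by (intro mult_right_mono) auto
    then have "\<epsilon>\<^sup>2 * r \<le> \<epsilon> * r" using r by (simp add: power2_eq_square mult_right_mono)
    moreover have "0 \<le> \<epsilon> * r" using e r by simp
    ultimately show ?thesis using 1 unfolding dist by linarith
  qed
qed

text \<open>The bound on \<open>k\<close> may be quadratic because the gauge takes the root of
  heights. This is where the fourth dimension of the lattice comes from.\<close>

lemma knorm_lattice_point:
  assumes r: "0 < r" and u: "knorm u < r" and v: "knorm v < r"
    and n: "i \<le> n" "j \<le> n" "k \<le> n\<^sup>2"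
  shows "knorm (lattice_point u v (i, j, k)) \<le> 16 * real n * r"
proof -
  have k: "real k \<le> (real n)\<^sup>2" using n(3) by (metis of_nat_le_iff of_nat_power)
  have "\<bar>omega u v\<bar> \<le> \<bar>hx u\<bar> * \<bar>hy v\<bar> + \<bar>hx v\<bar> * \<bar>hy u\<bar>"
    unfolding omega_def by (metis abs_mult abs_triangle_ineq4)
  also have "\<dots> \<le> r * r + r * r"
    using abs_hx_le_knorm[of u] abs_hy_le_knorm[of u] abs_hx_le_knorm[of v] abs_hy_le_knorm[of v] u v r
    by (intro add_mono mult_mono) auto
  finally have w: "\<bar>omega u v\<bar> \<le> 2 * r\<^sup>2" by (simp add: power2_eq_square)
  define P where "P = lattice_point u v (i, j, k)"
  have h: "\<bar>2 * real i * x + 2 * real j * y\<bar> \<le> 4 * real n * r" if "\<bar>x\<bar> \<le> r" "\<bar>y\<bar> \<le> r" for x y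
  proof -
    have "\<bar>2 * real i * x + 2 * real j * y\<bar> \<le> 2 * (real i * \<bar>x\<bar>) + 2 * (real j * \<bar>y\<bar>)"
      using abs_triangle_ineq[of "2 * real i * x" "2 * real j * y"] by (simp add: abs_mult)
    also have "\<dots> \<le> 2 * (real n * r) + 2 * (real n * r)"
      using that n r by (intro add_mono mult_left_mono mult_mono) auto
    finally show ?thesis by linarith
  qed
  have "\<bar>hx P\<bar> \<le> 4 * real n * r" "\<bar>hy P\<bar> \<le> 4 * real n * r"
    unfolding P_def lattice_point_def using abs_hx_le_knorm[of u] abs_hy_le_knorm[of u]
      abs_hx_le_knorm[of v] abs_hy_le_knorm[of v] u v by (auto intro!: h)
  then have 1: "sqrt ((hx P)\<^sup>2 + (hy P)\<^sup>2) \<le> 8 * real n * r"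
    using sqrt_sum_squares_le_sum_abs[of "hx P" "hy P"] by linarith
  have "real i * real j \<le> (real n)\<^sup>2" using n by (auto simp: power2_eq_square intro!: mult_mono)
  then have "4 * real k + 2 * real i * real j \<le> 6 * (real n)\<^sup>2" using k by linarith
  then have "\<bar>4 * real k + 2 * real i * real j\<bar> \<le> 6 * (real n)\<^sup>2" by simp
  then have "\<bar>ht P\<bar> \<le> 6 * (real n)\<^sup>2 * (2 * r\<^sup>2)"
    unfolding P_def lattice_point_def prod.case heis.sel abs_mult[of _ "omega u v"]
    using w by (intro mult_mono) auto
  also have "\<dots> \<le> (4 * (real n * r))\<^sup>2" by (simp add: power_mult_distrib)
  finally have "sqrt \<bar>ht P\<bar> \<le> sqrt ((4 * (real n * r))\<^sup>2)" by (rule real_sqrt_le_mono)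
  also have "\<dots> = 4 * (real n * r)" using r by (intro real_sqrt_unique) auto
  finally have "sqrt \<bar>ht P\<bar> \<le> 4 * (real n * r)" .
  then show ?thesis using knorm_le[of P] 1 unfolding P_def by linarith
qed

section \<open>Growth of the lattice against 3-regularity\<close>

context regular_set begin

text \<open>Without an asymmetric pair \<open>E\<close> has a point near each of
  \<open>n ^ 4\<close> lattice points. The balls of radius \<open>s * r\<close> about these points
  are disjoint and lie in one ball of radius \<open>18 * n * r\<close>. Comparing the lower bound
  for their masses with the upper bound for the large ball gives
  \<open>n * s ^ 3 \<le> 18 ^ 3 * A\<^sup>2\<close>, which the choice of \<open>n\<close>
  excludes.\<close>

lemma flat_or_asymmetric:
  assumes e: "0 < \<epsilon>" "\<epsilon> \<le> 1"
  shows "\<exists>N \<eta>. 1 \<le> N \<and> 0 < \<eta> \<and> \<eta> \<le> 1 \<and> (\<forall>p\<in>E. \<forall>r>0. ennreal (N * r) \<le> ediam E \<longrightarrow>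
     ennreal \<epsilon> \<le> vertical_beta E p r \<longrightarrow>
     (\<exists>a\<in>E \<inter> ball p (N * r). \<exists>b\<in>E \<inter> ball p (N * r). \<forall>w\<in>E. \<eta> * r \<le> dist w (hsym a b)))"
proof -
  \<comment> \<open>Lattice points are at least \<open>4 * s * r\<close> apart and are approximated
    up to \<open>s * r\<close>, which leaves the approximants at least \<open>2 * s * r\<close>
    apart.\<close>
  define s where "s = \<epsilon>\<^sup>2 / 16"
  have s: "0 < s" "s \<le> 1" using e power_le_one[of \<epsilon> 2] by (auto simp: s_def)
  obtain n :: nat where n: "real n > 18 ^ 3 * A\<^sup>2 / s ^ 3" using reals_Archimedean2 by blast
  moreover have "18 ^ 3 * A\<^sup>2 / s ^ 3 > 0" using s A_ge_1 by simp
  ultimately have n0: "1 \<le> n" by (cases n) auto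
  \<comment> \<open>At most \<open>12 * n\<^sup>2\<close> reflections are applied. Each leads at
    most \<open>3 * r\<close> further away from \<open>p\<close>, whence
    \<open>36 * n\<^sup>2\<close>, and \<open>\<eta>\<close> makes their errors add up to at most
    \<open>s * r\<close>. The term \<open>18 * n\<close> makes room for the large ball.\<close>
  define N where "N = 36 * (real n)\<^sup>2 + 18 * real n"
  define \<eta> where "\<eta> = s / (12 * (real n)\<^sup>2)"
  have \<eta>0: "0 < \<eta>" using s n0 by (simp add: \<eta>_def)
  have n1: "1 \<le> real n" using n0 by simp
  have n2: "1 \<le> (real n)\<^sup>2" using n1 by (simp add: one_le_power)
  have \<eta>1: "\<eta> \<le> 1" proof -
    have "s \<le> 12 * (real n)\<^sup>2" using s n2 by linarith
    moreover have "0 < 12 * (real n)\<^sup>2" using n2 by linarith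
    ultimately show ?thesis unfolding \<eta>_def by (subst divide_le_eq_1_pos)
  qed
  have N1: "1 \<le> N" using n1 n2 unfolding N_def by linarith
  have False if p: "p \<in> E" and r: "0 < r" and diam: "ennreal (N * r) \<le> ediam E"
    and beta: "ennreal \<epsilon> \<le> vertical_beta E p r"
    and contr: "\<not> (\<exists>a\<in>E \<inter> ball p (N * r). \<exists>b\<in>E \<inter> ball p (N * r). \<forall>w\<in>E. \<eta> * r \<le> dist w (hsym a b))" for p r
  proof -
    obtain u v where uv: "p + u \<in> E" "p + v \<in> E" "knorm u < r" "knorm v < r"
      and w: "\<epsilon>\<^sup>2 * r\<^sup>2 / 4 \<le> \<bar>omega u v\<bar>"
      using vertical_beta_two_directions[OF r e(1) beta] by (elim exE conjE)
    define I where "I = {1..n} \<times> {1..n} \<times> {1..n\<^sup>2}"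
    have "\<exists>w\<in>E. dist w (p + lattice_point u v a) \<le> s * r" if aI: "a \<in> I" for a
    proof -
      obtain i j k where a: "a = (i, j, k)" "i \<le> n" "j \<le> n" "k \<le> n\<^sup>2" using aI by (auto simp: I_def)
      have "n \<le> n\<^sup>2" by (simp add: power2_eq_square)
      then have m: "8 * k + 2 * j + 2 * i \<le> 12 * n\<^sup>2" using a by linarith
      then have m': "real (8 * k + 2 * j + 2 * i) \<le> 12 * (real n)\<^sup>2"
        by (metis of_nat_le_iff of_nat_mult of_nat_numeral of_nat_power)
      have "\<exists>w\<in>E. dist w (p + lattice_point u v a) \<le> real (8 * k + 2 * j + 2 * i) * \<eta> * r"
        unfolding a(1) lattice_point_def prod.case
      proof (rule lattice_orbit_near[OF p uv(1,3) uv(2,4) \<eta>1])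
        show "3 * real (8 * k + 2 * j + 2 * i) < N" proof -
          have "3 * real (8 * k + 2 * j + 2 * i) \<le> 3 * (12 * (real n)\<^sup>2)"
            using m' by (rule mult_left_mono) simp
          also have "\<dots> < N" using n1 by (simp add: N_def)
          finally show ?thesis .
        qed
      qed (use contr N1 in \<open>auto simp: not_le\<close>)
      moreover have "real (8 * k + 2 * j + 2 * i) * \<eta> * r \<le> s * r"
      proof (rule mult_right_mono)
        have "real (8 * k + 2 * j + 2 * i) * \<eta> \<le> 12 * (real n)\<^sup>2 * \<eta>"
          using m' \<eta>0 by (intro mult_right_mono) auto
        then show "real (8 * k + 2 * j + 2 * i) * \<eta> \<le> s" using n0 by (simp add: \<eta>_def)
      qed (use r in simp)
      ultimately show ?thesis by (meson order_trans)
    qed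
    then obtain f where f: "\<And>a. a \<in> I \<Longrightarrow> f a \<in> E" "\<And>a. a \<in> I \<Longrightarrow> dist (f a) (p + lattice_point u v a) \<le> s * r"
      by metis
    have disj: "disjoint_family_on (\<lambda>a. E \<inter> ball (f a) (s * r)) I"
      unfolding disjoint_family_on_def
    proof (intro ballI impI)
      fix a b assume ab: "a \<in> I" "b \<in> I" "a \<noteq> b"
      have "4 * (s * r) \<le> dist (lattice_point u v a) (lattice_point u v b)"
        using lattice_point_separated[OF r e uv(3,4) w ab(3)] by (simp add: s_def mult.commute)
      also have "\<dots> = dist (p + lattice_point u v a) (p + lattice_point u v b)" by simp
      also have "\<dots> \<le> dist (f a) (p + lattice_point u v a) + dist (f a) (f b) + dist (f b) (p + lattice_point u v b)"
        using dist_triangle[of "p + lattice_point u v a" "p + lattice_point u v b" "f a"]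
          dist_triangle[of "f a" "p + lattice_point u v b" "f b"]
        unfolding dist_commute[of "p + lattice_point u v a" "f a"] by linarith
      finally have "2 * (s * r) \<le> dist (f a) (f b)" using f(2)[OF ab(1)] f(2)[OF ab(2)] by linarith
      then show "E \<inter> ball (f a) (s * r) \<inter> (E \<inter> ball (f b) (s * r)) = {}"
        using dist_triangle_half_l[of "f a" _ "2 * (s * r)" "f b"] by fastforce
    qed
    have sub: "E \<inter> ball (f a) (s * r) \<subseteq> E \<inter> ball p (18 * real n * r)" if a: "a \<in> I" for a
    proof -
      obtain i j k where ijk: "a = (i, j, k)" "i \<le> n" "j \<le> n" "k \<le> n\<^sup>2" using a by (auto simp: I_def)
      have "dist p (p + lattice_point u v a) \<le> 16 * real n * r"
        using knorm_lattice_point[OF r uv(3,4) ijk(2-4)] unfolding ijk(1) by simp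
      moreover have "s * r \<le> real n * r" using s n1 r by (intro mult_right_mono) auto
      \<comment> \<open>16 for the lattice point, and 1 each for the approximation and for the
        radius of the small ball.\<close>
      ultimately have "dist p (f a) + s * r \<le> 18 * real n * r"
        using f(2)[OF a] dist_triangle[of p "f a" "p + lattice_point u v a"]
        by (simp add: dist_commute[of "f a"])
      then have "dist p x < 18 * real n * r" if "dist (f a) x < s * r" for x
        using dist_triangle[of p x "f a"] that by linarith
      then show ?thesis by auto
    qed
    have card: "card I = n ^ 4" by (simp add: I_def power2_eq_square power4_eq_xxxx)
    have borel: "E \<inter> ball q t \<in> sets (hausdorff_measure 3)" for q t
      using closed by auto
    have Nn: "18 * real n \<le> N" "s \<le> N" using n1 n2 s unfolding N_def by linarith+
    have "18 * real n * r \<le> N * r" "s * r \<le> N * r" using Nn r by auto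
    then have le: "ennreal (18 * real n * r) \<le> ediam E" "ennreal (s * r) \<le> ediam E"
      using diam by (meson ennreal_leI order_trans)+
    have "ennreal (real (n ^ 4) * ((s * r) ^ 3 / A)) = (\<Sum>a\<in>I. ennreal ((s * r) ^ 3 / A))"
      unfolding sum_constant card ennreal_of_nat_eq_real_of_nat
      using s r A_ge_1 by (intro ennreal_mult) auto
    also have "\<dots> \<le> (\<Sum>a\<in>I. emeasure (hausdorff_measure 3) (E \<inter> ball (f a) (s * r)))"
      using le s r f(1) closed by (intro sum_mono) (simp add: emeasure_hausdorff_measure lower)
    also have "\<dots> = emeasure (hausdorff_measure 3) (\<Union>a\<in>I. E \<inter> ball (f a) (s * r))"
      using disj borel by (intro sum_emeasure) (auto simp: I_def)
    also have "\<dots> \<le> emeasure (hausdorff_measure 3) (E \<inter> ball p (18 * real n * r))"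
      using sub borel by (intro emeasure_mono) auto
    also have "\<dots> \<le> ennreal (A * (18 * real n * r) ^ 3)"
      using le r n0 p closed by (simp add: emeasure_hausdorff_measure upper)
    finally have "real (n ^ 4) * ((s * r) ^ 3 / A) \<le> A * (18 * real n * r) ^ 3"
      using A_ge_1 r by (subst (asm) ennreal_le_iff) auto
    moreover have "real (n ^ 4) * ((s * r) ^ 3 / A) = real n * s ^ 3 * (real n * r) ^ 3 / A"
      by (simp add: power_mult_distrib power4_eq_xxxx power3_eq_cube)
    moreover have "A * (18 * real n * r) ^ 3 = 18 ^ 3 * A * (real n * r) ^ 3"
      by (simp add: power_mult_distrib)
    ultimately have "real n * s ^ 3 * (real n * r) ^ 3 \<le> 18 ^ 3 * A * (real n * r) ^ 3 * A"
      using A_ge_1 by (simp add: pos_divide_le_eq)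
    then have "real n * s ^ 3 * (real n * r) ^ 3 \<le> 18 ^ 3 * A\<^sup>2 * (real n * r) ^ 3"
      by (simp add: power2_eq_square mult_ac)
    then have "real n * s ^ 3 \<le> 18 ^ 3 * A\<^sup>2" using n0 r by (simp add: mult_le_cancel_right)
    then show False using n s by (simp add: field_simps)
  qed
  then show ?thesis using \<eta>0 \<eta>1 N1 by (intro exI[of _ N] exI[of _ \<eta>]) blast
qed

end

section \<open>Lacunary sums of rescaled kernels are admissible\<close>

lemma dyadic_bracket:
  fixes x :: real
  assumes "0 < x"
  shows "2 powi \<lfloor>log 2 x\<rfloor> \<le> x" and "x < 2 powi (\<lfloor>log 2 x\<rfloor> + 1)"
proof -
  have "2 powr real_of_int \<lfloor>log 2 x\<rfloor> \<le> x" using assms by (simp flip: le_log_iff)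
  then show "2 powi \<lfloor>log 2 x\<rfloor> \<le> x" by (simp add: powr_real_of_int')
  have "x < 2 powr real_of_int (\<lfloor>log 2 x\<rfloor> + 1)" using assms by (simp flip: log_less_iff)
  then show "x < 2 powi (\<lfloor>log 2 x\<rfloor> + 1)" by (subst (asm) powr_real_of_int') auto
qed

lemma powi_2_less: "i < j \<Longrightarrow> 2 * (2 :: real) powi i \<le> 2 powi j"
  using power_int_increasing[of "i + 1" j "2 :: real"] by (simp add: power_int_add)

lemma dyadic_unique:
  fixes x :: real
  assumes "2 powi j \<le> x" "x < 2 * 2 powi j"
  shows "\<lfloor>log 2 x\<rfloor> = j"
proof -
  have x: "0 < x" using assms(1) by (meson less_le_trans zero_less_numeral zero_less_power_int)
  have b: "2 powi \<lfloor>log 2 x\<rfloor> \<le> x" "x < 2 * 2 powi \<lfloor>log 2 x\<rfloor>"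
    using dyadic_bracket[OF x] by (simp_all add: power_int_add)
  show ?thesis
  proof (rule linorder_cases[of "\<lfloor>log 2 x\<rfloor>" j])
    assume "\<lfloor>log 2 x\<rfloor> < j"
    then show ?thesis using powi_2_less[of "\<lfloor>log 2 x\<rfloor>" j] b(2) assms(1) by linarith
  next
    assume "j < \<lfloor>log 2 x\<rfloor>"
    then show ?thesis using powi_2_less[of j "\<lfloor>log 2 x\<rfloor>"] b(1) assms(2) by linarith
  qed
qed

definition coords :: "heis \<Rightarrow> real3" where
  "coords p = (hx p, hy p, ht p)"

definition of_coords :: "real3 \<Rightarrow> heis" where
  "of_coords = (\<lambda>(x, y, t). Heis x y t)"

lemma of_coords_coords [simp]: "of_coords (coords p) = p" "coords (of_coords x) = x"
  by (auto simp: of_coords_def coords_def split: prod.split)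

lemma of_coords_eq_0 [simp]: "of_coords x = 0 \<longleftrightarrow> x = 0"
  by (auto simp: of_coords_def zero_heis_def zero_prod_def split: prod.split)

lemma continuous_knorm_of_coords: "continuous_on UNIV (\<lambda>x. knorm (of_coords x))"
  using continuous_knorm_Heis by (simp add: of_coords_def case_prod_beta')

text \<open>The exponent is a parameter because each horizontal derivative raises it by one; kernels
  start with 3.\<close>

definition rescale :: "nat \<Rightarrow> (real3 \<Rightarrow> real) \<Rightarrow> real \<Rightarrow> real3 \<Rightarrow> real" where
  "rescale n g c x = g (coords (dil (1 / c) (of_coords x))) / c ^ n"

lemma rescale_triple: "rescale n g c (x, y, t) = g (x / c, y / c, t / c\<^sup>2) / c ^ n"
  by (simp add: rescale_def coords_def of_coords_def power_divide)

lemma elem_fun_rescale: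
  assumes "elem_fun g"
  shows "elem_fun (rescale n g c)"
proof -
  have "bounded_linear (\<lambda>x :: real3. (fst x / c, fst (snd x) / c, snd (snd x) / c\<^sup>2))"
    by (intro bounded_linear_Pair bounded_linear_divide[THEN bounded_linear_compose]
        bounded_linear_fst bounded_linear_snd bounded_linear_fst[THEN bounded_linear_compose]
        bounded_linear_snd[THEN bounded_linear_compose])
  then have "elem_fun (\<lambda>x. (1 / c ^ n) * g (fst x / c, fst (snd x) / c, snd (snd x) / c\<^sup>2))"
    by (intro elem_fun_cmult elem_fun_compose_linear[OF assms])
  moreover have "(\<lambda>x. (1 / c ^ n) * g (fst x / c, fst (snd x) / c, snd (snd x) / c\<^sup>2)) = rescale n g c"
    by (auto simp: rescale_triple)
  ultimately show ?thesis by simp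
qed

text \<open>As both inequalities are strict, the supports of the rescalings by powers of 2 are
  separated by gaps around the radii \<open>\<rho> * 2 powi j\<close>. The smoothness of the sums
  and the exactness of dyadic truncations rest on these gaps.\<close>

locale annulus =
  fixes \<rho> a b :: real
  assumes rho: "0 < \<rho>" and a: "\<rho> < a" and b: "0 < b" "b < 2 * \<rho>"
begin

definition supported :: "(real3 \<Rightarrow> real) \<Rightarrow> bool" where
  "supported g \<longleftrightarrow> (\<forall>x. g x \<noteq> 0 \<longrightarrow> a \<le> knorm (of_coords x) \<and> knorm (of_coords x) \<le> b)"

definition dyad :: "heis \<Rightarrow> int" where
  "dyad p = \<lfloor>log 2 (knorm p / \<rho>)\<rfloor>"

text \<open>The series over all scales, written with the only summand that can be nonzero at
  \<open>p\<close> when \<open>g\<close> is supported in the annulus. No question of convergence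
  arises.\<close>

definition lacunary :: "(int \<Rightarrow> real) \<Rightarrow> nat \<Rightarrow> (real3 \<Rightarrow> real) \<Rightarrow> heis \<Rightarrow> real" where
  "lacunary s n g p = (if p = 0 then 0 else s (dyad p) * rescale n g (2 powi dyad p) (coords p))"

lemma rescale_support:
  assumes "supported g" "0 < c" "rescale n g c x \<noteq> 0"
  shows "a * c \<le> knorm (of_coords x)" "knorm (of_coords x) \<le> b * c"
proof -
  have "g (coords (dil (1 / c) (of_coords x))) \<noteq> 0" using assms(3) by (simp add: rescale_def)
  then have "a \<le> knorm (dil (1 / c) (of_coords x))" "knorm (dil (1 / c) (of_coords x)) \<le> b"
    using assms(1) unfolding supported_def by (metis of_coords_coords(1))+
  then show "a * c \<le> knorm (of_coords x)" "knorm (of_coords x) \<le> b * c"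
    using assms(2) by (simp_all add: knorm_dil pos_le_divide_eq pos_divide_le_eq)
qed

lemma dyad_bracket:
  assumes "p \<noteq> 0"
  shows "\<rho> * 2 powi dyad p \<le> knorm p" "knorm p < \<rho> * 2 * 2 powi dyad p"
proof -
  have "0 < knorm p" using assms knorm_eq_0_iff[of p] knorm_nonneg[of p] by linarith
  then have "0 < knorm p / \<rho>" using rho by simp
  from dyadic_bracket[OF this] show "\<rho> * 2 powi dyad p \<le> knorm p" "knorm p < \<rho> * 2 * 2 powi dyad p"
    using rho by (simp_all add: dyad_def power_int_add field_simps)
qed

lemma rescale_off_dyad:
  assumes "supported g" "p \<noteq> 0" "j \<noteq> dyad p"
  shows "rescale n g (2 powi j) (coords p) = 0"
proof (rule ccontr)
  assume "rescale n g (2 powi j) (coords p) \<noteq> 0"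
  from rescale_support[OF assms(1) _ this]
  have 1: "a * 2 powi j \<le> knorm p" "knorm p \<le> b * 2 powi j" by auto
  have "\<rho> * 2 powi j \<le> a * 2 powi j" using a by (intro mult_right_mono) auto
  moreover have "b * 2 powi j < (2 * \<rho>) * 2 powi j" using b by (intro mult_strict_right_mono) auto
  ultimately have "\<rho> * 2 powi j \<le> knorm p" "knorm p < (2 * \<rho>) * 2 powi j" using 1 by linarith+
  then have "\<lfloor>log 2 (knorm p / \<rho>)\<rfloor> = j"
    using rho by (intro dyadic_unique) (simp_all add: field_simps)
  then show False using assms(3) by (simp add: dyad_def)
qed

text \<open>The support of \<open>g\<close> stays away from the boundary of the annulus \<open>\<rho> \<le> |x| \<le> 2\<rho>\<close>, so that
  the sum has only one term near each point.\<close>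

lemma lacunary_locally:
  assumes "x \<noteq> 0"
  shows "\<exists>U. open U \<and> x \<in> U \<and> (\<forall>y\<in>U. y \<noteq> 0 \<and> (\<forall>s n g. supported g \<longrightarrow>
     lacunary s n g (of_coords y) = s (dyad (of_coords x)) * rescale n g (2 powi dyad (of_coords x)) y))"
proof -
  define j where "j = dyad (of_coords x)"
  \<comment> \<open>\<open>U\<close> reaches below the annulus of \<open>x\<close>, down to where
    the support of the summand \<open>j - 1\<close> ends. In this extra part all summands vanish, so
    the formula with the fixed index \<open>j\<close> remains correct there.\<close>
  define U where "U = (\<lambda>y. knorm (of_coords y)) -` {b * (2 powi j / 2)<..<\<rho> * 2 * 2 powi j}"
  have 1: "open U" unfolding U_def
    by (rule open_vimage[OF _ continuous_knorm_of_coords]) simp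
  have 2: "x \<in> U"
  proof -
    have "b * (2 powi j / 2) < (2 * \<rho>) * (2 powi j / 2)" using b by (intro mult_strict_right_mono) auto
    also have "\<dots> = \<rho> * 2 powi j" by simp
    also have "\<dots> \<le> knorm (of_coords x)" using dyad_bracket(1)[of "of_coords x"] assms by (simp add: j_def)
    finally show ?thesis
      using dyad_bracket(2)[of "of_coords x"] assms
      unfolding U_def j_def vimage_eq greaterThanLessThan_iff of_coords_eq_0 by blast
  qed
  have 3: "y \<noteq> 0" if "y \<in> U" for y
  proof -
    have "0 < b * (2 powi j / 2)" using b by simp
    then have "knorm (of_coords y) \<noteq> 0" using that by (auto simp: U_def)
    then show ?thesis using knorm_eq_0_iff[of "of_coords y"] by auto
  qed
  have 4: "lacunary s n g (of_coords y) = s j * rescale n g (2 powi j) y"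
    if y: "y \<in> U" and g: "supported g" for y s n g
  proof -
    have y0: "of_coords y \<noteq> 0" using 3[OF y] by simp
    show "lacunary s n g (of_coords y) = s j * rescale n g (2 powi j) y"
    proof (cases "dyad (of_coords y) = j")
      case True
      then show ?thesis using y0 by (simp add: lacunary_def)
    next
      case False
      define i where "i = dyad (of_coords y)"
      have i: "i < j"
      proof (rule ccontr)
        assume "\<not> i < j"
        then have "2 * 2 powi j \<le> (2 powi i :: real)" using False by (intro powi_2_less) (simp add: i_def)
        then have "\<rho> * (2 * 2 powi j) \<le> \<rho> * 2 powi i" using rho by (intro mult_left_mono) auto
        then have "\<rho> * 2 * 2 powi j \<le> knorm (of_coords y)"
          using dyad_bracket(1)[OF y0] unfolding i_def by linarith
        then show False using y unfolding U_def by (simp only: vimage_eq greaterThanLessThan_iff) linarith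
      qed
      have "rescale n g (2 powi i) y = 0"
      proof (rule ccontr)
        assume "rescale n g (2 powi i) y \<noteq> 0"
        then have "knorm (of_coords y) \<le> b * 2 powi i" by (intro rescale_support(2)[OF g]) auto
        also have "\<dots> \<le> b * (2 powi j / 2)" using powi_2_less[OF i] b by (intro mult_left_mono) auto
        finally show False using y unfolding U_def by (simp only: vimage_eq greaterThanLessThan_iff) linarith
      qed
      moreover have "rescale n g (2 powi j) y = 0"
        using rescale_off_dyad[OF g y0, of j n] False by simp
      ultimately show ?thesis using y0 by (simp add: lacunary_def i_def)
    qed
  qed
  show ?thesis
    unfolding j_def[symmetric] by (rule exI[of _ U]) (intro conjI ballI allI impI 1 2 3 4)
qed

section \<open>Horizontal derivatives of lacunary sums\<close>

definition deriv_X :: "(real3 \<Rightarrow> real3 \<Rightarrow> real) \<Rightarrow> real3 \<Rightarrow> real" where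
  "deriv_X g' x = g' x (1, 0, 0) - fst (snd x) / 2 * g' x (0, 0, 1)"

definition deriv_Y :: "(real3 \<Rightarrow> real3 \<Rightarrow> real) \<Rightarrow> real3 \<Rightarrow> real" where
  "deriv_Y g' x = g' x (0, 1, 0) + fst x / 2 * g' x (0, 0, 1)"

lemma deriv_rescale:
  assumes g: "\<And>x. (g has_derivative g' x) (at x)" and c: "0 < c"
  shows "((\<lambda>x. rescale n g c (x, y, t)) has_real_derivative g' (x / c, y / c, t / c\<^sup>2) (1, 0, 0) / c ^ (n + 1)) (at x)"
    and "((\<lambda>y. rescale n g c (x, y, t)) has_real_derivative g' (x / c, y / c, t / c\<^sup>2) (0, 1, 0) / c ^ (n + 1)) (at y)"
    and "((\<lambda>t. rescale n g c (x, y, t)) has_real_derivative g' (x / c, y / c, t / c\<^sup>2) (0, 0, 1) / c ^ (n + 2)) (at t)"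
proof -
  have lin: "g' z (h * u, h * v, h * w) = h * g' z (u, v, w)" for z h u v w
    using has_derivative_bounded_linear[OF g[of z], THEN bounded_linear.linear, THEN linear_scale, of h "(u, v, w)"]
    by simp
  have lin': "g' z (h * u, 0, 0) = h * g' z (u, 0, 0)" "g' z (0, h * u, 0) = h * g' z (0, u, 0)"
     "g' z (0, 0, h * u) = h * g' z (0, 0, u)" for z h u
    using lin[of z h u 0 0] lin[of z h 0 u 0] lin[of z h 0 0 u] by simp_all
  let ?z = "(x / c, y / c, t / c\<^sup>2)"
  have "((\<lambda>x. (x / c, y / c, t / c\<^sup>2)) has_derivative (\<lambda>h. (h / c, 0, 0))) (at x)"
    by (intro has_derivative_Pair has_derivative_const bounded_linear_imp_has_derivative bounded_linear_divide)
  from has_derivative_compose[OF this g]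
  have "((\<lambda>x. g (x / c, y / c, t / c\<^sup>2) / c ^ n) has_derivative (\<lambda>h. g' ?z (h / c, 0, 0) / c ^ n)) (at x)"
    by (rule bounded_linear.has_derivative[OF bounded_linear_divide])
  moreover have "(\<lambda>h. g' ?z (h / c, 0, 0) / c ^ n) = (*) (g' ?z (1, 0, 0) / c ^ (n + 1))"
    using lin'(1)[of ?z "_ / c" 1] by (auto simp: fun_eq_iff)
  ultimately show "((\<lambda>x. rescale n g c (x, y, t)) has_real_derivative g' ?z (1, 0, 0) / c ^ (n + 1)) (at x)"
    by (simp add: has_field_derivative_def rescale_triple)
  have "((\<lambda>y. (x / c, y / c, t / c\<^sup>2)) has_derivative (\<lambda>h. (0, h / c, 0))) (at y)"
    by (intro has_derivative_Pair has_derivative_const bounded_linear_imp_has_derivative bounded_linear_divide)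
  from has_derivative_compose[OF this g]
  have "((\<lambda>y. g (x / c, y / c, t / c\<^sup>2) / c ^ n) has_derivative (\<lambda>h. g' ?z (0, h / c, 0) / c ^ n)) (at y)"
    by (rule bounded_linear.has_derivative[OF bounded_linear_divide])
  moreover have "(\<lambda>h. g' ?z (0, h / c, 0) / c ^ n) = (*) (g' ?z (0, 1, 0) / c ^ (n + 1))"
    using lin'(2)[of ?z "_ / c" 1] by (auto simp: fun_eq_iff)
  ultimately show "((\<lambda>y. rescale n g c (x, y, t)) has_real_derivative g' ?z (0, 1, 0) / c ^ (n + 1)) (at y)"
    by (simp add: has_field_derivative_def rescale_triple)
  have "((\<lambda>t. (x / c, y / c, t / c\<^sup>2)) has_derivative (\<lambda>h. (0, 0, h / c\<^sup>2))) (at t)"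
    by (intro has_derivative_Pair has_derivative_const bounded_linear_imp_has_derivative bounded_linear_divide)
  from has_derivative_compose[OF this g]
  have "((\<lambda>t. g (x / c, y / c, t / c\<^sup>2) / c ^ n) has_derivative (\<lambda>h. g' ?z (0, 0, h / c\<^sup>2) / c ^ n)) (at t)"
    by (rule bounded_linear.has_derivative[OF bounded_linear_divide])
  moreover have "(\<lambda>h. g' ?z (0, 0, h / c\<^sup>2) / c ^ n) = (*) (g' ?z (0, 0, 1) / c ^ (n + 2))"
    using lin'(3)[of ?z "_ / c\<^sup>2" 1] by (auto simp: fun_eq_iff power2_eq_square mult_ac)
  ultimately show "((\<lambda>t. rescale n g c (x, y, t)) has_real_derivative g' ?z (0, 0, 1) / c ^ (n + 2)) (at t)"
    by (simp add: has_field_derivative_def rescale_triple)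
qed

lemma supported_derivative:
  assumes g: "\<And>x. (g has_derivative g' x) (at x)" and s: "supported g"
  shows "supported (deriv_X g')" "supported (deriv_Y g')"
proof -
  define S where "S = (\<lambda>x. knorm (of_coords x)) -` {a..b}"
  have "closed S" unfolding S_def by (rule closed_vimage[OF _ continuous_knorm_of_coords]) simp
  have "g' x = (\<lambda>_. 0)" if "x \<notin> S" for x
  proof -
    have "((\<lambda>_. 0) has_derivative g' x) (at x)"
      by (rule has_derivative_transform_within_open[OF g[of x], of "- S"])
         (use that \<open>closed S\<close> s in \<open>auto simp: S_def supported_def\<close>)
    then show ?thesis using has_derivative_unique has_derivative_const by blast
  qed
  then have "deriv_X g' x = 0" "deriv_Y g' x = 0" if "x \<notin> S" for x
    using that by (simp_all add: deriv_X_def deriv_Y_def)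
  then have "x \<in> S" if "deriv_X g' x \<noteq> 0 \<or> deriv_Y g' x \<noteq> 0" for x using that by blast
  then show "supported (deriv_X g')" "supported (deriv_Y g')"
    unfolding supported_def S_def by auto
qed

text \<open>Bookkeeping of weights, used with \<open>d = c ^ (n + 1)\<close>: the vertical
  derivative carries one more power of \<open>c\<close> in the denominator, and its coefficient
  \<open>x\<close>, being \<open>c\<close> times the rescaled coordinate, compensates for
  it.\<close>

lemma quotient_add: "s * (A / d) + x / 2 * (s * (B / (c * d))) = s * ((A + x / c / 2 * B) / d)"
  for s A B c d x :: real
  by (cases "d = 0"; cases "c = 0") (simp_all add: field_simps)

lemma quotient_diff: "s * (A / d) - x / 2 * (s * (B / (c * d))) = s * ((A - x / c / 2 * B) / d)"
  for s A B c d x :: real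
  by (cases "d = 0"; cases "c = 0") (simp_all add: field_simps)

text \<open>Near \<open>p\<close> the scale is frozen by \<open>lacunary_locally\<close>, so a
  single rescaled function is differentiated. \<open>D\<close> is compared with a lacunary sum off
  the origin only, since nothing is known about \<open>vf_X\<close> and \<open>vf_Y\<close> at the
  origin; in this form the statement can be iterated.\<close>

lemma vf_lacunary:
  assumes g: "\<And>x. (g has_derivative g' x) (at x)" and s: "supported g"
    and D: "\<And>p. p \<noteq> 0 \<Longrightarrow> D p = lacunary s n g p" and p: "p \<noteq> 0"
  shows "vf_X D p = lacunary s (n + 1) (deriv_X g') p" "vf_Y D p = lacunary s (n + 1) (deriv_Y g') p"
proof -
  obtain x y t where xyt: "p = Heis x y t" by (cases p)
  define j where "j = dyad p"
  define c where "c = (2 :: real) powi j"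
  have c: "0 < c" by (simp add: c_def)
  have xyt': "of_coords (x, y, t) = p" by (simp add: of_coords_def xyt)
  obtain U where U: "open U" "(x, y, t) \<in> U"
    "\<And>z. z \<in> U \<Longrightarrow> z \<noteq> 0" "\<And>z. z \<in> U \<Longrightarrow> lacunary s n g (of_coords z) = s j * rescale n g c z"
  proof -
    have "(x, y, t) \<noteq> 0" using p xyt' by (metis of_coords_eq_0)
    then obtain U where "open U" "(x, y, t) \<in> U" and U: "\<forall>z\<in>U. z \<noteq> 0 \<and> (\<forall>s n g. supported g \<longrightarrow>
        lacunary s n g (of_coords z) = s j * rescale n g c z)"
      using lacunary_locally[OF \<open>(x, y, t) \<noteq> 0\<close>] unfolding xyt' j_def c_def by (elim exE conjE)
    then show ?thesis using s by (intro that[of U]) simp_all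
  qed
  have U': "D (of_coords z) = s j * rescale n g c z" if "z \<in> U" for z
    using D[of "of_coords z"] U(3,4)[OF that] by simp
  have ev: "eventually (\<lambda>w. D (of_coords (f w)) = s j * rescale n g c (f w)) (nhds u)"
    if "isCont f u" "f u = (x, y, t)" for f :: "real \<Rightarrow> real3" and u
  proof -
    have "eventually (\<lambda>w. f w \<in> U) (nhds u)"
      using that(1)[unfolded isCont_def tendsto_at_iff_tendsto_nhds] U(1,2) that(2)
      by (intro topological_tendstoD) auto
    then show ?thesis by eventually_elim (rule U')
  qed
  let ?z = "(x / c, y / c, t / c\<^sup>2)"
  have X: "((\<lambda>x. D (Heis x y t)) has_real_derivative s j * (g' ?z (1, 0, 0) / c ^ (n + 1))) (at x)"
  proof -
    have 1: "((\<lambda>x. s j * rescale n g c (x, y, t)) has_real_derivative s j * (g' ?z (1, 0, 0) / c ^ (n + 1))) (at x)"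
      by (intro DERIV_cmult deriv_rescale(1)[OF g c])
    have "isCont (\<lambda>x. (x, y, t)) x" by (intro continuous_intros)
    from ev[OF this refl, unfolded of_coords_def prod.case]
    have "eventually (\<lambda>x. D (Heis x y t) = s j * rescale n g c (x, y, t)) (nhds x)" .
    from DERIV_cong_ev[OF refl this refl] 1 show ?thesis by (rule iffD2)
  qed
  have Y: "((\<lambda>y. D (Heis x y t)) has_real_derivative s j * (g' ?z (0, 1, 0) / c ^ (n + 1))) (at y)"
  proof -
    have 1: "((\<lambda>y. s j * rescale n g c (x, y, t)) has_real_derivative s j * (g' ?z (0, 1, 0) / c ^ (n + 1))) (at y)"
      by (intro DERIV_cmult deriv_rescale(2)[OF g c])
    have "isCont (\<lambda>y. (x, y, t)) y" by (intro continuous_intros)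
    from ev[OF this refl, unfolded of_coords_def prod.case]
    have "eventually (\<lambda>y. D (Heis x y t) = s j * rescale n g c (x, y, t)) (nhds y)" .
    from DERIV_cong_ev[OF refl this refl] 1 show ?thesis by (rule iffD2)
  qed
  have T: "((\<lambda>t. D (Heis x y t)) has_real_derivative s j * (g' ?z (0, 0, 1) / c ^ (n + 2))) (at t)"
  proof -
    have 1: "((\<lambda>t. s j * rescale n g c (x, y, t)) has_real_derivative s j * (g' ?z (0, 0, 1) / c ^ (n + 2))) (at t)"
      by (intro DERIV_cmult deriv_rescale(3)[OF g c])
    have "isCont (\<lambda>t. (x, y, t)) t" by (intro continuous_intros)
    from ev[OF this refl, unfolded of_coords_def prod.case]
    have "eventually (\<lambda>t. D (Heis x y t) = s j * rescale n g c (x, y, t)) (nhds t)" .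
    from DERIV_cong_ev[OF refl this refl] 1 show ?thesis by (rule iffD2)
  qed
  have rhs: "lacunary s (n + 1) h p = s j * (h ?z / c ^ (n + 1))" for h
    unfolding lacunary_def j_def[symmetric] c_def[symmetric]
    using p by (simp only: if_False) (simp only: xyt coords_def heis.sel rescale_triple)
  have cn: "c ^ (n + 2) = c * c ^ (n + 1)" by simp
  have "vf_X D p = s j * (g' ?z (1, 0, 0) / c ^ (n + 1)) - y / 2 * (s j * (g' ?z (0, 0, 1) / c ^ (n + 2)))"
    using DERIV_imp_deriv[OF X] DERIV_imp_deriv[OF T] by (simp only: vf_X_def xyt heis.sel)
  also have "\<dots> = s j * ((g' ?z (1, 0, 0) - y / c / 2 * g' ?z (0, 0, 1)) / c ^ (n + 1))"
    unfolding cn by (rule quotient_diff)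
  also have "\<dots> = lacunary s (n + 1) (deriv_X g') p"
    unfolding rhs deriv_X_def fst_conv snd_conv ..
  finally show "vf_X D p = lacunary s (n + 1) (deriv_X g') p" .
  have "vf_Y D p = s j * (g' ?z (0, 1, 0) / c ^ (n + 1)) + x / 2 * (s j * (g' ?z (0, 0, 1) / c ^ (n + 2)))"
    using DERIV_imp_deriv[OF Y] DERIV_imp_deriv[OF T] by (simp only: vf_Y_def xyt heis.sel)
  also have "\<dots> = s j * ((g' ?z (0, 1, 0) + x / c / 2 * g' ?z (0, 0, 1)) / c ^ (n + 1))"
    unfolding cn by (rule quotient_add)
  also have "\<dots> = lacunary s (n + 1) (deriv_Y g') p"
    unfolding rhs deriv_Y_def fst_conv snd_conv ..
  finally show "vf_Y D p = lacunary s (n + 1) (deriv_Y g') p" .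
qed

lemma horizontal_derivs_lacunary:
  assumes "elem_fun g" "supported g" "D \<in> horizontal_derivs j (lacunary s n g)"
  shows "\<exists>h. elem_fun h \<and> supported h \<and> (\<forall>p. p \<noteq> 0 \<longrightarrow> D p = lacunary s (n + j) h p)"
  using assms(3)
proof (induction j arbitrary: D)
  case 0
  then show ?case using assms by auto
next
  case (Suc j)
  then obtain D' where D': "D' \<in> horizontal_derivs j (lacunary s n g)" "D = vf_X D' \<or> D = vf_Y D'"
    by auto
  obtain h where h: "elem_fun h" "supported h" "\<And>p. p \<noteq> 0 \<Longrightarrow> D' p = lacunary s (n + j) h p"
    using Suc.IH[OF D'(1)] by blast
  obtain h' where h': "\<And>x. (h has_derivative h' x) (at x)" "\<And>v. elem_fun (\<lambda>x. h' x v)"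
    using elem_fun_has_derivative[OF h(1)] by blast
  have eq: "deriv_X h' = (\<lambda>x. h' x (1, 0, 0) - (1 / 2) * fst (snd x) * h' x (0, 0, 1))"
    "deriv_Y h' = (\<lambda>x. h' x (0, 1, 0) + (1 / 2) * fst x * h' x (0, 0, 1))"
    by (auto simp: deriv_X_def deriv_Y_def)
  have "elem_fun (deriv_X h')" "elem_fun (deriv_Y h')"
    unfolding eq
    by (intro elem_fun_diff elem_fun.add elem_fun.mult elem_fun_cmult h'(2) elem_fun_coord)+
  then show ?case
    using D'(2) supported_derivative[OF h'(1) h(2)] vf_lacunary[OF h'(1) h(2,3)] by auto
qed

section \<open>Size estimates and admissibility\<close>

lemma supported_bounded:
  assumes "elem_fun g" "supported g"
  shows "\<exists>B\<ge>0. \<forall>x. \<bar>g x\<bar> \<le> B"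
proof -
  define S where "S = {- b..b} \<times> {- b..b} \<times> {- (b\<^sup>2)..b\<^sup>2}"
  have "compact S" unfolding S_def by (intro compact_Times) auto
  then have "compact (g ` S)"
    by (intro compact_continuous_image continuous_on_subset[OF elem_fun_continuous[OF assms(1)]]) auto
  then obtain B where B: "\<And>y. y \<in> g ` S \<Longrightarrow> \<bar>y\<bar> \<le> B"
    using compact_imp_bounded bounded_real by metis
  have "\<bar>g x\<bar> \<le> max B 0" for x
  proof (cases "g x = 0")
    case False
    define p where "p = of_coords x"
    have x: "x = (hx p, hy p, ht p)" by (auto simp: p_def of_coords_def split: prod.split)
    have "knorm p \<le> b" using False assms(2) unfolding supported_def p_def by blast
    moreover then have "(knorm p)\<^sup>2 \<le> b\<^sup>2" by (intro power_mono) auto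
    moreover have "\<bar>ht p\<bar> \<le> b\<^sup>2" using calculation(2) abs_ht_le_knorm[of p] by linarith
    ultimately have "x \<in> S"
      unfolding x using abs_hx_le_knorm[of p] abs_hy_le_knorm[of p] by (auto simp: S_def)
    then show ?thesis using B[of "g x"] by auto
  qed auto
  then show ?thesis by (intro exI[of _ "max B 0"]) auto
qed

text \<open>\<open>knorm p\<close> is comparable with the scale \<open>2 powi dyad p\<close>, so the
  denominator of \<open>rescale\<close> turns into the required power of the gauge.\<close>

lemma lacunary_bound:
  assumes "elem_fun g" "supported g" and s: "\<And>j. \<bar>s j\<bar> \<le> 1"
  shows "\<exists>C. \<forall>p. p \<noteq> 0 \<longrightarrow> \<bar>lacunary s n g p\<bar> \<le> C * knorm p powr (- real n)"
proof -
  obtain B where B: "0 \<le> B" "\<And>x. \<bar>g x\<bar> \<le> B" using supported_bounded[OF assms(1,2)] by blast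
  have "\<bar>lacunary s n g p\<bar> \<le> B * (2 * \<rho>) ^ n * knorm p powr (- real n)" if p: "p \<noteq> 0" for p
  proof -
    define c where "c = (2 :: real) powi dyad p"
    have c: "0 < c" by (simp add: c_def)
    have k: "0 < knorm p" using p knorm_eq_0_iff[of p] knorm_nonneg[of p] by linarith
    have "knorm p ^ n \<le> ((2 * \<rho>) * c) ^ n"
      using dyad_bracket(2)[OF p] by (intro power_mono) (auto simp: c_def)
    then have inv: "1 / c ^ n \<le> (2 * \<rho>) ^ n / knorm p ^ n"
      using c k by (simp add: field_simps power_mult_distrib)
    have "\<bar>lacunary s n g p\<bar> = \<bar>s (dyad p)\<bar> * (\<bar>g (coords (dil (1 / c) p))\<bar> * (1 / c ^ n))"
      using p c by (simp add: lacunary_def rescale_def abs_mult flip: c_def)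
    also have "\<dots> \<le> 1 * (B * ((2 * \<rho>) ^ n / knorm p ^ n))"
      using s B inv c by (intro mult_mono) auto
    also have "\<dots> = B * (2 * \<rho>) ^ n * knorm p powr (- real n)"
      using k by (simp add: powr_minus powr_realpow field_simps)
    finally show ?thesis .
  qed
  then show ?thesis by blast
qed

lemma admissible_lacunary:
  assumes g: "elem_fun g" "supported g" and anti: "\<And>x y t. g (- x, - y, t) = - g (x, y, t)"
    and s: "\<And>j. \<bar>s j\<bar> \<le> 1"
  shows "admissible_kernel (lacunary s 3 g)"
  unfolding admissible_kernel_def
proof (intro conjI allI impI)
  have "locally_elem (\<lambda>x. lacunary s 3 g (of_coords x))"
    unfolding locally_elem_def
  proof (intro allI impI)
    fix x :: real3 assume "x \<noteq> 0"
    then obtain U where "open U" "x \<in> U"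
      "\<forall>y\<in>U. lacunary s 3 g (of_coords y) = s (dyad (of_coords x)) * rescale 3 g (2 powi dyad (of_coords x)) y"
      using lacunary_locally[of x] g(2) by blast
    moreover have "elem_fun (\<lambda>y. s (dyad (of_coords x)) * rescale 3 g (2 powi dyad (of_coords x)) y)"
      by (intro elem_fun_cmult elem_fun_rescale g)
    ultimately show "\<exists>U h. open U \<and> x \<in> U \<and> elem_fun h \<and> (\<forall>y\<in>U. lacunary s 3 g (of_coords y) = h y)"
      by blast
  qed
  from locally_elem_smooth_on[OF this]
  show "smooth_on (\<lambda>(x, y, t). lacunary s 3 g (Heis x y t)) (- {(0, 0, 0)})"
    by (simp add: of_coords_def case_prod_beta' zero_prod_def)
  fix p :: heis assume p: "p \<noteq> 0"
  have "hconj p \<noteq> 0" using p by (metis hconj_hconj knorm_eq_0_iff knorm_hconj)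
  moreover have "rescale 3 g c (coords (hconj p)) = - rescale 3 g c (coords p)" for c
  proof -
    have "g (coords (hconj q)) = - g (coords q)" for q by (simp add: coords_def anti)
    then show ?thesis by (simp add: rescale_def dil_hconj)
  qed
  ultimately show "lacunary s 3 g (hconj p) = - lacunary s 3 g p"
    using p by (simp add: lacunary_def dyad_def)
next
  fix j
  have fin: "finite (horizontal_derivs j K)" for K by (induction j) auto
  have "\<exists>C. \<forall>p. p \<noteq> 0 \<longrightarrow> \<bar>D p\<bar> \<le> C * knorm p powr (- 3 - real j)"
    if D: "D \<in> horizontal_derivs j (lacunary s 3 g)" for D
  proof -
    obtain h where h: "elem_fun h" "supported h" "\<And>p. p \<noteq> 0 \<Longrightarrow> D p = lacunary s (3 + j) h p"
      using horizontal_derivs_lacunary[OF g D] by blast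
    have "- 3 - real j = - real (3 + j)" by simp
    then show ?thesis using lacunary_bound[of h s "3 + j", OF h(1,2) s] h(3) by (simp only:) auto
  qed
  then obtain C where C: "\<And>D p. D \<in> horizontal_derivs j (lacunary s 3 g) \<Longrightarrow> p \<noteq> 0 \<Longrightarrow>
      \<bar>D p\<bar> \<le> C D * knorm p powr (- 3 - real j)" by metis
  define M where "M = (\<Sum>D\<in>horizontal_derivs j (lacunary s 3 g). \<bar>C D\<bar>)"
  have "\<bar>D p\<bar> \<le> M * knorm p powr (- 3 - real j)"
    if D: "D \<in> horizontal_derivs j (lacunary s 3 g)" "p \<noteq> 0" for D p
  proof -
    have "C D \<le> \<bar>C D\<bar>" by simp
    also have "\<dots> \<le> M" unfolding M_def using fin D(1) by (intro member_le_sum) auto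
    finally have "C D * knorm p powr (- 3 - real j) \<le> M * knorm p powr (- 3 - real j)"
      by (rule mult_right_mono) simp
    then show ?thesis using C[OF D] by (rule order_trans[rotated])
  qed
  then show "\<exists>C. \<forall>D\<in>horizontal_derivs j (lacunary s 3 g). \<forall>p. p \<noteq> 0 \<longrightarrow> \<bar>D p\<bar> \<le> C * knorm p powr (- 3 - real j)"
    by (intro exI[of _ M] ballI allI impI)
qed

end

section \<open>A Carleson estimate from the boundedness of singular integrals\<close>

subsection \<open>Square integrable functions\<close>

definition sq_integrable :: "'a measure \<Rightarrow> ('a \<Rightarrow> real) \<Rightarrow> bool" where
  "sq_integrable M f \<longleftrightarrow> f \<in> borel_measurable M \<and> integrable M (\<lambda>x. (f x)\<^sup>2)"

lemma sq_integrable_mult: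
  assumes "sq_integrable M f" "sq_integrable M g"
  shows "integrable M (\<lambda>x. f x * g x)"
proof (rule Bochner_Integration.integrable_bound)
  show "integrable M (\<lambda>x. (f x)\<^sup>2 + (g x)\<^sup>2)" using assms by (auto simp: sq_integrable_def)
  show "(\<lambda>x. f x * g x) \<in> borel_measurable M"
    using assms unfolding sq_integrable_def by (intro borel_measurable_times) auto
  have "\<bar>y * z\<bar> \<le> y\<^sup>2 + z\<^sup>2" for y z :: real
  proof -
    have "0 \<le> (\<bar>y\<bar> - \<bar>z\<bar>)\<^sup>2" by simp
    then have "2 * (\<bar>y\<bar> * \<bar>z\<bar>) \<le> y\<^sup>2 + z\<^sup>2" by (simp add: power2_diff)
    moreover have "0 \<le> \<bar>y\<bar> * \<bar>z\<bar>" by simp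
    ultimately show ?thesis unfolding abs_mult by linarith
  qed
  then show "AE x in M. norm (f x * g x) \<le> norm ((f x)\<^sup>2 + (g x)\<^sup>2)" by simp
qed

lemma sq_integrable_cmult: "sq_integrable M f \<Longrightarrow> sq_integrable M (\<lambda>x. c * f x)"
  by (auto simp: sq_integrable_def power_mult_distrib)

lemma sq_integrable_add:
  assumes "sq_integrable M f" "sq_integrable M g"
  shows "sq_integrable M (\<lambda>x. f x + g x)"
  unfolding sq_integrable_def power2_sum
  using assms sq_integrable_mult[OF assms]
  by (auto simp: sq_integrable_def mult.assoc intro!: Bochner_Integration.integrable_add)

text \<open>A greedy substitute for averaging over random signs: each new sign is chosen so that the
  cross term with the sum built so far is nonnegative.\<close>

lemma exists_signs:
  assumes "finite J" and "\<And>j. j \<in> J \<Longrightarrow> sq_integrable M (f j)"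
  shows "\<exists>s. (\<forall>j. \<bar>s j\<bar> \<le> 1) \<and> sq_integrable M (\<lambda>x. \<Sum>j\<in>J. s j * f j x) \<and>
    (\<Sum>j\<in>J. LINT x|M. (f j x)\<^sup>2) \<le> (LINT x|M. (\<Sum>j\<in>J. s j * f j x)\<^sup>2)"
  using assms
proof (induction J rule: finite_induct)
  case empty
  show ?case by (intro exI[of _ "\<lambda>_. 0"]) (auto simp: sq_integrable_def)
next
  case (insert k J)
  then obtain s where s: "\<And>j. \<bar>s j\<bar> \<le> (1 :: real)" "sq_integrable M (\<lambda>x. \<Sum>j\<in>J. s j * f j x)"
    "(\<Sum>j\<in>J. LINT x|M. (f j x)\<^sup>2) \<le> (LINT x|M. (\<Sum>j\<in>J. s j * f j x)\<^sup>2)" by auto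
  define h where "h x = (\<Sum>j\<in>J. s j * f j x)" for x
  have h: "sq_integrable M h" using s(2) by (simp add: h_def[abs_def])
  have k: "sq_integrable M (f k)" using insert.prems by auto
  define e where "e = (if 0 \<le> (LINT x|M. f k x * h x) then 1 else - 1 :: real)"
  define s' where "s' = s(k := e)"
  have sum: "(\<Sum>j\<in>insert k J. s' j * f j x) = e * f k x + h x" for x
    using insert.hyps by (auto simp: s'_def h_def intro!: sum.cong)
  have e: "e\<^sup>2 = 1" "0 \<le> e * (LINT x|M. f k x * h x)" by (auto simp: e_def)
  have int: "integrable M (\<lambda>x. (f k x)\<^sup>2)" "integrable M (\<lambda>x. (h x)\<^sup>2)" "integrable M (\<lambda>x. f k x * h x)"
    using h k sq_integrable_mult[OF k h] by (auto simp: sq_integrable_def)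
  have "(LINT x|M. (e * f k x + h x)\<^sup>2) = (LINT x|M. (f k x)\<^sup>2 + (h x)\<^sup>2 + 2 * e * (f k x * h x))"
    using e(1) by (simp add: power2_sum power_mult_distrib mult_ac)
  also have "\<dots> = (LINT x|M. (f k x)\<^sup>2) + (LINT x|M. (h x)\<^sup>2) + 2 * e * (LINT x|M. f k x * h x)"
    using int by simp
  finally have "(LINT x|M. (f k x)\<^sup>2) + (LINT x|M. (h x)\<^sup>2) \<le> (LINT x|M. (e * f k x + h x)\<^sup>2)"
    using e(2) by linarith
  moreover have "(\<Sum>j\<in>insert k J. LINT x|M. (f j x)\<^sup>2) \<le> (LINT x|M. (f k x)\<^sup>2) + (LINT x|M. (h x)\<^sup>2)"
    using s(3) insert.hyps by (simp add: h_def)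
  ultimately have "(\<Sum>j\<in>insert k J. LINT x|M. (f j x)\<^sup>2) \<le> (LINT x|M. (\<Sum>j\<in>insert k J. s' j * f j x)\<^sup>2)"
    unfolding sum by linarith
  moreover have "sq_integrable M (\<lambda>x. \<Sum>j\<in>insert k J. s' j * f j x)"
    unfolding sum by (intro sq_integrable_add sq_integrable_cmult h k)
  moreover have "\<bar>s' j\<bar> \<le> 1" for j using s(1) by (auto simp: s'_def e_def)
  ultimately show ?case by (intro exI[of _ s']) auto
qed

text \<open>If each sign sequence gives a bound of its own then the bound is uniform: otherwise violating windows
  could be chosen disjoint and glued into a single bad sequence.\<close>

lemma gliding_hump:
  fixes f :: "'i \<Rightarrow> int \<Rightarrow> 'a \<Rightarrow> real" and m :: "'i \<Rightarrow> real"
  assumes m: "\<And>i. i \<in> I \<Longrightarrow> 0 \<le> m i"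
    and sq: "\<And>i j. i \<in> I \<Longrightarrow> sq_integrable M (f i j)"
    and bd: "\<And>s. (\<And>j. \<bar>s j\<bar> \<le> 1) \<Longrightarrow>
      \<exists>C. \<forall>i\<in>I. \<forall>a b. (LINT x|M. (\<Sum>j=a..b. s j * f i j x)\<^sup>2) \<le> C * m i"
  shows "\<exists>C. \<forall>i\<in>I. \<forall>a b. (\<Sum>j=a..b. LINT x|M. (f i j x)\<^sup>2) \<le> C * m i"
proof (rule ccontr)
  assume contr: "\<not> ?thesis"
  define Q where "Q i J = (\<Sum>j\<in>J. LINT x|M. (f i j x)\<^sup>2)" for i J
  have term_nonneg: "0 \<le> (LINT x|M. (f i j x)\<^sup>2)" for i j by simp
  \<comment> \<open>Sequences supported at one index control each single scale, with a constant that
    may depend on the scale.\<close>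
  have "\<exists>C. \<forall>i\<in>I. (LINT x|M. (f i j x)\<^sup>2) \<le> C * m i" for j
  proof -
    have "\<bar>(if k = j then 1 else 0) :: real\<bar> \<le> 1" for k by simp
    from bd[of "\<lambda>k. if k = j then 1 else 0", OF this]
    obtain C where "\<forall>i\<in>I. \<forall>a b. (LINT x|M. (\<Sum>k=a..b. (if k = j then 1 else 0) * f i k x)\<^sup>2) \<le> C * m i"
      by blast
    then have "\<forall>i\<in>I. (LINT x|M. (\<Sum>k=j..j. (if k = j then 1 else 0) * f i k x)\<^sup>2) \<le> C * m i" by blast
    then show ?thesis by auto
  qed
  then obtain c where c: "\<And>i j. i \<in> I \<Longrightarrow> (LINT x|M. (f i j x)\<^sup>2) \<le> c j * m i" by metis
  have "\<exists>i\<in>I. \<exists>a b. (b < - int N \<or> int N < a) \<and> real N * m i < Q i {a..b}" for N :: nat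
  proof -
    \<comment> \<open>\<open>tot * m i\<close> bounds the part of the sum over
      \<open>{- N..N}\<close>. If a window carries more than \<open>(tot + 2 * N) * m i\<close>,
      then its part to the left or its part to the right of \<open>{- N..N}\<close> carries more
      than \<open>N * m i\<close>.\<close>
    define tot where "tot = (\<Sum>j=- int N..int N. c j)"
    obtain i a b where i: "i \<in> I" and Q: "(tot + 2 * real N) * m i < Q i {a..b}"
      using contr unfolding Q_def by (meson not_le)
    define L where "L = {a..min b (- int N - 1)}"
    define R where "R = {max a (int N + 1)..b}"
    have "Q i {a..b} \<le> Q i (L \<union> {- int N..int N} \<union> R)"
      unfolding Q_def by (rule sum_mono2) (auto simp: L_def R_def)
    also have "\<dots> \<le> Q i L + Q i {- int N..int N} + Q i R"
    proof -
      have "Q i (L \<union> {- int N..int N}) \<le> Q i L + Q i {- int N..int N}"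
        unfolding Q_def by (subst sum.union_disjoint) (auto simp: L_def)
      moreover have "Q i (L \<union> {- int N..int N} \<union> R) \<le> Q i (L \<union> {- int N..int N}) + Q i R"
        unfolding Q_def by (subst sum.union_disjoint) (auto simp: L_def R_def)
      ultimately show ?thesis by linarith
    qed
    also have "Q i {- int N..int N} \<le> tot * m i"
      unfolding Q_def tot_def sum_distrib_right by (intro sum_mono c i)
    finally have "real N * m i < Q i L \<or> real N * m i < Q i R"
      using Q by (auto simp: distrib_right)
    moreover have "min b (- int N - 1) < - int N" "int N < max a (int N + 1)" by auto
    ultimately show ?thesis unfolding L_def R_def using i by blast
  qed
  then obtain i a b where i: "\<And>N. i N \<in> I" and ab: "\<And>N. b N < - int N \<or> int N < a N"
    and Q: "\<And>N. real N * m (i N) < Q (i N) {a N..b N}" by metis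
  define W where "W N = {a N..b N}" for N
  have "\<exists>s. (\<forall>j. \<bar>s j\<bar> \<le> 1) \<and> Q (i N) (W N) \<le> (LINT x|M. (\<Sum>j\<in>W N. s j * f (i N) j x)\<^sup>2)" for N
    using exists_signs[of "W N" M "f (i N)"] sq[OF i] by (auto simp: Q_def W_def)
  then obtain s where s: "\<And>N j. \<bar>s N j\<bar> \<le> 1"
    "\<And>N. Q (i N) (W N) \<le> (LINT x|M. (\<Sum>j\<in>W N. s N j * f (i N) j x)\<^sup>2)" by metis
  \<comment> \<open>The window belonging to \<open>N\<close> lies outside \<open>{- N..N}\<close>,
    and \<open>nxt N\<close> exceeds its endpoints in absolute value. Along the iterates of
    \<open>nxt\<close> the windows are therefore disjoint.\<close>
  define nxt where "nxt N = Suc (N + nat \<bar>a N\<bar> + nat \<bar>b N\<bar>)" for N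
  define N where "N k = (nxt ^^ k) 0" for k
  have N_Suc: "N (Suc k) = nxt (N k)" for k by (simp add: N_def)
  have N_mono: "N k + (l - k) \<le> N l" if "k \<le> l" for k l
    using that
  proof (induction l rule: dec_induct)
    case (step l)
    then show ?case by (simp add: N_Suc nxt_def)
  qed simp
  have window: "int (N k) < \<bar>j\<bar> \<and> \<bar>j\<bar> < int (N (Suc k))" if "j \<in> W (N k)" for j k
    using that ab[of "N k"] by (auto simp: W_def N_Suc nxt_def)
  have unique: "k = l" if "j \<in> W (N k)" "j \<in> W (N l)" for j k l
  proof (rule ccontr)
    assume "k \<noteq> l"
    then have "N (Suc k) \<le> N l \<or> N (Suc l) \<le> N k"
      using N_mono[of "Suc k" l] N_mono[of "Suc l" k] by (cases "k < l") auto
    then show False using window[OF that(1)] window[OF that(2)] by linarith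
  qed
  define t where "t j = (if \<exists>k. j \<in> W (N k) then s (N (SOME k. j \<in> W (N k))) j else 0)" for j
  have t: "t j = s (N k) j" if "j \<in> W (N k)" for j k
  proof -
    have "(SOME k. j \<in> W (N k)) = k" using that unique by (intro some_equality) auto
    then show ?thesis using that by (auto simp: t_def)
  qed
  have "\<bar>t j\<bar> \<le> 1" for j using s(1) by (auto simp: t_def)
  then obtain C where C: "\<And>i a b. i \<in> I \<Longrightarrow> (LINT x|M. (\<Sum>j=a..b. t j * f i j x)\<^sup>2) \<le> C * m i"
    using bd[of t] by blast
  obtain k :: nat where k: "C \<le> real k" using real_arch_simple by blast
  have "real (N k) * m (i (N k)) < Q (i (N k)) (W (N k))" using Q by (simp add: W_def)
  also have "\<dots> \<le> (LINT x|M. (\<Sum>j\<in>W (N k). s (N k) j * f (i (N k)) j x)\<^sup>2)" by (rule s(2))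
  also have "\<dots> = (LINT x|M. (\<Sum>j\<in>W (N k). t j * f (i (N k)) j x)\<^sup>2)" by (simp add: t)
  also have "\<dots> \<le> C * m (i (N k))" unfolding W_def by (rule C[OF i])
  also have "\<dots> \<le> real (N k) * m (i (N k))"
    using k N_mono[of 0 k] m[OF i] by (intro mult_right_mono) auto
  finally show False by simp
qed

subsection \<open>Truncated singular integrals of lacunary kernels\<close>

lemma sets_hausdorff3_on [simp, measurable_cong]: "sets (hausdorff3_on E) = sets borel"
  by (simp add: hausdorff3_on_def)

lemma space_hausdorff3_on [simp]: "space (hausdorff3_on E) = UNIV"
  by (simp add: hausdorff3_on_def)

lemma borel_measurable_knorm_translate:
  "sets M = sets borel \<Longrightarrow> (\<lambda>q. knorm (- q + p)) \<in> borel_measurable M"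
proof -
  have "(\<lambda>q. knorm (- q + p)) \<in> borel_measurable borel" unfolding knorm_def by simp measurable
  then show "sets M = sets borel \<Longrightarrow> (\<lambda>q. knorm (- q + p)) \<in> borel_measurable M"
    by (simp cong: measurable_cong_sets)
qed

lemma borel_measurable_rescale_translate:
  assumes "elem_fun g" "sets M = sets borel"
  shows "(\<lambda>q. rescale n g c (coords (- q + p))) \<in> borel_measurable M"
  unfolding coords_def
  by (intro borel_measurable_left_translate borel_measurable_continuous_onI elem_fun_continuous
      elem_fun_rescale assms)

locale sio_setting = annulus +
  fixes E :: "heis set" and g :: "real3 \<Rightarrow> real"
  assumes closed: "closed E" and elem: "elem_fun g" and supp: "supported g"
    and anti: "\<And>x y t. g (- x, - y, t) = - g (x, y, t)"
    and bounded: "\<And>K. admissible_kernel K \<Longrightarrow> sio_bounded_L2 K (hausdorff3_on E)"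
begin

abbreviation mu :: "heis measure" where "mu \<equiv> hausdorff3_on E"

abbreviation psi :: "int \<Rightarrow> heis \<Rightarrow> real" where "psi j u \<equiv> rescale 3 g (2 powi j) (coords u)"

text \<open>The ball is encoded as a pair of centre and radius in order to serve as the index
  \<open>'i\<close> of \<open>gliding_hump\<close>: the final constant has to be uniform over
  balls.\<close>

definition conv :: "heis \<times> real \<Rightarrow> int \<Rightarrow> heis \<Rightarrow> real" where
  "conv B j p = (LINT q|mu. psi j (- q + p) * indicator (ball (fst B) (snd B)) q)"

definition finite_balls :: "(heis \<times> real) set" where
  "finite_balls = {B. emeasure mu (ball (fst B) (snd B)) < \<infinity>}"

lemma psi_nonzero:
  assumes "psi j u \<noteq> 0"
  shows "\<rho> * 2 powi j < knorm u" "knorm u < 2 * \<rho> * 2 powi j"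
proof -
  have 1: "a * 2 powi j \<le> knorm u" "knorm u \<le> b * 2 powi j"
    using rescale_support[OF supp _ assms] by auto
  have "\<rho> * 2 powi j < a * 2 powi j" using a by (intro mult_strict_right_mono) auto
  moreover have "b * 2 powi j < 2 * \<rho> * 2 powi j" using b by (intro mult_strict_right_mono) auto
  ultimately show "\<rho> * 2 powi j < knorm u" "knorm u < 2 * \<rho> * 2 powi j" using 1 by linarith+
qed

lemma psi_bounded: "\<exists>B. \<forall>u. \<bar>psi j u\<bar> \<le> B"
proof -
  obtain B where B: "\<And>x. \<bar>g x\<bar> \<le> B" using supported_bounded[OF elem supp] by blast
  have "\<bar>g x\<bar> / (2 powi j) ^ 3 \<le> B / (2 powi j) ^ 3" for x
    by (intro divide_right_mono B) simp
  then have "\<bar>psi j u\<bar> \<le> B / (2 powi j) ^ 3" for u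
    by (simp add: rescale_def)
  then show ?thesis by blast
qed

text \<open>The cutoff radius lies in a gap between two supports, so every summand is either kept or
  removed as a whole.\<close>

lemma lacunary_cutoff:
  "(if \<rho> * 2 powi i < knorm u then lacunary s 3 g u else 0) =
   (if u \<noteq> 0 \<and> i \<le> dyad u then s (dyad u) * psi (dyad u) u else 0)"
proof (cases "u = 0 \<or> psi (dyad u) u = 0")
  case True
  then show ?thesis by (auto simp: lacunary_def)
next
  case False
  have 1: "\<rho> * 2 powi dyad u < knorm u" "knorm u < 2 * \<rho> * 2 powi dyad u" using psi_nonzero False by auto
  have "\<rho> * 2 powi i < knorm u \<longleftrightarrow> i \<le> dyad u"
  proof
    assume *: "\<rho> * 2 powi i < knorm u"
    show "i \<le> dyad u"
    proof (rule ccontr)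
      assume "\<not> i \<le> dyad u"
      then have "2 * 2 powi dyad u \<le> (2 powi i :: real)" by (intro powi_2_less) simp
      then have "\<rho> * (2 * 2 powi dyad u) \<le> \<rho> * 2 powi i" using rho by (intro mult_left_mono) auto
      then show False using * 1(2) by linarith
    qed
  next
    assume "i \<le> dyad u"
    then have "(2 powi i :: real) \<le> 2 powi dyad u" by (intro power_int_increasing) auto
    then have "\<rho> * 2 powi i \<le> \<rho> * 2 powi dyad u" using rho by (intro mult_left_mono) auto
    then show "\<rho> * 2 powi i < knorm u" using 1(1) by linarith
  qed
  then show ?thesis using False by (simp add: lacunary_def)
qed

text \<open>Subtracting two truncations of the same kernel isolates a finite window, so one kernel
  with one constant serves all windows of a sign sequence. The case \<open>l = h + 1\<close> is the
  empty window.\<close>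

lemma lacunary_window:
  assumes "l \<le> h + 1"
  shows "(if \<rho> * 2 powi l < knorm u then lacunary s 3 g u else 0)
     - (if \<rho> * 2 powi (h + 1) < knorm u then lacunary s 3 g u else 0) = (\<Sum>j=l..h. s j * psi j u)"
proof (cases "u = 0")
  case True
  have "psi j 0 = 0" for j
  proof (rule ccontr)
    assume "psi j 0 \<noteq> 0"
    from psi_nonzero(1)[OF this] have "\<rho> * 2 powi j < 0" using knorm_eq_0_iff[of 0] by simp
    moreover have "0 < \<rho> * 2 powi j" using rho by simp
    ultimately show False by linarith
  qed
  then show ?thesis using True by (simp add: lacunary_def)
next
  case False
  define d where "d = dyad u"
  define X where "X = s d * psi d u"
  have "s j * psi j u = (if j = d then X else 0)" for j
    using rescale_off_dyad[OF supp False, of j 3] by (simp add: X_def d_def)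
  then have "(\<Sum>j=l..h. s j * psi j u) = (\<Sum>j=l..h. if j = d then X else 0)" by (simp only:)
  also have "\<dots> = (if d \<in> {l..h} then X else 0)" by simp
  finally have rhs: "(\<Sum>j=l..h. s j * psi j u) = (if d \<in> {l..h} then X else 0)" .
  show ?thesis
    unfolding lacunary_cutoff rhs d_def[symmetric] X_def[symmetric] using False assms
    by (cases "l \<le> d"; cases "h + 1 \<le> d") simp_all
qed

lemma truncated_sio_window:
  assumes B: "B \<in> finite_balls" and s: "\<And>j. \<bar>s j\<bar> \<le> 1" and lh: "l \<le> h + 1"
  defines "f \<equiv> \<lambda>q. complex_of_real (indicator (ball (fst B) (snd B)) q)"
  shows "truncated_sio (lacunary s 3 g) (\<rho> * 2 powi l) mu f p
      - truncated_sio (lacunary s 3 g) (\<rho> * 2 powi (h + 1)) mu f p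
      = complex_of_real (\<Sum>j=l..h. s j * conv B j p)"
proof -
  define A where "A = ball (fst B) (snd B)"
  have A: "A \<in> sets mu" using borel_open[OF open_ball, of "fst B" "snd B"] by (simp only: A_def sets_hausdorff3_on)
  have intA: "integrable mu (indicator A :: heis \<Rightarrow> real)"
    using B A by (simp add: finite_balls_def A_def)
  define K where "K = lacunary s 3 g"
  define H where "H i q = (if \<rho> * 2 powi i < knorm (- q + p) then K (- q + p) else 0) * indicator A q" for i q
  obtain C where C: "\<And>u. u \<noteq> 0 \<Longrightarrow> \<bar>K u\<bar> \<le> C * knorm u powr (- real 3)"
    using lacunary_bound[of g s 3, OF elem supp s] unfolding K_def by (elim exE) blast
  have H_meas: "H i \<in> borel_measurable mu" for i
  proof -
    have [measurable]: "(\<lambda>q. knorm (- q + p)) \<in> borel_measurable mu"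
      by (rule borel_measurable_knorm_translate) simp
    have [measurable]: "(\<lambda>q. psi j (- q + p)) \<in> borel_measurable mu" for j
      by (rule borel_measurable_rescale_translate[OF elem]) simp
    have [measurable]: "(\<lambda>q. dyad (- q + p)) \<in> measurable mu (count_space UNIV)"
      unfolding dyad_def by measurable
    \<comment> \<open>The scale is a measurable integer-valued function of \<open>q\<close>, so the
      choice of the summand is a countable case distinction.\<close>
    have "(\<lambda>q. (\<lambda>j q. s j * psi j (- q + p)) (dyad (- q + p)) q) \<in> borel_measurable mu"
      by (rule measurable_compose_countable) measurable
    then have [measurable]: "(\<lambda>q. s (dyad (- q + p)) * psi (dyad (- q + p)) (- q + p)) \<in> borel_measurable mu"
      by simp
    have "(\<lambda>q. (if knorm (- q + p) \<noteq> 0 \<and> i \<le> dyad (- q + p)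
        then s (dyad (- q + p)) * psi (dyad (- q + p)) (- q + p) else 0) * indicator A q) \<in> borel_measurable mu"
      using A by measurable
    then show ?thesis unfolding H_def K_def lacunary_cutoff knorm_eq_0_iff .
  qed
  have H_int: "integrable mu (H i)" for i
  proof (rule Bochner_Integration.integrable_bound)
    \<comment> \<open>The bound on the kernel decreases in the gauge, so its value at the cutoff
      radius bounds the truncated kernel everywhere.\<close>
    define D where "D = \<bar>C\<bar> * (\<rho> * 2 powi i) powr (- real 3)"
    show "integrable mu (\<lambda>q. D * indicator A q)" using intA by simp
    have "norm (H i q) \<le> norm (D * indicator A q)" for q
    proof (cases "\<rho> * 2 powi i < knorm (- q + p)")
      case True
      have pos: "0 < \<rho> * 2 powi i" using rho by simp
      then have "- q + p \<noteq> 0" using True knorm_eq_0_iff[of "- q + p"] by auto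
      then have "\<bar>K (- q + p)\<bar> \<le> C * knorm (- q + p) powr (- real 3)" by (rule C)
      also have "\<dots> \<le> \<bar>C\<bar> * (\<rho> * 2 powi i) powr (- real 3)"
        using True pos by (intro mult_mono powr_mono2') auto
      finally have "\<bar>K (- q + p)\<bar> \<le> D" by (simp add: D_def)
      then show ?thesis by (simp add: H_def indicator_def)
    qed (simp add: H_def)
    then show "AE q in mu. norm (H i q) \<le> norm (D * indicator A q)" by simp
  qed (rule H_meas)
  have T: "truncated_sio K (\<rho> * 2 powi i) mu f p = complex_of_real (LINT q|mu. H i q)" for i
  proof -
    have "truncated_sio K (\<rho> * 2 powi i) mu f p = (LINT q|mu. complex_of_real (H i q))"
      unfolding truncated_sio_def set_lebesgue_integral_def f_def H_def A_def
      by (intro Bochner_Integration.integral_cong) (auto simp: indicator_def scaleR_conv_of_real)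
    then show ?thesis by simp
  qed
  have psi_int: "integrable mu (\<lambda>q. psi j (- q + p) * indicator A q)" for j
  proof -
    obtain D where D: "\<And>u. \<bar>psi j u\<bar> \<le> D" using psi_bounded by blast
    show ?thesis
    proof (rule Bochner_Integration.integrable_bound)
    show "integrable mu (\<lambda>q. D * indicator A q)" using intA by simp
    show "(\<lambda>q. psi j (- q + p) * indicator A q) \<in> borel_measurable mu"
      using A borel_measurable_rescale_translate[OF elem, of mu 3 "2 powi j" p]
      by (intro borel_measurable_times) auto
    show "AE q in mu. norm (psi j (- q + p) * indicator A q) \<le> norm (D * indicator A q)"
    proof (rule AE_I2)
      fix q
      have "\<bar>psi j (- q + p)\<bar> \<le> \<bar>D\<bar>" using D[of "- q + p"] by linarith
      then show "norm (psi j (- q + p) * indicator A q) \<le> norm (D * indicator A q)"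
        by (auto simp: indicator_def)
    qed
    qed
  qed
  have "truncated_sio K (\<rho> * 2 powi l) mu f p - truncated_sio K (\<rho> * 2 powi (h + 1)) mu f p
      = complex_of_real (LINT q|mu. H l q - H (h + 1) q)"
    unfolding T using H_int by simp
  also have "(LINT q|mu. H l q - H (h + 1) q)
      = (LINT q|mu. (\<Sum>j=l..h. s j * (psi j (- q + p) * indicator A q)))"
  proof (intro Bochner_Integration.integral_cong refl)
    fix q
    have "H l q - H (h + 1) q = (\<Sum>j=l..h. s j * psi j (- q + p)) * indicator A q"
      unfolding H_def K_def left_diff_distrib[symmetric] lacunary_window[OF lh] ..
    then show "H l q - H (h + 1) q = (\<Sum>j=l..h. s j * (psi j (- q + p) * indicator A q))"
      by (simp add: sum_distrib_right mult.assoc)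
  qed
  also have "\<dots> = (\<Sum>j=l..h. s j * conv B j p)"
    using psi_int unfolding conv_def A_def[symmetric] by (subst Bochner_Integration.integral_sum) auto
  finally show ?thesis unfolding K_def .
qed

text \<open>The constant is that of the kernel built from \<open>s\<close>, hence depends on
  \<open>s\<close> but neither on the ball nor on the window. Removing the dependence on
  \<open>s\<close> is the task of \<open>gliding_hump\<close>.\<close>

lemma window_bound:
  assumes s: "\<And>j. \<bar>s j\<bar> \<le> 1"
  shows "\<exists>C. \<forall>B\<in>finite_balls. \<forall>l h. sq_integrable mu (\<lambda>p. \<Sum>j=l..h. s j * conv B j p) \<and>
    (LINT p|mu. (\<Sum>j=l..h. s j * conv B j p)\<^sup>2) \<le> C * measure mu (ball (fst B) (snd B))"
proof -
  define K where "K = lacunary s 3 g"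
  have "sio_bounded_L2 K mu"
    unfolding K_def by (rule bounded, rule admissible_lacunary[OF elem supp anti s])
  then obtain C where C: "\<And>\<epsilon> f. 0 < \<epsilon> \<Longrightarrow> integrable mu f \<Longrightarrow> in_L2 mu f \<Longrightarrow>
      in_L2 mu (truncated_sio K \<epsilon> mu f) \<and> L2_norm mu (truncated_sio K \<epsilon> mu f) \<le> C * L2_norm mu f"
    unfolding sio_bounded_L2_def by blast
  \<comment> \<open>Two truncations contribute \<open>C\<^sup>2\<close> each, and squaring their
    difference costs another factor 2.\<close>
  have "sq_integrable mu (\<lambda>p. \<Sum>j=l..h. s j * conv B j p) \<and>
    (LINT p|mu. (\<Sum>j=l..h. s j * conv B j p)\<^sup>2) \<le> 4 * C\<^sup>2 * measure mu (ball (fst B) (snd B))"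
    if B: "B \<in> finite_balls" for B l h
  proof (cases "l \<le> h + 1")
    case False
    then show ?thesis by (simp add: sq_integrable_def)
  next
    case True
    define A where "A = ball (fst B) (snd B)"
    define f where "f q = complex_of_real (indicator A q)" for q
    have A: "A \<in> sets mu" "emeasure mu A < \<infinity>" using B by (auto simp: A_def finite_balls_def)
    have intA: "integrable mu (indicator A :: heis \<Rightarrow> real)" using A by simp
    have sq: "(cmod (f q))\<^sup>2 = indicator A q" for q by (simp add: f_def indicator_def)
    have f: "integrable mu f" "in_L2 mu f"
      using intA A(1) unfolding in_L2_def sq by (auto simp: f_def[abs_def])
    have norm_f: "(L2_norm mu f)\<^sup>2 = measure mu A"
      using A by (simp add: L2_norm_def sq)
    define T where "T i p = truncated_sio K (\<rho> * 2 powi i) mu f p" for i p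
    have pos: "0 < \<rho> * 2 powi i" for i using rho by simp
    have T: "T i \<in> borel_measurable mu" "integrable mu (\<lambda>p. (cmod (T i p))\<^sup>2)"
      "(LINT p|mu. (cmod (T i p))\<^sup>2) \<le> C\<^sup>2 * measure mu A" for i
    proof -
      have 1: "in_L2 mu (T i)" "L2_norm mu (T i) \<le> C * L2_norm mu f"
        using C[OF pos f] unfolding T_def[abs_def] by auto
      then show "T i \<in> borel_measurable mu" "integrable mu (\<lambda>p. (cmod (T i p))\<^sup>2)" by (auto simp: in_L2_def)
      have "(LINT p|mu. (cmod (T i p))\<^sup>2) = (L2_norm mu (T i))\<^sup>2" by (simp add: L2_norm_def)
      also have "\<dots> \<le> (C * L2_norm mu f)\<^sup>2" using 1(2) by (intro power_mono) (auto simp: L2_norm_def)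
      finally show "(LINT p|mu. (cmod (T i p))\<^sup>2) \<le> C\<^sup>2 * measure mu A"
        by (simp add: power_mult_distrib norm_f)
    qed
    define W where "W p = (\<Sum>j=l..h. s j * conv B j p)" for p
    have W: "complex_of_real (W p) = T l p - T (h + 1) p" for p
      unfolding T_def W_def K_def f_def A_def using truncated_sio_window[OF B s True] by simp
    have "W = (\<lambda>p. Re (T l p - T (h + 1) p))" using W by (metis Re_complex_of_real)
    then have meas: "W \<in> borel_measurable mu" using T(1) by simp
    have bound: "(W p)\<^sup>2 \<le> 2 * (cmod (T l p))\<^sup>2 + 2 * (cmod (T (h + 1) p))\<^sup>2" for p
    proof -
      have "\<bar>W p\<bar> = cmod (T l p - T (h + 1) p)" using W[of p] by (metis norm_of_real)
      also have "\<dots> \<le> cmod (T l p) + cmod (T (h + 1) p)" by (rule norm_triangle_ineq4)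
      finally have "\<bar>W p\<bar>\<^sup>2 \<le> (cmod (T l p) + cmod (T (h + 1) p))\<^sup>2" by (intro power_mono) auto
      also have "\<dots> \<le> 2 * (cmod (T l p))\<^sup>2 + 2 * (cmod (T (h + 1) p))\<^sup>2"
        using sum_squares_bound[of "cmod (T l p)" "cmod (T (h + 1) p)"] by (simp add: power2_sum)
      finally show ?thesis by simp
    qed
    have int: "integrable mu (\<lambda>p. (W p)\<^sup>2)"
    proof (rule Bochner_Integration.integrable_bound)
      show "integrable mu (\<lambda>p. 2 * (cmod (T l p))\<^sup>2 + 2 * (cmod (T (h + 1) p))\<^sup>2)" using T(2) by simp
      show "(\<lambda>p. (W p)\<^sup>2) \<in> borel_measurable mu" using meas by simp
      show "AE p in mu. norm ((W p)\<^sup>2) \<le> norm (2 * (cmod (T l p))\<^sup>2 + 2 * (cmod (T (h + 1) p))\<^sup>2)"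
        using bound by simp
    qed
    have "(LINT p|mu. (W p)\<^sup>2) \<le> (LINT p|mu. 2 * (cmod (T l p))\<^sup>2 + 2 * (cmod (T (h + 1) p))\<^sup>2)"
      using int T(2) bound by (intro integral_mono) auto
    also have "\<dots> = 2 * (LINT p|mu. (cmod (T l p))\<^sup>2) + 2 * (LINT p|mu. (cmod (T (h + 1) p))\<^sup>2)"
      using T(2) by simp
    also have "\<dots> \<le> 4 * C\<^sup>2 * measure mu A" using T(3)[of l] T(3)[of "h + 1"] by linarith
    finally show ?thesis using meas int unfolding sq_integrable_def W_def[abs_def] A_def by simp
  qed
  then show ?thesis by blast
qed

lemma sq_integrable_conv:
  assumes "B \<in> finite_balls"
  shows "sq_integrable mu (conv B j)"
proof -
  have "\<bar>(\<lambda>_. 1) k :: real\<bar> \<le> 1" for k :: int by simp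
  from window_bound[of "\<lambda>_. 1", OF this] assms
  have "sq_integrable mu (\<lambda>p. \<Sum>k=j..j. 1 * conv B k p)" by blast
  then show ?thesis by simp
qed

lemma carleson_estimate:
  "\<exists>C\<ge>0. \<forall>B\<in>finite_balls. \<forall>l h. (\<Sum>j=l..h. LINT p|mu. (conv B j p)\<^sup>2) \<le> C * measure mu (ball (fst B) (snd B))"
proof -
  have "\<exists>C. \<forall>B\<in>finite_balls. \<forall>l h. (\<Sum>j=l..h. LINT p|mu. (conv B j p)\<^sup>2) \<le> C * measure mu (ball (fst B) (snd B))"
  proof (rule gliding_hump[where f = conv and I = finite_balls and M = mu
        and m = "\<lambda>B. measure mu (ball (fst B) (snd B))"])
    show "\<exists>C. \<forall>B\<in>finite_balls. \<forall>l h.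
      (LINT p|mu. (\<Sum>j=l..h. s j * conv B j p)\<^sup>2) \<le> C * measure mu (ball (fst B) (snd B))"
      if sb: "\<And>j. \<bar>s j\<bar> \<le> 1" for s
    proof -
      obtain C where C: "\<forall>B\<in>finite_balls. \<forall>l h. sq_integrable mu (\<lambda>p. \<Sum>j=l..h. s j * conv B j p) \<and>
          (LINT p|mu. (\<Sum>j=l..h. s j * conv B j p)\<^sup>2) \<le> C * measure mu (ball (fst B) (snd B))"
        using window_bound[of s, OF sb] by (elim exE)
      show ?thesis by (rule exI[of _ C]) (use C in blast)
    qed
  qed (simp_all add: sq_integrable_conv)
  then obtain C where C: "\<forall>B\<in>finite_balls. \<forall>l h.
      (\<Sum>j=l..h. LINT p|mu. (conv B j p)\<^sup>2) \<le> C * measure mu (ball (fst B) (snd B))" by blast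
  have D: "C * measure mu A \<le> max C 0 * measure mu A" for A by (intro mult_right_mono) auto
  show ?thesis
  proof (intro exI[of _ "max C 0"] conjI ballI allI)
    fix B l h assume "B \<in> finite_balls"
    then show "(\<Sum>j=l..h. LINT p|mu. (conv B j p)\<^sup>2) \<le> max C 0 * measure mu (ball (fst B) (snd B))"
      using C D order_trans by blast
  qed simp
qed

end

section \<open>Antisymmetric bumps detect asymmetry\<close>

lemma norm_real3_power2: "(norm (x :: real3))\<^sup>2 = (fst x)\<^sup>2 + (fst (snd x))\<^sup>2 + (snd (snd x))\<^sup>2"
  by (cases x) (simp add: norm_Pair)

lemma norm_real3_le: "norm ((x, y, t) :: real3) \<le> \<bar>x\<bar> + \<bar>y\<bar> + \<bar>t\<bar>"
  using norm_Pair_le[of x "(y, t)"] norm_Pair_le[of y t] by simp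

lemma abs_le_norm_real3:
  "\<bar>fst x\<bar> \<le> norm (x :: real3)" "\<bar>fst (snd x)\<bar> \<le> norm x" "\<bar>snd (snd x)\<bar> \<le> norm x"
proof -
  have le: "\<bar>z\<bar> \<le> norm x" if "z\<^sup>2 \<le> (norm x)\<^sup>2" for z
    using abs_le_square_iff[of z "norm x"] that by simp
  show "\<bar>fst x\<bar> \<le> norm (x :: real3)" "\<bar>fst (snd x)\<bar> \<le> norm x" "\<bar>snd (snd x)\<bar> \<le> norm x"
    by (rule le, simp add: norm_real3_power2)+
qed

text \<open>Bumps are localised in coordinates, asymmetry in the gauge; this converts the first into
  the second. The difference is \<open>p - q\<close> and not \<open>- q + p\<close> because the
  arguments \<open>- v + u\<close> and \<open>- w + u\<close> of a kernel share the right factor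
  \<open>u\<close>, which cancels in it.\<close>

lemma knorm_diff_le:
  assumes p: "knorm p \<le> N" and s: "norm (coords q - coords p) \<le> s"
  shows "knorm (p - q) \<le> 2 * s + 2 * sqrt (s * (1 + N))"
proof -
  have d: "\<bar>hx q - hx p\<bar> \<le> s" "\<bar>hy q - hy p\<bar> \<le> s" "\<bar>ht q - ht p\<bar> \<le> s"
    using abs_le_norm_real3[of "coords q - coords p"] s by (auto simp: coords_def)
  have s0: "0 \<le> s" using d(1) by linarith
  have N0: "0 \<le> N" using p knorm_nonneg[of p] by linarith
  have "sqrt ((hx (p - q))\<^sup>2 + (hy (p - q))\<^sup>2) \<le> \<bar>hx (p - q)\<bar> + \<bar>hy (p - q)\<bar>"
    by (rule sqrt_sum_squares_le_sum_abs)
  also have "\<dots> \<le> 2 * s" using d by simp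
  finally have 1: "sqrt ((hx (p - q))\<^sup>2 + (hy (p - q))\<^sup>2) \<le> 2 * s" .
  have "hx p * hy q - hx q * hy p = hx p * (hy q - hy p) - (hx q - hx p) * hy p"
    by (simp add: algebra_simps)
  also have "\<bar>\<dots>\<bar> \<le> \<bar>hx p\<bar> * \<bar>hy q - hy p\<bar> + \<bar>hx q - hx p\<bar> * \<bar>hy p\<bar>"
    unfolding abs_mult[symmetric] by (rule abs_triangle_ineq4)
  also have "\<dots> \<le> N * s + s * N"
    using d abs_hx_le_knorm[of p] abs_hy_le_knorm[of p] p s0 N0 by (intro add_mono mult_mono) auto
  also have "\<dots> = 2 * (s * N)" by (simp add: mult.commute)
  finally have 2: "\<bar>hx p * hy q - hx q * hy p\<bar> \<le> 2 * (s * N)" .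
  have "\<bar>ht (p - q)\<bar> = \<bar>(ht p - ht q) - (hx p * hy q - hx q * hy p) / 2\<bar>" by simp
  also have "\<dots> \<le> \<bar>ht p - ht q\<bar> + \<bar>(hx p * hy q - hx q * hy p) / 2\<bar>" by (rule abs_triangle_ineq4)
  also have "\<dots> \<le> s + s * N" using d(3) 2 abs_minus_commute[of "ht p" "ht q"] unfolding abs_divide by simp
  also have "\<dots> = s * (1 + N)" by (simp add: distrib_left)
  finally have "sqrt \<bar>ht (p - q)\<bar> \<le> sqrt (s * (1 + N))" by (rule real_sqrt_le_mono)
  then show ?thesis using knorm_le[of "p - q"] 1 by linarith
qed

text \<open>The factor \<open>h\<close> stands on the left because replacing \<open>v\<close> by
  \<open>v + h\<close> turns the kernel argument \<open>- v + u\<close> into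
  \<open>- h + (- v + u)\<close>.\<close>

lemma norm_coords_translate:
  assumes p: "knorm p \<le> N" and h: "knorm h \<le> \<kappa>" "\<kappa> \<le> 1"
  shows "norm (coords (- h + p) - coords p) \<le> \<kappa> * (3 + N)"
proof -
  have N0: "0 \<le> N" and k0: "0 \<le> \<kappa>" using p h knorm_nonneg order_trans by blast+
  have "\<bar>hx h * hy p - hx p * hy h\<bar> \<le> \<bar>hx h\<bar> * \<bar>hy p\<bar> + \<bar>hx p\<bar> * \<bar>hy h\<bar>"
    unfolding abs_mult[symmetric] by (rule abs_triangle_ineq4)
  also have "\<dots> \<le> \<kappa> * N + N * \<kappa>"
    using abs_hx_le_knorm[of p] abs_hy_le_knorm[of p] abs_hx_le_knorm[of h] abs_hy_le_knorm[of h] p h N0 k0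
    by (intro add_mono mult_mono) auto
  also have "\<dots> = 2 * (\<kappa> * N)" by (simp add: mult.commute)
  finally have 1: "\<bar>hx h * hy p - hx p * hy h\<bar> \<le> 2 * (\<kappa> * N)" .
  have "(knorm h)\<^sup>2 \<le> \<kappa> * \<kappa>" unfolding power2_eq_square using h k0 by (intro mult_mono) auto
  also have "\<dots> \<le> \<kappa> * 1" using h k0 by (intro mult_left_mono) auto
  finally have 2: "\<bar>ht h\<bar> \<le> \<kappa>" using abs_ht_le_knorm[of h] by linarith
  have eq: "coords (- h + p) - coords p = (- hx h, - hy h, - ht h - (hx h * hy p - hx p * hy h) / 2)"
    by (simp add: coords_def field_simps)
  have 3: "norm (coords (- h + p) - coords p)
      \<le> \<bar>hx h\<bar> + \<bar>hy h\<bar> + \<bar>- ht h - (hx h * hy p - hx p * hy h) / 2\<bar>"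
    unfolding eq using norm_real3_le[of "- hx h" "- hy h"] by simp
  have 4: "\<bar>- ht h - (hx h * hy p - hx p * hy h) / 2\<bar> \<le> \<bar>ht h\<bar> + \<bar>hx h * hy p - hx p * hy h\<bar> / 2"
    using abs_triangle_ineq4[of "- ht h" "(hx h * hy p - hx p * hy h) / 2"] by simp
  have "norm (coords (- h + p) - coords p) \<le> 3 * \<kappa> + \<kappa> * N"
    using 1 2 3 4 abs_hx_le_knorm[of h] abs_hy_le_knorm[of h] h(1) by linarith
  then show ?thesis by (simp add: distrib_left mult.commute)
qed

text \<open>Euclidean balls are used because the squared norm is a polynomial in the coordinates,
  which keeps the bump elementary.\<close>

definition bump :: "real \<Rightarrow> real3 \<Rightarrow> real3 \<Rightarrow> real" where
  "bump s c x = flat 0 (4 * s\<^sup>2 - (norm (x - c))\<^sup>2)"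

lemma elem_fun_bump: "elem_fun (bump s c)"
proof -
  have eq: "bump s c = (\<lambda>x. flat 0 (4 * s\<^sup>2 - ((fst x - fst c) * (fst x - fst c) +
      (fst (snd x) - fst (snd c)) * (fst (snd x) - fst (snd c)) +
      (snd (snd x) - snd (snd c)) * (snd (snd x) - snd (snd c)))))"
    unfolding bump_def norm_real3_power2 by (rule ext) (simp add: power2_eq_square)
  show ?thesis
    unfolding eq by (intro elem_fun.flat elem_fun_diff elem_fun.add elem_fun.mult elem_fun.const elem_fun_coord)
qed

lemma bump_nonneg: "0 \<le> bump s c x"
  by (simp add: bump_def flat_nonneg)

lemma bump_nonzero:
  assumes "bump s c x \<noteq> 0" "0 < s"
  shows "norm (x - c) < 2 * s"
proof (rule ccontr)
  assume "\<not> norm (x - c) < 2 * s"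
  then have "(2 * s)\<^sup>2 \<le> (norm (x - c))\<^sup>2" using assms(2) by (intro power_mono) auto
  then show False using assms(1) by (simp add: bump_def power_mult_distrib)
qed

lemma bump_ge:
  assumes "norm (x - c) \<le> 3 / 2 * s"
  shows "flat 0 (s\<^sup>2) \<le> bump s c x"
  unfolding bump_def
proof (rule flat_0_mono)
  have "(norm (x - c))\<^sup>2 \<le> (3 / 2 * s)\<^sup>2" using assms by (intro power_mono) auto
  moreover have "(3 / 2 * s)\<^sup>2 = 9 / 4 * s\<^sup>2" by (simp add: power_mult_distrib power2_eq_square)
  moreover have "0 \<le> s\<^sup>2" by simp
  ultimately show "s\<^sup>2 \<le> 4 * s\<^sup>2 - (norm (x - c))\<^sup>2" by linarith
qed

text \<open>Here \<open>n\<close> is the gauge of the centre of the bump.\<close>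

definition annular_bump :: "(real3 \<Rightarrow> real) \<Rightarrow> real \<Rightarrow> bool" where
  "annular_bump \<phi> n \<longleftrightarrow> 0 < n \<and> elem_fun \<phi> \<and> (\<forall>x. 0 \<le> \<phi> x) \<and>
     (\<forall>x. \<phi> x \<noteq> 0 \<longrightarrow> 3 / 4 * n \<le> knorm (of_coords x) \<and> knorm (of_coords x) \<le> 5 / 4 * n)"

text \<open>The coordinates of all admissible \<open>p\<close> form a compact shell, which finitely
  many Euclidean balls of radius \<open>s\<close> cover; the bump at a centre serves every point of
  its ball, with the same \<open>\<kappa>\<close> and \<open>m\<close>.\<close>

lemma bump_family:
  assumes N: "1 \<le> N" and \<eta>: "0 < \<eta>" "\<eta> \<le> 1"
  shows "\<exists>G \<kappa> m. finite G \<and> 0 < \<kappa> \<and> \<kappa> \<le> 1 \<and> 0 < m \<and> (\<forall>(\<phi>, n)\<in>G. annular_bump \<phi> n) \<and>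
    (\<forall>p. knorm p \<le> N \<longrightarrow> \<eta> / 2 \<le> knorm p \<longrightarrow> (\<exists>(\<phi>, n)\<in>G.
       (\<forall>q. \<phi> (coords q) \<noteq> 0 \<longrightarrow> knorm (p - q) < \<eta>) \<and> (\<forall>h. knorm h < \<kappa> \<longrightarrow> m \<le> \<phi> (coords (- h + p)))))"
proof -
  \<comment> \<open>A point of the support is at most \<open>3 * s\<close> from the covered point in
    coordinates, and \<open>s\<close> makes this less than \<open>\<eta> / 8\<close> in the gauge.
    As centres have gauge at least \<open>\<eta> / 2\<close>, this is at most a quarter of it,
    whence the factors 3/4 and 5/4.\<close>
  define s where "s = min (\<eta> / 192) ((\<eta> / 64)\<^sup>2 / (3 * (1 + N)))"
  have s: "0 < s" using \<eta> N by (simp add: s_def)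
  have near: "knorm (p - q) < \<eta> / 8" if "knorm p \<le> N" "norm (coords q - coords p) \<le> 3 * s" for p q
  proof -
    have "3 * s * (1 + N) \<le> (\<eta> / 64)\<^sup>2"
    proof -
      have "s \<le> (\<eta> / 64)\<^sup>2 / (3 * (1 + N))" unfolding s_def by (rule min.cobounded2)
      then have "s * (3 * (1 + N)) \<le> (\<eta> / 64)\<^sup>2" using N by (simp add: pos_le_divide_eq)
      then show ?thesis by (simp add: mult_ac)
    qed
    then have "sqrt (3 * s * (1 + N)) \<le> sqrt ((\<eta> / 64)\<^sup>2)" by (rule real_sqrt_le_mono)
    also have "\<dots> = \<eta> / 64" using \<eta> by (intro real_sqrt_unique) auto
    finally have "sqrt (3 * s * (1 + N)) \<le> \<eta> / 64" .
    moreover have "s \<le> \<eta> / 192" unfolding s_def by (rule min.cobounded1)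
    ultimately show ?thesis using knorm_diff_le[OF that] \<eta>(1) by linarith
  qed
  \<comment> \<open>Translation by \<open>h\<close> moves the coordinates by at most
    \<open>s / 2\<close>; added to the covering radius \<open>s\<close> this is the radius in
    \<open>bump_ge\<close>.\<close>
  define \<kappa> where "\<kappa> = min 1 (s / (2 * (3 + N)))"
  have \<kappa>: "0 < \<kappa>" "\<kappa> \<le> 1" using s N by (auto simp: \<kappa>_def)
  have \<kappa>s: "\<kappa> * (3 + N) \<le> s / 2"
  proof -
    have "\<kappa> \<le> s / (2 * (3 + N))" unfolding \<kappa>_def by (rule min.cobounded2)
    then have "\<kappa> * (2 * (3 + N)) \<le> s" using N by (simp add: pos_le_divide_eq)
    moreover have "\<kappa> * (2 * (3 + N)) = 2 * (\<kappa> * (3 + N))" by simp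
    ultimately show ?thesis by linarith
  qed
  define m where "m = flat 0 (s\<^sup>2)"
  have m: "0 < m" using s by (simp add: m_def flat_pos)
  define K where "K = (\<lambda>x. knorm (of_coords x)) -` {\<eta> / 2..N} \<inter> ({- N..N} \<times> {- N..N} \<times> {- (N\<^sup>2)..N\<^sup>2})"
  have "closed ((\<lambda>x. knorm (of_coords x)) -` {\<eta> / 2..N})"
    by (rule closed_vimage[OF _ continuous_knorm_of_coords]) simp
  moreover have "compact ({- N..N} \<times> {- N..N} \<times> {- (N\<^sup>2)..N\<^sup>2})" by (intro compact_Times) auto
  ultimately have "compact K" unfolding K_def by (rule closed_Int_compact)
  moreover have "K \<subseteq> (\<Union>c\<in>K. ball c s)" using s by auto
  ultimately obtain C where C: "C \<subseteq> K" "finite C" "K \<subseteq> (\<Union>c\<in>C. ball c s)"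
    using compactE_image[of K K "\<lambda>c. ball c s"] by auto
  define G where "G = (\<lambda>c. (bump s c, knorm (of_coords c))) ` C"
  have F1: "finite G" using C(2) by (simp add: G_def)
  have "annular_bump (bump s c) (knorm (of_coords c))" if "c \<in> C" for c
    unfolding annular_bump_def
  proof (intro conjI allI impI elem_fun_bump bump_nonneg)
    have c: "\<eta> / 2 \<le> knorm (of_coords c)" "knorm (of_coords c) \<le> N"
      using that C(1) by (auto simp: K_def)
    then show "0 < knorm (of_coords c)" using \<eta> by linarith
    fix x assume "bump s c x \<noteq> 0"
    then have "norm (x - c) < 2 * s" using s by (rule bump_nonzero)
    then have "knorm (of_coords c - of_coords x) < \<eta> / 8" using s c(2) by (intro near) auto
    moreover have "knorm (of_coords c) \<le> knorm (of_coords c - of_coords x) + knorm (of_coords x)"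
      using knorm_triangle[of "of_coords c - of_coords x" "of_coords x"] by simp
    moreover have "knorm (of_coords x) \<le> knorm (of_coords c - of_coords x) + knorm (of_coords c)"
    proof -
      have "of_coords x = - (of_coords c - of_coords x) + of_coords c"
        by (rule heis_eqI) (simp_all add: field_simps)
      then show ?thesis using knorm_triangle[of "- (of_coords c - of_coords x)" "of_coords c"] by (metis knorm_uminus)
    qed
    ultimately show "3 / 4 * knorm (of_coords c) \<le> knorm (of_coords x)"
      "knorm (of_coords x) \<le> 5 / 4 * knorm (of_coords c)" using c(1) by linarith+
  qed
  then have F2: "\<forall>(\<phi>, n)\<in>G. annular_bump \<phi> n" by (simp add: G_def)
  have F3: "\<exists>(\<phi>, n)\<in>G. (\<forall>q. \<phi> (coords q) \<noteq> 0 \<longrightarrow> knorm (p - q) < \<eta>) \<and>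
      (\<forall>h. knorm h < \<kappa> \<longrightarrow> m \<le> \<phi> (coords (- h + p)))"
    if p: "knorm p \<le> N" "\<eta> / 2 \<le> knorm p" for p
  proof -
    have "(knorm p)\<^sup>2 \<le> N\<^sup>2" using p by (intro power_mono) auto
    then have "\<bar>ht p\<bar> \<le> N\<^sup>2" using abs_ht_le_knorm[of p] by linarith
    then have "coords p \<in> K"
      using p abs_hx_le_knorm[of p] abs_hy_le_knorm[of p] unfolding K_def by (auto simp: coords_def[of p, symmetric]) (auto simp: coords_def)
    then obtain c where c: "c \<in> C" "norm (coords p - c) < s"
      using C(3) by (auto simp: dist_norm norm_minus_commute)
    have 1: "knorm (p - q) < \<eta>" if "bump s c (coords q) \<noteq> 0" for q
    proof -
      have "norm (coords q - c) < 2 * s" using that s by (rule bump_nonzero)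
      then have "norm (coords q - coords p) \<le> 3 * s"
        using c(2) norm_triangle_ineq[of "coords q - c" "c - coords p"] by (simp add: norm_minus_commute)
      from near[OF p(1) this] show ?thesis using \<eta> by linarith
    qed
    have 2: "m \<le> bump s c (coords (- h + p))" if "knorm h < \<kappa>" for h
      unfolding m_def
    proof (rule bump_ge)
      have "norm (coords (- h + p) - coords p) \<le> s / 2"
        using norm_coords_translate[OF p(1), of h \<kappa>] that \<kappa>(2) \<kappa>s by linarith
      then show "norm (coords (- h + p) - c) \<le> 3 / 2 * s"
        using c(2) norm_triangle_ineq[of "coords (- h + p) - coords p" "coords p - c"] by simp
    qed
    have "(bump s c, knorm (of_coords c)) \<in> G" using c(1) by (simp add: G_def)
    then show ?thesis using 1 2 by (intro bexI[of _ "(bump s c, knorm (of_coords c))"]) simp_all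
  qed
  show ?thesis
    by (intro exI[of _ G] exI[of _ \<kappa>] exI[of _ m] conjI F1 F2 F3 \<kappa> m allI impI)
qed

definition antisymmetrize :: "(real3 \<Rightarrow> real) \<Rightarrow> real3 \<Rightarrow> real" where
  "antisymmetrize \<phi> x = \<phi> x - \<phi> (coords (hconj (of_coords x)))"

text \<open>The support has ratio 5/3 between outer and inner radius, less than 2, so it fits
  strictly into a dyadic annulus: any inner radius between 5/8 and 3/4 of \<open>n\<close> would do,
  and 7/10 is one. The gauge is invariant under \<open>hconj\<close>, so the mirrored bump stays in
  the same annulus.\<close>

lemma antisymmetrize_annular:
  assumes "annular_bump \<phi> n"
  shows "annulus (7 / 10 * n) (3 / 4 * n) (5 / 4 * n)"
    and "elem_fun (antisymmetrize \<phi>)"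
    and "annulus.supported (3 / 4 * n) (5 / 4 * n) (antisymmetrize \<phi>)"
    and "antisymmetrize \<phi> (- x, - y, t) = - antisymmetrize \<phi> (x, y, t)"
proof -
  show ann: "annulus (7 / 10 * n) (3 / 4 * n) (5 / 4 * n)"
    using assms by (simp add: annulus_def annular_bump_def)
  have lin: "bounded_linear (\<lambda>x :: real3. (- fst x, - fst (snd x), snd (snd x)))"
    by (rule bounded_linear_Pair[OF bounded_linear_minus[OF bounded_linear_fst]
        bounded_linear_Pair[OF bounded_linear_minus[OF bounded_linear_compose[OF bounded_linear_fst bounded_linear_snd]]
          bounded_linear_compose[OF bounded_linear_snd bounded_linear_snd]]])
  have e: "elem_fun \<phi>" using assms by (simp add: annular_bump_def)
  have "elem_fun (\<lambda>x. \<phi> x - \<phi> (- fst x, - fst (snd x), snd (snd x)))"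
    by (rule elem_fun_diff[OF e elem_fun_compose_linear[OF e lin]])
  moreover have eq: "antisymmetrize \<phi> = (\<lambda>x. \<phi> x - \<phi> (- fst x, - fst (snd x), snd (snd x)))"
  proof (rule ext)
    fix x :: real3
    obtain x1 x2 x3 where x: "x = (x1, x2, x3)" by (cases x)
    have "coords (hconj (of_coords x)) = (- x1, - x2, x3)"
      unfolding x of_coords_def prod.case by (simp only: coords_def hconj_sel heis.sel)
    then show "antisymmetrize \<phi> x = \<phi> x - \<phi> (- fst x, - fst (snd x), snd (snd x))"
      unfolding antisymmetrize_def by (simp only: x fst_conv snd_conv)
  qed
  ultimately show "elem_fun (antisymmetrize \<phi>)" by simp
  show "antisymmetrize \<phi> (- x, - y, t) = - antisymmetrize \<phi> (x, y, t)" by (simp add: eq)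
  have "3 / 4 * n \<le> knorm (of_coords x) \<and> knorm (of_coords x) \<le> 5 / 4 * n"
    if "antisymmetrize \<phi> x \<noteq> 0" for x
  proof -
    have "\<phi> x \<noteq> 0 \<or> \<phi> (coords (hconj (of_coords x))) \<noteq> 0" using that by (auto simp: antisymmetrize_def)
    then show ?thesis
    proof
      assume "\<phi> x \<noteq> 0"
      then show ?thesis using assms unfolding annular_bump_def by blast
    next
      assume "\<phi> (coords (hconj (of_coords x))) \<noteq> 0"
      then have "3 / 4 * n \<le> knorm (of_coords (coords (hconj (of_coords x)))) \<and>
          knorm (of_coords (coords (hconj (of_coords x)))) \<le> 5 / 4 * n"
        using assms unfolding annular_bump_def by blast
      then show ?thesis by simp
    qed
  qed
  then show "annulus.supported (3 / 4 * n) (5 / 4 * n) (antisymmetrize \<phi>)"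
    unfolding annulus.supported_def[OF ann] by blast
qed

section \<open>Lower bound for a convolution at an asymmetric pair\<close>

context regular_set begin

lemma emeasure_mu: "S \<in> sets borel \<Longrightarrow> emeasure (hausdorff3_on E) S = hausdorff 3 (E \<inter> S)"
  using closed by (intro emeasure_hausdorff3_on) auto

lemma AE_mu_I:
  assumes "\<And>q. q \<in> E \<Longrightarrow> P q"
  shows "AE q in hausdorff3_on E. P q"
proof -
  have meas: "indicator E \<in> borel_measurable (hausdorff_measure 3 :: heis measure)"
    using borel_closed[OF closed] by (intro borel_measurable_indicator) simp
  have "AE q in hausdorff_measure 3. 0 < (indicator E q :: ennreal) \<longrightarrow> P q"
  proof (rule AE_I2)
    fix q show "0 < (indicator E q :: ennreal) \<longrightarrow> P q"
      using assms[of q] by (cases "q \<in> E") simp_all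
  qed
  then show ?thesis unfolding hausdorff3_on_def AE_density[OF meas] .
qed

text \<open>The bump sees points near \<open>v\<close>, its mirror image sees points near
  \<open>hsym u v\<close>, where \<open>E\<close> is absent. On \<open>E\<close> the kernel is
  therefore the nonnegative bump without any cancellation, and on
  \<open>ball v (\<kappa> * r)\<close> it is at least \<open>m / r ^ 3\<close>, while regularity
  provides mass there.\<close>

lemma asymmetric_imp_large:
  assumes \<phi>: "annular_bump \<phi> n" and m: "0 < m" and \<kappa>: "0 < \<kappa>" "\<kappa> \<le> 1" and r: "0 < r"
    and uv: "u \<in> E" "v \<in> E" "dist u v \<le> N * r"
    and asym: "\<And>w. w \<in> E \<Longrightarrow> \<eta> * r \<le> dist w (hsym u v)"
    and diam: "ennreal (\<kappa> * r) \<le> ediam E"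
    and near: "\<And>q. \<phi> (coords q) \<noteq> 0 \<Longrightarrow> knorm (dil (1 / r) (- v + u) - q) < \<eta>"
    and large: "\<And>h. knorm h < \<kappa> \<Longrightarrow> m \<le> \<phi> (coords (- h + dil (1 / r) (- v + u)))"
    and B: "emeasure (hausdorff3_on E) (ball p R) < \<infinity>" "ball u ((N + 1) * r) \<subseteq> ball p R"
  shows "m * \<kappa> ^ 3 / A \<le>
    (LINT q|hausdorff3_on E. rescale 3 (antisymmetrize \<phi>) r (coords (- q + u)) * indicator (ball p R) q)"
proof -
  define g where "g = antisymmetrize \<phi>"
  define S where "S = ball v (\<kappa> * r)"
  define f where "f q = rescale 3 g r (coords (- q + u)) * indicator (ball p R) q" for q
  note g = antisymmetrize_annular[OF \<phi>, folded g_def]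
  interpret annulus "7 / 10 * n" "3 / 4 * n" "5 / 4 * n" by (rule g(1))
  have S_sub: "S \<subseteq> ball p R"
  proof -
    have "dist u q < (N + 1) * r" if "dist v q < \<kappa> * r" for q
    proof -
      have "\<kappa> * r \<le> 1 * r" using \<kappa> r by (intro mult_right_mono) auto
      then show ?thesis using that uv(3) dist_triangle[of u q v] by (simp add: distrib_right)
    qed
    then have "S \<subseteq> ball u ((N + 1) * r)" by (auto simp: S_def)
    then show ?thesis using B(2) by blast
  qed
  have finS: "emeasure (hausdorff3_on E) S < \<infinity>"
    using emeasure_mono[OF S_sub, of "hausdorff3_on E"] B(1) by (simp add: order.strict_trans1)
  have intB: "integrable (hausdorff3_on E) (indicator (ball p R) :: heis \<Rightarrow> real)"
    using B(1) by simp
  have intS: "integrable (hausdorff3_on E) (indicator S :: heis \<Rightarrow> real)"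
    using finS by (simp add: S_def)
  have int_f: "integrable (hausdorff3_on E) f"
  proof -
    obtain D where D: "\<And>x. \<bar>g x\<bar> \<le> D" using supported_bounded[OF g(2,3)] by blast
    show ?thesis
    proof (rule Bochner_Integration.integrable_bound)
      show "integrable (hausdorff3_on E) (\<lambda>q. D / r ^ 3 * indicator (ball p R) q)" using intB by simp
      show "f \<in> borel_measurable (hausdorff3_on E)"
        unfolding f_def
        by (intro borel_measurable_times borel_measurable_indicator borel_measurable_rescale_translate g(2)) auto
      show "AE q in hausdorff3_on E. norm (f q) \<le> norm (D / r ^ 3 * indicator (ball p R) q)"
      proof (rule AE_I2)
        fix q
        have "\<bar>g (coords (dil (1 / r) (- q + u)))\<bar> \<le> \<bar>D\<bar>" using D by (meson abs_ge_self order_trans)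
        then show "norm (f q) \<le> norm (D / r ^ 3 * indicator (ball p R) q)"
          using r by (auto simp: f_def rescale_def indicator_def divide_right_mono)
      qed
    qed
  qed
  have pointwise: "m / r ^ 3 * indicator S q \<le> f q" if q: "q \<in> E" for q
  proof -
    define b where "b = dil (1 / r) (- q + u)"
    \<comment> \<open>Otherwise the reflection of \<open>q\<close> in \<open>u\<close> is close to
      \<open>v\<close>, and as reflections are isometric involutions the point \<open>q\<close> of
      \<open>E\<close> is close to \<open>hsym u v\<close>.\<close>
    have "\<phi> (coords (hconj b)) = 0"
    proof (rule ccontr)
      assume *: "\<phi> (coords (hconj b)) \<noteq> 0"
      define w where "w = hsym u q"
      have "dil (1 / r) (- v + u) - hconj b = dil (1 / r) (- v + u) - dil (1 / r) (- w + u)"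
        by (simp add: b_def w_def uminus_hsym dil_hconj)
      also have "\<dots> = dil (1 / r) ((- v + u) - (- w + u))"
        by (simp only: diff_conv_add_uminus dil_plus dil_uminus)
      also have "(- v + u) - (- w + u) = - v + w"
        by (rule heis_eqI) (simp_all add: field_simps)
      finally have "knorm (dil (1 / r) (- v + w)) < \<eta>" using near[OF *] by simp
      then have "dist w v < \<eta> * r" using r by (simp add: knorm_dil dist_heis_def field_simps)
      moreover have "dist w v = dist q (hsym u v)"
        unfolding w_def using dist_hsym[of u q "hsym u v"] by simp
      ultimately show False using asym[OF q] by simp
    qed
    then have gb: "g (coords b) = \<phi> (coords b)" by (simp add: g_def antisymmetrize_def)
    have f: "f q = \<phi> (coords b) / r ^ 3 * indicator (ball p R) q"
      by (simp add: f_def rescale_def gb flip: b_def)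
    show ?thesis
    proof (cases "q \<in> S")
      case False
      have "0 \<le> \<phi> (coords b)" using \<phi> unfolding annular_bump_def by blast
      then show ?thesis using False r by (simp add: f)
    next
      case True
      define h where "h = dil (1 / r) (- v + q)"
      have "dist q v < \<kappa> * r" using True dist_commute[of v q] by (simp add: S_def)
      then have "knorm h < \<kappa>" using r by (simp add: h_def knorm_dil dist_heis_def pos_divide_less_eq)
      moreover have "- h + dil (1 / r) (- v + u) = b"
      proof -
        have "- (- v + q) + (- v + u) = - q + u"
          by (rule heis_eqI) (simp_all add: field_simps)
        then show ?thesis
          unfolding h_def b_def dil_uminus[symmetric] dil_plus[symmetric] by (simp only:)
      qed
      ultimately have "m \<le> \<phi> (coords b)" using large[of h] by simp
      then show ?thesis using True S_sub r by (auto simp: f divide_right_mono)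
    qed
  qed
  have "(\<kappa> * r) ^ 3 / A \<le> measure (hausdorff3_on E) S"
  proof -
    have "ennreal ((\<kappa> * r) ^ 3 / A) \<le> hausdorff 3 (E \<inter> ball v (\<kappa> * r))"
      using \<kappa> r by (intro lower uv diam) auto
    also have "\<dots> = emeasure (hausdorff3_on E) S" unfolding S_def by (subst emeasure_mu) auto
    also have "\<dots> = ennreal (measure (hausdorff3_on E) S)"
      using finS by (intro emeasure_eq_ennreal_measure) auto
    finally show ?thesis by (subst (asm) ennreal_le_iff) auto
  qed
  then have "m / r ^ 3 * ((\<kappa> * r) ^ 3 / A) \<le> m / r ^ 3 * measure (hausdorff3_on E) S"
    using m r by (intro mult_left_mono) auto
  also have "m / r ^ 3 * ((\<kappa> * r) ^ 3 / A) = m * \<kappa> ^ 3 / A" using r by (simp add: power_mult_distrib)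
  also have "m / r ^ 3 * measure (hausdorff3_on E) S = (LINT q|hausdorff3_on E. m / r ^ 3 * indicator S q)"
    by simp
  also have "\<dots> \<le> (LINT q|hausdorff3_on E. f q)"
    using intS int_f by (intro integral_mono_AE AE_mu_I pointwise) auto
  finally show ?thesis by (simp add: f_def g_def)
qed

end

section \<open>The weak geometric lemma\<close>

lemma exists_separated_net:
  fixes T :: "'a::metric_space set" and s X :: real
  assumes "\<And>F. F \<subseteq> T \<Longrightarrow> finite F \<Longrightarrow> (\<forall>x\<in>F. \<forall>y\<in>F. x \<noteq> y \<longrightarrow> s \<le> dist x y) \<Longrightarrow> real (card F) \<le> X"
  shows "\<exists>F\<subseteq>T. finite F \<and> (\<forall>x\<in>F. \<forall>y\<in>F. x \<noteq> y \<longrightarrow> s \<le> dist x y) \<and> (\<forall>x\<in>T. \<exists>y\<in>F. dist x y < s \<or> x = y)"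
proof -
  define P where "P F \<longleftrightarrow> F \<subseteq> T \<and> finite F \<and> (\<forall>x\<in>F. \<forall>y\<in>F. x \<noteq> y \<longrightarrow> s \<le> dist x y)" for F
  obtain b :: nat where b: "X < real b" using reals_Archimedean2 by blast
  have "P {}" by (simp add: P_def)
  moreover have "\<forall>F. P F \<longrightarrow> card F < b"
  proof (intro allI impI)
    fix F assume "P F"
    then have "real (card F) \<le> X" using assms by (auto simp: P_def)
    then show "card F < b" using b by linarith
  qed
  \<comment> \<open>Maximal cardinality makes the separated set a net; a maximum exists because the
    hypothesis bounds all cardinalities.\<close>
  ultimately obtain F where F: "P F" "\<And>F'. P F' \<Longrightarrow> card F' \<le> card F"
    using ex_has_greatest_nat[of P "{}" card b] by (metis less_imp_le)
  have "\<exists>y\<in>F. dist x y < s \<or> x = y" if x: "x \<in> T" for x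
  proof (rule ccontr)
    assume *: "\<not> ?thesis"
    then have "P (insert x F)" using F(1) x by (auto simp: P_def dist_commute not_less)
    then have "card (insert x F) \<le> card F" by (rule F(2))
    then show False using * F(1) by (auto simp: P_def)
  qed
  then show ?thesis using F(1) by (intro exI[of _ F]) (auto simp: P_def)
qed

lemma vertical_plane_through: "\<exists>W. vertical_plane W \<and> p \<in> W"
proof -
  define V where "V = {w :: real \<times> real \<times> real. (1, 0, 0) \<bullet> w = 0}"
  have "(1, 0, 0) \<noteq> (0 :: real \<times> real \<times> real)" by (simp add: zero_prod_def)
  then have "dim V = 2" unfolding V_def using dim_hyperplane[of "(1 :: real, 0 :: real, 0 :: real)"] by simp
  moreover have "subspace V" unfolding V_def by (rule subspace_hyperplane)
  ultimately have "vertical_plane ((\<lambda>q. p + q) ` {q. (hx q, hy q, ht q) \<in> V})"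
    unfolding vertical_plane_def by (intro exI[of _ V] exI[of _ p]) (auto simp: V_def)
  moreover have "p \<in> (\<lambda>q. p + q) ` {q. (hx q, hy q, ht q) \<in> V}"
    by (rule image_eqI[of _ _ 0]) (auto simp: V_def)
  ultimately show ?thesis by blast
qed

text \<open>A plane through \<open>p\<close> itself is a competitor and misses no point of
  \<open>E\<close> by more than \<open>D\<close>. Radii far beyond the diameter thus have small
  \<beta>-numbers.\<close>

lemma vertical_beta_le_diameter:
  assumes r: "0 < r" and p: "p \<in> E" and D: "\<And>x y. x \<in> E \<Longrightarrow> y \<in> E \<Longrightarrow> dist x y \<le> D"
    and beta: "ennreal \<epsilon> \<le> vertical_beta E p r" and e: "0 < \<epsilon>"
  shows "\<epsilon> * r \<le> D"
proof -
  obtain W where W: "vertical_plane W" "p \<in> W" using vertical_plane_through by blast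
  have D0: "0 \<le> D" using D[OF p p] by simp
  have "vertical_beta E p r \<le> (SUP y\<in>ball p r \<inter> E. ennreal (infdist y W / r))"
    unfolding vertical_beta_def using W by (intro INF_lower) auto
  also have "\<dots> \<le> ennreal (D / r)"
  proof (rule SUP_least)
    fix y assume y: "y \<in> ball p r \<inter> E"
    have "infdist y W \<le> dist y p" using W by (intro infdist_le) auto
    also have "\<dots> \<le> D" using y p by (intro D) auto
    finally show "ennreal (infdist y W / r) \<le> ennreal (D / r)"
      using r by (intro ennreal_leI divide_right_mono) auto
  qed
  finally have "ennreal \<epsilon> \<le> ennreal (D / r)" using beta by (rule order_trans[rotated])
  then have "\<epsilon> \<le> D / r" using D0 r by (subst (asm) ennreal_le_iff) auto
  then show ?thesis using r by (simp add: pos_le_divide_eq)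
qed

text \<open>The same plane is tested at both radii: the larger ball contains the smaller one, and
  normalising by \<open>r'\<close> instead of \<open>r\<close> loses at most the factor 2. Dyadic
  radii can thus stand for all radii.\<close>

lemma vertical_beta_doubling:
  assumes r: "0 < r" "r \<le> r'" "r' \<le> 2 * r" and beta: "ennreal \<epsilon> \<le> vertical_beta E p r" and e: "0 < \<epsilon>"
  shows "ennreal (\<epsilon> / 2) \<le> vertical_beta E p r'"
  unfolding vertical_beta_def
proof (rule INF_greatest)
  fix W assume W: "W \<in> {W. vertical_plane W}"
  define S where "S = (SUP y\<in>ball p r' \<inter> E. ennreal (infdist y W / r'))"
  have "ennreal \<epsilon> \<le> (SUP y\<in>ball p r \<inter> E. ennreal (infdist y W / r))"
    using beta W unfolding vertical_beta_def by (auto simp: le_INF_iff)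
  also have "\<dots> \<le> 2 * S"
  proof (rule SUP_least)
    fix y assume y: "y \<in> ball p r \<inter> E"
    have "infdist y W / r \<le> 2 * (infdist y W / r')"
    proof -
      have "infdist y W * r' \<le> infdist y W * (2 * r)" using r infdist_nonneg by (intro mult_left_mono) auto
      then show ?thesis using r by (simp add: field_simps)
    qed
    then have "ennreal (infdist y W / r) \<le> ennreal (2 * (infdist y W / r'))" by (rule ennreal_leI)
    also have "\<dots> = 2 * ennreal (infdist y W / r')"
      using r infdist_nonneg[of y W] by (subst ennreal_mult) auto
    also have "\<dots> \<le> 2 * S"
      unfolding S_def using y r by (intro mult_left_mono SUP_upper) auto
    finally show "ennreal (infdist y W / r) \<le> 2 * S" .
  qed
  finally have le: "ennreal \<epsilon> \<le> 2 * S" .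
  show "ennreal (\<epsilon> / 2) \<le> S"
  proof (cases S)
    case (real x)
    then have "2 * S = ennreal (2 * x)" by (simp add: ennreal_mult)
    then have "\<epsilon> \<le> 2 * x" using le real(1) by (simp add: ennreal_le_iff)
    then show ?thesis unfolding real(2) using real(1) by (intro ennreal_leI) simp
  qed simp
qed

text \<open>The convolution \<open>conv\<close> with bump and ball as explicit arguments, because a
  finite family of bumps has to be treated together.\<close>

definition bconv :: "heis set \<Rightarrow> (real3 \<Rightarrow> real) \<Rightarrow> heis \<Rightarrow> real \<Rightarrow> int \<Rightarrow> heis \<Rightarrow> real" where
  "bconv E \<phi> p0 R j p =
    (LINT q|hausdorff3_on E. rescale 3 (antisymmetrize \<phi>) (2 powi j) (coords (- q + p)) * indicator (ball p0 R) q)"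

lemma bconv_carleson:
  assumes \<phi>: "annular_bump \<phi> n" and E: "closed E"
    and bd: "\<forall>K. admissible_kernel K \<longrightarrow> sio_bounded_L2 K (hausdorff3_on E)"
  shows "\<exists>C\<ge>0. \<forall>p0 R. emeasure (hausdorff3_on E) (ball p0 R) < \<infinity> \<longrightarrow>
    (\<forall>j. sq_integrable (hausdorff3_on E) (bconv E \<phi> p0 R j)) \<and>
    (\<forall>l h. (\<Sum>j=l..h. LINT p|hausdorff3_on E. (bconv E \<phi> p0 R j p)\<^sup>2) \<le> C * measure (hausdorff3_on E) (ball p0 R))"
proof -
  note g = antisymmetrize_annular[OF \<phi>]
  interpret sio_setting "7 / 10 * n" "3 / 4 * n" "5 / 4 * n" E "antisymmetrize \<phi>"
    by (rule sio_setting.intro[OF g(1)], rule sio_setting_axioms.intro)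
      (fact E g(2,3,4) bd[rule_format])+
  have eq: "conv (p0, R) j = bconv E \<phi> p0 R j" for p0 R j
    by (rule ext) (simp add: conv_def bconv_def)
  have fin: "(p0, R) \<in> finite_balls" if "emeasure (hausdorff3_on E) (ball p0 R) < \<infinity>" for p0 R
    using that by (simp add: finite_balls_def)
  obtain C where C: "0 \<le> C" "\<And>B l h. B \<in> finite_balls \<Longrightarrow>
      (\<Sum>j=l..h. LINT p|mu. (conv B j p)\<^sup>2) \<le> C * measure mu (ball (fst B) (snd B))"
    using carleson_estimate by blast
  show ?thesis
  proof (intro exI[of _ C] conjI allI impI C(1))
    fix p0 :: heis and R :: real assume *: "emeasure mu (ball p0 R) < \<infinity>"
    show "sq_integrable mu (bconv E \<phi> p0 R j)" for j
      using sq_integrable_conv[OF fin[OF *], of j] by (simp only: eq)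
    show "(\<Sum>j=l..h. LINT p|mu. (bconv E \<phi> p0 R j p)\<^sup>2) \<le> C * measure mu (ball p0 R)" for l h
      using C(2)[OF fin[OF *], of l h] by (simp only: eq fst_conv snd_conv)
  qed
qed

section \<open>The bad set at a single scale\<close>

context regular_set begin

text \<open>Regularity concerns radii up to the diameter, whereas balls of arbitrary radius occur
  below. A bounded \<open>E\<close> is compact, so finitely many balls of radius \<open>D\<close>
  bound its total mass, which suffices for \<open>R > D\<close>.\<close>

lemma global_upper:
  assumes "ediam E \<noteq> 0"
  shows "\<exists>A'\<ge>1. \<forall>p\<in>E. \<forall>R>0. hausdorff 3 (E \<inter> ball p R) \<le> ennreal (A' * R ^ 3)"
proof (cases "ediam E")
  case top
  then show ?thesis using upper A_ge_1 by (intro exI[of _ A]) auto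
next
  case (real D)
  have D: "0 < D" using real assms by (cases "D = 0") auto
  have dist_le: "dist x y \<le> D" if "x \<in> E" "y \<in> E" for x y
    using dist_le_ediam[OF that] real by (simp add: ennreal_le_iff)
  have "bounded E" using dist_le unfolding bounded_def by blast
  then have "compact E" using closed by (rule closed_bounded_imp_compact_heis[rotated])
  then obtain F where F: "F \<subseteq> E" "finite F" "E \<subseteq> (\<Union>x\<in>F. ball x D)"
  proof (rule compactE_image[of E E "\<lambda>x. ball x D"])
    show "E \<subseteq> (\<Union>x\<in>E. ball x D)" using D by auto
  qed auto
  have "hausdorff 3 E = emeasure (hausdorff3_on E) UNIV" by (subst emeasure_mu) auto
  also have "\<dots> = emeasure (hausdorff3_on E) E"
    using closed by (subst (1 2) emeasure_mu) auto
  also have "\<dots> \<le> emeasure (hausdorff3_on E) (\<Union>x\<in>F. ball x D)" by (intro emeasure_mono F(3)) (auto intro: borel_open)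
  also have "\<dots> \<le> (\<Sum>x\<in>F. emeasure (hausdorff3_on E) (ball x D))"
    using F(2) by (intro emeasure_subadditive_finite) auto
  also have "\<dots> \<le> (\<Sum>x\<in>F. ennreal (A * D ^ 3))"
  proof (rule sum_mono)
    fix x assume "x \<in> F"
    then have "hausdorff 3 (E \<inter> ball x D) \<le> ennreal (A * D ^ 3)" using F(1) D real by (intro upper) auto
    then show "emeasure (hausdorff3_on E) (ball x D) \<le> ennreal (A * D ^ 3)" by (simp add: emeasure_mu)
  qed
  also have "\<dots> = ennreal (real (card F) * (A * D ^ 3))"
    unfolding sum_constant ennreal_of_nat_eq_real_of_nat
    using A_ge_1 D by (intro ennreal_mult[symmetric]) auto
  finally have total: "hausdorff 3 E \<le> ennreal (real (card F) * (A * D ^ 3))" .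
  define A' where "A' = A + real (card F) * A"
  have A': "A \<le> A'" "real (card F) * A \<le> A'" using A_ge_1 by (auto simp: A'_def)
  have "hausdorff 3 (E \<inter> ball p R) \<le> ennreal (A' * R ^ 3)" if p: "p \<in> E" and R: "0 < R" for p R
  proof (cases "R \<le> D")
    case True
    have "hausdorff 3 (E \<inter> ball p R) \<le> ennreal (A * R ^ 3)"
      using True p R real by (intro upper) (auto intro: ennreal_leI)
    also have "\<dots> \<le> ennreal (A' * R ^ 3)" using A' R by (intro ennreal_leI mult_right_mono) auto
    finally show ?thesis .
  next
    case False
    have "hausdorff 3 (E \<inter> ball p R) \<le> hausdorff 3 E" by (intro hausdorff_mono) auto
    also note total
    also have "ennreal (real (card F) * (A * D ^ 3)) \<le> ennreal (A' * R ^ 3)"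
    proof (rule ennreal_leI)
      have "D ^ 3 \<le> R ^ 3" using False D by (intro power_mono) auto
      then have "real (card F) * A * D ^ 3 \<le> A' * R ^ 3"
        using A' A_ge_1 D by (intro mult_mono) auto
      then show "real (card F) * (A * D ^ 3) \<le> A' * R ^ 3" by (simp add: mult.assoc)
    qed
    finally show ?thesis .
  qed
  then show ?thesis using A' A_ge_1 by (intro exI[of _ A']) auto
qed

text \<open>A bad point lies within \<open>N * r\<close> of an asymmetric pair, and the asymmetry
  survives moving \<open>a\<close> by \<open>\<sigma> * r\<close>. So \<open>Q\<close> is large on
  disjoint balls about a net of such centres; Chebyshev's inequality counts them, and enlarged balls
  cover the bad set. The bad set itself enters through the monotonicity of the outer measure alone,
  so its measurability is not at issue.\<close>

lemma bad_set_estimate: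
  assumes e: "0 < \<epsilon>" "\<epsilon> \<le> 1"
    and A'_nonneg: "0 \<le> A'" and A'_upper: "\<forall>p\<in>E. \<forall>R>0. hausdorff 3 (E \<inter> ball p R) \<le> ennreal (A' * R ^ 3)"
    and bd: "\<forall>K. admissible_kernel K \<longrightarrow> sio_bounded_L2 K (hausdorff3_on E)"
  shows "\<exists>G N0 L K. finite G \<and> 1 \<le> N0 \<and> 1 \<le> L \<and> 0 \<le> K \<and> (\<forall>(\<phi>, n)\<in>G. annular_bump \<phi> n) \<and>
    (\<forall>p0\<in>E. \<forall>R>0. \<forall>k. 2 powi k \<le> 2 * R \<longrightarrow> ennreal (N0 * 2 powi k) \<le> ediam E \<longrightarrow>
      hausdorff 3 {p \<in> E \<inter> ball p0 R. ennreal \<epsilon> \<le> vertical_beta E p (2 powi k)}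
        \<le> ennreal (K * (\<Sum>(\<phi>, n)\<in>G. LINT p|hausdorff3_on E. (bconv E \<phi> p0 (L * R) k p)\<^sup>2)))"
proof -
  have A': "0 \<le> A'" "\<And>p R. p \<in> E \<Longrightarrow> 0 < R \<Longrightarrow> hausdorff 3 (E \<inter> ball p R) \<le> ennreal (A' * R ^ 3)"
    using A'_nonneg A'_upper by auto
  define M where "M = hausdorff3_on E"
  obtain N \<eta> where N: "1 \<le> N" and \<eta>: "0 < \<eta>" "\<eta> \<le> 1"
    and asym: "\<And>p r. p \<in> E \<Longrightarrow> 0 < r \<Longrightarrow> ennreal (N * r) \<le> ediam E \<Longrightarrow> ennreal \<epsilon> \<le> vertical_beta E p r \<Longrightarrow>
      \<exists>a\<in>E \<inter> ball p (N * r). \<exists>b\<in>E \<inter> ball p (N * r). \<forall>w\<in>E. \<eta> * r \<le> dist w (hsym a b)"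
    using flat_or_asymmetric[OF e] by blast
  \<comment> \<open>By \<open>dist_hsym_centre\<close>, moving the centre by
    \<open>\<sigma> * r\<close> displaces the mirror image of a point within
    \<open>2 * N * r\<close> by at most \<open>\<eta> / 4 * r\<close> from each of the two terms, so
    half of the asymmetry remains.\<close>
  define \<sigma> where "\<sigma> = min (\<eta> / 8) ((\<eta> / 16)\<^sup>2 / (2 * N + 1))"
  have \<sigma>0: "0 < \<sigma>" using \<eta> N by (simp add: \<sigma>_def)
  have \<sigma>1: "\<sigma> \<le> \<eta> / 8" unfolding \<sigma>_def by (rule min.cobounded1)
  have \<sigma>2: "\<sigma> * (2 * N + \<sigma>) \<le> (\<eta> / 16)\<^sup>2"
  proof -
    have "\<sigma> \<le> (\<eta> / 16)\<^sup>2 / (2 * N + 1)" unfolding \<sigma>_def by (rule min.cobounded2)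
    then have "\<sigma> * (2 * N + 1) \<le> (\<eta> / 16)\<^sup>2" using N by (simp add: pos_le_divide_eq)
    moreover have "\<sigma> * (2 * N + \<sigma>) \<le> \<sigma> * (2 * N + 1)" using \<sigma>0 \<sigma>1 \<eta> by (intro mult_left_mono) auto
    ultimately show ?thesis by linarith
  qed
  \<comment> \<open>The pair has distance at most \<open>2 * N * r\<close>, and moving the centre
    adds at most \<open>r\<close>.\<close>
  define N1 where "N1 = 2 * N + 1"
  obtain G \<kappa> m where G: "finite G" "\<forall>(\<phi>, n)\<in>G. annular_bump \<phi> n" and \<kappa>: "0 < \<kappa>" "\<kappa> \<le> 1" and m: "0 < m"
    and bumps: "\<And>p. knorm p \<le> N1 \<Longrightarrow> \<eta> / 2 / 2 \<le> knorm p \<Longrightarrow> \<exists>(\<phi>, n)\<in>G.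
       (\<forall>q. \<phi> (coords q) \<noteq> 0 \<longrightarrow> knorm (p - q) < \<eta> / 2) \<and> (\<forall>h. knorm h < \<kappa> \<longrightarrow> m \<le> \<phi> (coords (- h + p)))"
    using bump_family[of N1 "\<eta> / 2"] N \<eta> unfolding N1_def by auto
  define \<delta> where "\<delta> = m * \<kappa> ^ 3 / A"
  have \<delta>: "0 < \<delta>" using m \<kappa> A_ge_1 by (simp add: \<delta>_def)
  \<comment> \<open>From \<open>p0\<close> to \<open>p\<close> at most \<open>R\<close>, on to
    \<open>a\<close> at most \<open>N * r\<close>, on to \<open>a'\<close> at most \<open>r\<close>,
    then the ball of radius \<open>(N1 + 1) * r\<close>; finally
    \<open>r \<le> 2 * R\<close>.\<close>
  define L where "L = 1 + 2 * (N + 1 + (N1 + 1))"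
  \<comment> \<open>Chebyshev contributes \<open>\<delta>\<close>, the masses of the small disjoint
    balls contribute \<open>A / \<sigma> ^ 3\<close>, and the covering balls of radius
    \<open>(N + 2) * r\<close> contribute the rest.\<close>
  define K where "K = A' * (N + 2) ^ 3 * A / (\<sigma> ^ 3 * \<delta>\<^sup>2)"
  have K0: "0 \<le> K" using A' N A_ge_1 \<sigma>0 by (simp add: K_def)
  have main: "hausdorff 3 {p \<in> E \<inter> ball p0 R. ennreal \<epsilon> \<le> vertical_beta E p (2 powi k)}
        \<le> ennreal (K * (\<Sum>(\<phi>, n)\<in>G. LINT p|M. (bconv E \<phi> p0 (L * R) k p)\<^sup>2))"
    if p0: "p0 \<in> E" and R: "0 < R" and kR: "2 powi k \<le> 2 * R" and diam: "ennreal (N * 2 powi k) \<le> ediam E" for p0 R k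
  proof -
    define r where "r = (2 :: real) powi k"
    have r: "0 < r" by (simp add: r_def)
    have rR: "r \<le> 2 * R" using kR by (simp add: r_def)
    have L1: "1 \<le> L" using N by (simp add: L_def N1_def)
    have fin: "emeasure M (ball p0 (L * R)) < \<infinity>"
      using A'(2)[OF p0, of "L * R"] L1 R unfolding M_def by (simp add: emeasure_mu order.strict_trans1)
    have small_scale: "ennreal (t * r) \<le> ediam E" if "t \<le> 1" for t
    proof -
      have "t * r \<le> N * r" using that N r by (intro mult_right_mono) auto
      then show ?thesis using diam unfolding r_def[symmetric] by (meson ennreal_leI order_trans)
    qed
    define Q where "Q p = (\<Sum>(\<phi>, n)\<in>G. (bconv E \<phi> p0 (L * R) k p)\<^sup>2)" for p
    have sq: "sq_integrable M (bconv E \<phi> p0 (L * R) k)" if "(\<phi>, n) \<in> G" for \<phi> n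
      using bconv_carleson[of \<phi> n E] that G(2) closed bd fin unfolding M_def by blast
    have intQ: "integrable M Q"
      unfolding Q_def using sq by (intro Bochner_Integration.integrable_sum) (auto simp: sq_integrable_def)
    have Q0: "0 \<le> Q p" for p unfolding Q_def by (intro sum_nonneg) auto
    have LQ: "(LINT p|M. Q p) = (\<Sum>(\<phi>, n)\<in>G. LINT p|M. (bconv E \<phi> p0 (L * R) k p)\<^sup>2)"
      unfolding Q_def using sq
      by (subst Bochner_Integration.integral_sum) (auto simp: sq_integrable_def case_prod_beta')
    \<comment> \<open>Centres for which \<open>Q\<close> is large on a whole piece of
      \<open>E\<close> and not merely at one point, so that an integral of \<open>Q\<close> can
      count them.\<close>
    define T where "T = {a \<in> E. \<forall>a'\<in>E \<inter> ball a (\<sigma> * r). \<delta>\<^sup>2 \<le> Q a'}"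
    have close: "\<exists>a\<in>T. dist p a < N * r"
      if p: "p \<in> E" "dist p0 p < R" "ennreal \<epsilon> \<le> vertical_beta E p r" for p
    proof -
      obtain a b where ab: "a \<in> E" "b \<in> E" "dist p a < N * r" "dist p b < N * r"
        and far: "\<And>w. w \<in> E \<Longrightarrow> \<eta> * r \<le> dist w (hsym a b)"
        using asym[OF p(1) r _ p(3)] diam unfolding r_def by auto
      have "\<delta>\<^sup>2 \<le> Q a'" if a': "a' \<in> E" "dist a a' < \<sigma> * r" for a'
      proof -
        have "dist a b \<le> 2 * N * r" using ab dist_triangle[of a b p] by (simp add: dist_commute[of a])
        from dist_hsym_centre[OF _ this, of a' "\<sigma> * r"] a'(2)
        have "dist (hsym a' b) (hsym a b) \<le> 2 * (\<sigma> * r) + 4 * sqrt (\<sigma> * r * (2 * N * r + \<sigma> * r))"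
          by (simp add: dist_commute[of a'])
        also have "\<sigma> * r * (2 * N * r + \<sigma> * r) = \<sigma> * (2 * N + \<sigma>) * r\<^sup>2"
          by (simp add: power2_eq_square algebra_simps)
        also have "sqrt (\<sigma> * (2 * N + \<sigma>) * r\<^sup>2) \<le> sqrt ((\<eta> / 16)\<^sup>2 * r\<^sup>2)"
          using \<sigma>2 by (intro real_sqrt_le_mono mult_right_mono) auto
        also have "sqrt ((\<eta> / 16)\<^sup>2 * r\<^sup>2) = \<eta> / 16 * r"
          using \<eta> r by (intro real_sqrt_unique) (auto simp: power_mult_distrib power_divide)
        finally have "dist (hsym a' b) (hsym a b) \<le> 2 * (\<sigma> * r) + 4 * (\<eta> / 16 * r)" by simp
        moreover have "\<sigma> * r \<le> \<eta> / 8 * r" using \<sigma>1 r by (intro mult_right_mono) auto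
        ultimately have shift: "dist (hsym a' b) (hsym a b) \<le> \<eta> / 2 * r" by linarith
        have far': "\<eta> / 2 * r \<le> dist w (hsym a' b)" if "w \<in> E" for w
          using far[OF that] shift dist_triangle[of w "hsym a b" "hsym a' b"] by linarith
        define c where "c = dil (1 / r) (- b + a')"
        have a'b: "dist a' b \<le> N1 * r"
        proof -
          have "\<sigma> * r \<le> 1 * r" using \<sigma>1 \<eta> r by (intro mult_right_mono) auto
          then show ?thesis
            using a'(2) \<open>dist a b \<le> 2 * N * r\<close> dist_triangle[of a' b a]
            by (simp add: N1_def dist_commute[of a'] distrib_right)
        qed
        have kc: "knorm c = dist a' b / r" using r by (simp add: c_def knorm_dil dist_heis_def)
        have c1: "knorm c \<le> N1" using a'b r by (simp add: kc pos_divide_le_eq)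
        \<comment> \<open>The point \<open>b\<close> of \<open>E\<close> is itself a competitor in
          \<open>far'\<close>.\<close>
        have "\<eta> / 2 * r \<le> dist (hsym a' b) b" using far'[OF ab(2)] by (simp add: dist_commute)
        also have "\<dots> = 2 * sqrt ((hx (- b + a'))\<^sup>2 + (hy (- b + a'))\<^sup>2)" by (rule dist_hsym_right)
        also have "\<dots> \<le> 2 * dist a' b" using horizontal_le_knorm[of "- b + a'"] by (simp add: dist_heis_def)
        finally have "\<eta> / 2 / 2 * r \<le> dist a' b" by linarith
        then have c2: "\<eta> / 2 / 2 \<le> knorm c" using r unfolding kc by (simp add: pos_le_divide_eq)
        obtain \<phi> n where \<phi>: "(\<phi>, n) \<in> G" "\<And>q. \<phi> (coords q) \<noteq> 0 \<Longrightarrow> knorm (c - q) < \<eta> / 2"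
          "\<And>h. knorm h < \<kappa> \<Longrightarrow> m \<le> \<phi> (coords (- h + c))"
          using bumps[OF c1 c2] by blast
        have "\<delta> \<le> bconv E \<phi> p0 (L * R) k a'"
          unfolding \<delta>_def bconv_def r_def[symmetric]
        proof (rule asymmetric_imp_large[where N = N1 and \<eta> = "\<eta> / 2" and v = b and n = n])
          show "annular_bump \<phi> n" using \<phi>(1) G(2) by blast
          show "ennreal (\<kappa> * r) \<le> ediam E" by (rule small_scale[OF \<kappa>(2)])
          show "emeasure (hausdorff3_on E) (ball p0 (L * R)) < \<infinity>" using fin by (simp add: M_def)
          show "ball a' ((N1 + 1) * r) \<subseteq> ball p0 (L * R)"
          proof
            fix q assume "q \<in> ball a' ((N1 + 1) * r)"
            then have "dist a' q < (N1 + 1) * r" by simp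
            moreover have "dist a a' < 1 * r"
              using a'(2) \<sigma>1 \<eta> r mult_right_mono[of \<sigma> 1 r] by linarith
            moreover have "dist p0 q \<le> dist p0 p + dist p a + dist a a' + dist a' q"
              using dist_triangle[of p0 q p] dist_triangle[of p q a] dist_triangle[of a q a'] by linarith
            ultimately have "dist p0 q < R + N * r + 1 * r + (N1 + 1) * r" using p(2) ab(3) by linarith
            also have "\<dots> = R + (N + 1 + (N1 + 1)) * r" by (simp add: algebra_simps)
            also have "\<dots> \<le> R + (N + 1 + (N1 + 1)) * (2 * R)"
              using rR N by (intro add_left_mono mult_left_mono) (auto simp: N1_def)
            also have "\<dots> = L * R" by (simp add: L_def algebra_simps)
            finally show "q \<in> ball p0 (L * R)" by simp
          qed
        qed (use m \<kappa> r a' ab a'b far' \<phi>(2,3) in \<open>simp_all add: c_def\<close>)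
        then have "\<delta>\<^sup>2 \<le> (bconv E \<phi> p0 (L * R) k a')\<^sup>2" using \<delta> by (intro power_mono) auto
        also have "\<dots> \<le> Q a'"
          unfolding Q_def
          using member_le_sum[of "(\<phi>, n)" G "\<lambda>(\<phi>, n). (bconv E \<phi> p0 (L * R) k a')\<^sup>2"] \<phi>(1) G(1) by auto
        finally show ?thesis .
      qed
      then have "a \<in> T" using ab(1) by (auto simp: T_def)
      then show ?thesis using ab(3) by blast
    qed
    \<comment> \<open>Chebyshev's inequality on the union of the disjoint balls, where
      \<open>Q\<close> is at least \<open>\<delta>\<^sup>2\<close>.\<close>
    have card: "real (card F) * ((\<sigma> * r) ^ 3 / A) \<le> (LINT p|M. Q p) / \<delta>\<^sup>2"
      if F: "F \<subseteq> T" "finite F" "\<forall>x\<in>F. \<forall>y\<in>F. x \<noteq> y \<longrightarrow> 2 * (\<sigma> * r) \<le> dist x y" for F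
    proof -
      define S where "S = (\<Union>x\<in>F. E \<inter> ball x (\<sigma> * r))"
      have S: "S \<in> sets M" unfolding S_def M_def using F(2) closed by (intro sets.finite_UN) auto
      have "ennreal (real (card F) * ((\<sigma> * r) ^ 3 / A)) = (\<Sum>x\<in>F. ennreal ((\<sigma> * r) ^ 3 / A))"
        unfolding sum_constant ennreal_of_nat_eq_real_of_nat
        using A_ge_1 \<sigma>0 r by (intro ennreal_mult) auto
      also have "\<dots> \<le> (\<Sum>x\<in>F. emeasure M (E \<inter> ball x (\<sigma> * r)))"
      proof (rule sum_mono)
        fix x assume "x \<in> F"
        then have "x \<in> E" using F(1) by (auto simp: T_def)
        moreover have "ennreal (\<sigma> * r) \<le> ediam E" using \<sigma>1 \<eta> by (intro small_scale) auto
        ultimately have "ennreal ((\<sigma> * r) ^ 3 / A) \<le> hausdorff 3 (E \<inter> ball x (\<sigma> * r))"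
          using \<sigma>0 r by (intro lower) auto
        also have "\<dots> = emeasure M (E \<inter> ball x (\<sigma> * r))"
          unfolding M_def using closed by (subst emeasure_mu) (auto simp: Int_assoc[symmetric])
        finally show "ennreal ((\<sigma> * r) ^ 3 / A) \<le> emeasure M (E \<inter> ball x (\<sigma> * r))" .
      qed
      also have "\<dots> = emeasure M S"
        unfolding S_def
      proof (rule sum_emeasure)
        show "disjoint_family_on (\<lambda>x. E \<inter> ball x (\<sigma> * r)) F"
          unfolding disjoint_family_on_def
        proof (intro ballI impI)
          fix x y assume xy: "x \<in> F" "y \<in> F" "x \<noteq> y"
          then have "2 * (\<sigma> * r) \<le> dist x y" using F(3) by blast
          then show "E \<inter> ball x (\<sigma> * r) \<inter> (E \<inter> ball y (\<sigma> * r)) = {}"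
            using dist_triangle_half_l[of x _ "2 * (\<sigma> * r)" y] by fastforce
        qed
      qed (use F(2) closed in \<open>auto simp: M_def\<close>)
      also have "\<dots> = (\<integral>\<^sup>+p. indicator S p \<partial>M)" using S by simp
      also have "\<dots> \<le> (\<integral>\<^sup>+p. ennreal (Q p / \<delta>\<^sup>2) \<partial>M)"
      proof (rule nn_integral_mono)
        fix p
        show "indicator S p \<le> ennreal (Q p / \<delta>\<^sup>2)"
        proof (cases "p \<in> S")
          case True
          then have "\<delta>\<^sup>2 \<le> Q p" using F(1) by (auto simp: S_def T_def)
          then have "1 \<le> Q p / \<delta>\<^sup>2" using \<delta> by (simp add: pos_le_divide_eq)
          then show ?thesis using True by simp
        qed simp
      qed
      also have "\<dots> = ennreal (LINT p|M. Q p / \<delta>\<^sup>2)"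
        using intQ Q0 by (intro nn_integral_eq_integral) auto
      finally have "ennreal (real (card F) * ((\<sigma> * r) ^ 3 / A)) \<le> ennreal ((LINT p|M. Q p) / \<delta>\<^sup>2)" by simp
      moreover have "0 \<le> (LINT p|M. Q p) / \<delta>\<^sup>2" using Q0 by (intro divide_nonneg_nonneg Bochner_Integration.integral_nonneg) auto
      ultimately show ?thesis by (subst (asm) ennreal_le_iff)
    qed
    have vol: "0 < (\<sigma> * r) ^ 3 / A" using \<sigma>0 r A_ge_1 by simp
    obtain F where F: "F \<subseteq> T" "finite F" "\<forall>x\<in>F. \<forall>y\<in>F. x \<noteq> y \<longrightarrow> 2 * (\<sigma> * r) \<le> dist x y"
      and cover: "\<And>x. x \<in> T \<Longrightarrow> \<exists>y\<in>F. dist x y < 2 * (\<sigma> * r) \<or> x = y"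
    proof -
      have "\<exists>F\<subseteq>T. finite F \<and> (\<forall>x\<in>F. \<forall>y\<in>F. x \<noteq> y \<longrightarrow> 2 * (\<sigma> * r) \<le> dist x y) \<and>
          (\<forall>x\<in>T. \<exists>y\<in>F. dist x y < 2 * (\<sigma> * r) \<or> x = y)"
      proof (rule exists_separated_net[of T "2 * (\<sigma> * r)" "(LINT p|M. Q p) / \<delta>\<^sup>2 / ((\<sigma> * r) ^ 3 / A)"])
        fix F assume "F \<subseteq> T" "finite F" "\<forall>x\<in>F. \<forall>y\<in>F. x \<noteq> y \<longrightarrow> 2 * (\<sigma> * r) \<le> dist x y"
        from card[OF this]
        show "real (card F) \<le> (LINT p|M. Q p) / \<delta>\<^sup>2 / ((\<sigma> * r) ^ 3 / A)"
          using vol by (subst pos_le_divide_eq)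
      qed
      then obtain F where "F \<subseteq> T" "finite F" "\<forall>x\<in>F. \<forall>y\<in>F. x \<noteq> y \<longrightarrow> 2 * (\<sigma> * r) \<le> dist x y"
        "\<forall>x\<in>T. \<exists>y\<in>F. dist x y < 2 * (\<sigma> * r) \<or> x = y" by (elim exE conjE)
      then show ?thesis by (intro that[of F]) simp_all
    qed
    have sub: "{p \<in> E \<inter> ball p0 R. ennreal \<epsilon> \<le> vertical_beta E p r} \<subseteq> (\<Union>x\<in>F. E \<inter> ball x ((N + 2) * r))"
    proof
      fix p assume p: "p \<in> {p \<in> E \<inter> ball p0 R. ennreal \<epsilon> \<le> vertical_beta E p r}"
      then obtain a where a: "a \<in> T" "dist p a < N * r" using close by auto
      obtain y where y: "y \<in> F" "dist a y < 2 * (\<sigma> * r) \<or> a = y" using cover[OF a(1)] by blast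
      have "\<sigma> * r \<le> 1 * r" using \<sigma>1 \<eta> r by (intro mult_right_mono) auto
      moreover have "0 < \<sigma> * r" using \<sigma>0 r by simp
      moreover have "dist a y < 2 * (\<sigma> * r)" using y(2) calculation(2) by auto
      ultimately have "dist y p < (N + 2) * r"
        using a(2) dist_triangle[of p y a] by (simp add: dist_commute[of y] distrib_right)
      then show "p \<in> (\<Union>x\<in>F. E \<inter> ball x ((N + 2) * r))" using p y(1) by auto
    qed
    have "hausdorff 3 {p \<in> E \<inter> ball p0 R. ennreal \<epsilon> \<le> vertical_beta E p r}
        \<le> hausdorff 3 (\<Union>x\<in>F. E \<inter> ball x ((N + 2) * r))" by (rule hausdorff_mono[OF sub])
    also have "\<dots> = emeasure M (\<Union>x\<in>F. E \<inter> ball x ((N + 2) * r))"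
    proof -
      have "(\<Union>x\<in>F. E \<inter> ball x ((N + 2) * r)) \<in> sets borel"
        using F(2) closed by (intro sets.finite_UN) auto
      moreover have "E \<inter> (\<Union>x\<in>F. E \<inter> ball x ((N + 2) * r)) = (\<Union>x\<in>F. E \<inter> ball x ((N + 2) * r))" by blast
      ultimately show ?thesis by (simp only: M_def emeasure_mu)
    qed
    also have "\<dots> \<le> (\<Sum>x\<in>F. emeasure M (E \<inter> ball x ((N + 2) * r)))"
      using F(2) closed by (intro emeasure_subadditive_finite) (auto simp: M_def)
    also have "\<dots> \<le> (\<Sum>x\<in>F. ennreal (A' * ((N + 2) * r) ^ 3))"
    proof (rule sum_mono)
      fix x assume "x \<in> F"
      then have "x \<in> E" using F(1) by (auto simp: T_def)
      then have "hausdorff 3 (E \<inter> ball x ((N + 2) * r)) \<le> ennreal (A' * ((N + 2) * r) ^ 3)"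
        using N r by (intro A'(2)) auto
      moreover have "emeasure M (E \<inter> ball x ((N + 2) * r)) = hausdorff 3 (E \<inter> ball x ((N + 2) * r))"
        unfolding M_def using closed by (subst emeasure_mu) (auto simp: Int_assoc[symmetric])
      ultimately show "emeasure M (E \<inter> ball x ((N + 2) * r)) \<le> ennreal (A' * ((N + 2) * r) ^ 3)" by simp
    qed
    also have "\<dots> = ennreal (real (card F) * (A' * ((N + 2) * r) ^ 3))"
      unfolding sum_constant ennreal_of_nat_eq_real_of_nat
      using A' N r by (intro ennreal_mult[symmetric]) auto
    also have "\<dots> \<le> ennreal (K * (LINT p|M. Q p))"
    proof (rule ennreal_leI)
      have "real (card F) * (A' * ((N + 2) * r) ^ 3)
          = real (card F) * ((\<sigma> * r) ^ 3 / A) * (A' * (N + 2) ^ 3 * A / \<sigma> ^ 3)"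
        using A_ge_1 \<sigma>0 by (simp add: power_mult_distrib)
      also have "\<dots> \<le> (LINT p|M. Q p) / \<delta>\<^sup>2 * (A' * (N + 2) ^ 3 * A / \<sigma> ^ 3)"
        using card[OF F] A' N A_ge_1 \<sigma>0 by (intro mult_right_mono) auto
      also have "\<dots> = K * (LINT p|M. Q p)" by (simp add: K_def mult_ac)
      finally show "real (card F) * (A' * ((N + 2) * r) ^ 3) \<le> K * (LINT p|M. Q p)" .
    qed
    finally show ?thesis unfolding LQ r_def .
  qed
  have "1 \<le> L" using N by (simp add: L_def N1_def)
  then show ?thesis
    using G N K0 main unfolding M_def
    by (intro exI[of _ G] exI[of _ N] exI[of _ L] exI[of _ K] conjI ballI allI impI) auto
qed

text \<open>For a set of diameter \<open>D\<close>, \<open>D < N * 2 powi k\<close> bounds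
  \<open>k\<close> from below, and a large \<beta>-number bounds it from above by
  \<open>vertical_beta_le_diameter\<close>. These are the scales out of reach of
  \<open>bad_set_estimate\<close>.\<close>

lemma finite_large_scales:
  assumes "0 < N" "0 < \<epsilon>"
  shows "finite {k. \<not> ennreal (N * 2 powi k) \<le> ediam E \<and> (\<exists>p\<in>E. ennreal \<epsilon> \<le> vertical_beta E p (2 powi k))}"
    (is "finite ?S")
proof (cases "ediam E")
  case top
  then show ?thesis by simp
next
  case (real D)
  have D: "dist x y \<le> D" if "x \<in> E" "y \<in> E" for x y
    using dist_le_ediam[OF that] real by (simp add: ennreal_le_iff)
  have "?S \<subseteq> {\<lfloor>log 2 (D / N)\<rfloor>..\<lfloor>log 2 (D / \<epsilon>)\<rfloor>}"
  proof
    fix k assume "k \<in> ?S"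
    then obtain p where k: "\<not> ennreal (N * 2 powi k) \<le> ediam E"
      and p: "p \<in> E" "ennreal \<epsilon> \<le> vertical_beta E p (2 powi k)" by blast
    have le: "\<epsilon> * 2 powi k \<le> D" by (rule vertical_beta_le_diameter[OF _ p(1) D p(2) assms(2)]) auto
    moreover have "0 < \<epsilon> * 2 powi k" using assms by simp
    ultimately have D0: "0 < D" by linarith
    have gt: "D < N * 2 powi k" using k real by (simp add: ennreal_le_iff not_le ennreal_less_iff)
    have "\<lfloor>log 2 (D / N)\<rfloor> \<le> k"
    proof (rule ccontr)
      assume "\<not> \<lfloor>log 2 (D / N)\<rfloor> \<le> k"
      then have "2 * 2 powi k \<le> (2 :: real) powi \<lfloor>log 2 (D / N)\<rfloor>" by (intro powi_2_less) simp
      also have "\<dots> \<le> D / N" using D0 assms by (intro dyadic_bracket) simp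
      also have "\<dots> < 2 powi k" using gt assms by (simp add: pos_divide_less_eq mult.commute)
      finally have "2 * 2 powi k < (2 :: real) powi k" .
      moreover have "0 < (2 :: real) powi k" by simp
      ultimately show False by linarith
    qed
    moreover have "k \<le> \<lfloor>log 2 (D / \<epsilon>)\<rfloor>"
    proof (rule ccontr)
      assume "\<not> k \<le> \<lfloor>log 2 (D / \<epsilon>)\<rfloor>"
      then have "(2 :: real) powi (\<lfloor>log 2 (D / \<epsilon>)\<rfloor> + 1) \<le> 2 powi k" by (intro power_int_increasing) auto
      also have "\<dots> \<le> D / \<epsilon>" using le assms by (simp add: pos_le_divide_eq mult.commute)
      also have "\<dots> < 2 powi (\<lfloor>log 2 (D / \<epsilon>)\<rfloor> + 1)" using D0 assms by (intro dyadic_bracket) simp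
      finally show False by simp
    qed
    ultimately show "k \<in> {\<lfloor>log 2 (D / N)\<rfloor>..\<lfloor>log 2 (D / \<epsilon>)\<rfloor>}" by simp
  qed
  then show ?thesis by (rule finite_subset) simp
qed

end

text \<open>The integrand is dominated by a step function on dyadic intervals, each of which
  contributes one value of \<open>h\<close>. As the comparison is pointwise, the measurability of
  \<open>H\<close> is not at issue.\<close>

lemma dyadic_integral_bound:
  fixes H :: "real \<Rightarrow> ennreal" and h :: "int \<Rightarrow> ennreal"
  assumes R: "0 < R" and H: "\<And>r k. 0 < r \<Longrightarrow> r < 2 powi k \<Longrightarrow> 2 powi k \<le> 2 * r \<Longrightarrow> H r \<le> h k"
  shows "(\<integral>\<^sup>+r\<in>{0<..<R}. H r / ennreal r \<partial>lborel) \<le> (\<Sum>n. h (\<lfloor>log 2 R\<rfloor> + 1 - int n))"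
proof -
  define m where "m = \<lfloor>log 2 R\<rfloor> + 1"
  \<comment> \<open>The lower end of the \<open>n\<close>-th dyadic interval, counted downwards from
    \<open>2 powi m\<close>. On it \<open>1 / r \<le> 1 / c n\<close>, and the length is
    \<open>c n\<close>, so the weight is at most 1; \<open>H\<close> is compared with
    \<open>h\<close> at the upper end.\<close>
  define c where "c n = (2 :: real) powi (m - int n - 1)" for n
  have c: "0 < c n" for n by (simp add: c_def)
  have c2: "2 powi (m - int n) = 2 * c n" for n
    using power_int_add[of "2 :: real" "m - int n - 1" 1] by (simp add: c_def)
  define f where "f n r = h (m - int n) * (ennreal (1 / c n) * indicator {c n..<2 * c n} r)" for n r
  have "H r / ennreal r * indicator {0<..<R} r \<le> (\<Sum>n. f n r)" for r
  proof (cases "r \<in> {0<..<R}")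
    case True
    then have r: "0 < r" "r < R" by auto
    define j where "j = \<lfloor>log 2 r\<rfloor>"
    have j: "2 powi j \<le> r" "r < 2 * 2 powi j"
      using dyadic_bracket[OF r(1)] by (simp_all add: j_def power_int_add)
    have "j \<le> \<lfloor>log 2 R\<rfloor>" unfolding j_def using r by (intro floor_mono) (simp add: log_le_cancel_iff)
    define n where "n = nat (m - 1 - j)"
    have n: "m - int n = j + 1" using \<open>j \<le> \<lfloor>log 2 R\<rfloor>\<close> by (simp add: n_def m_def)
    have cn: "c n = 2 powi j" by (simp add: c_def n)
    have "H r \<le> h (m - int n)"
    proof (rule H[OF r(1)])
      show "r < 2 powi (m - int n)" "2 powi (m - int n) \<le> 2 * r" unfolding c2 cn using j by auto
    qed
    moreover have "inverse (ennreal r) \<le> ennreal (1 / c n)"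
    proof -
      have "inverse r \<le> inverse (c n)" using j(1) c[of n] unfolding cn by (rule le_imp_inverse_le)
      then show ?thesis unfolding inverse_ennreal[OF r(1)] by (intro ennreal_leI) (simp add: inverse_eq_divide)
    qed
    ultimately have "H r / ennreal r \<le> h (m - int n) * ennreal (1 / c n)"
      unfolding divide_ennreal_def by (intro mult_mono) auto
    also have "\<dots> = f n r" using j cn by (simp add: f_def)
    also have "\<dots> \<le> (\<Sum>n. f n r)" using sum_le_suminf[OF summableI, of "{n}" "\<lambda>n. f n r"] by simp
    finally show ?thesis using True by simp
  qed simp
  then have "(\<integral>\<^sup>+r\<in>{0<..<R}. H r / ennreal r \<partial>lborel) \<le> (\<integral>\<^sup>+r. (\<Sum>n. f n r) \<partial>lborel)"
    by (intro nn_integral_mono)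
  also have "\<dots> = (\<Sum>n. \<integral>\<^sup>+r. f n r \<partial>lborel)"
    unfolding f_def by (intro nn_integral_suminf) measurable
  also have "\<dots> = (\<Sum>n. h (m - int n))"
  proof (intro suminf_cong)
    fix n
    have "(\<integral>\<^sup>+r. f n r \<partial>lborel) = h (m - int n) * (ennreal (1 / c n) * emeasure lborel {c n..<2 * c n})"
      unfolding f_def by (subst nn_integral_cmult, measurable, subst nn_integral_cmult_indicator) auto
    also have "emeasure lborel {c n..<2 * c n} = ennreal (c n)" using c[of n] by simp
    also have "ennreal (1 / c n) * ennreal (c n) = 1"
      using c[of n] by (simp flip: ennreal_mult)
    finally show "(\<integral>\<^sup>+r. f n r \<partial>lborel) = h (m - int n)" by simp
  qed
  finally show ?thesis by (simp add: m_def)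
qed

section \<open>Summation over all scales\<close>

context regular_set begin

lemma weak_geometric_lemma:
  assumes e: "0 < \<epsilon>" and bd: "\<forall>K. admissible_kernel K \<longrightarrow> sio_bounded_L2 K (hausdorff3_on E)"
  shows "\<exists>C\<ge>1. \<forall>p0\<in>E. \<forall>R>0. (\<integral>\<^sup>+r\<in>{0<..<R}.
     hausdorff 3 {p \<in> E \<inter> ball p0 R. ennreal \<epsilon> \<le> vertical_beta E p r} / ennreal r \<partial>lborel) \<le> ennreal (C * R ^ 3)"
proof (cases "ediam E = 0")
  case True
  \<comment> \<open>\<open>E\<close> has at most one point, and a vertical plane through it contains
    \<open>E\<close>, so no \<beta>-number reaches \<open>\<epsilon>\<close>.\<close>
  have D: "dist x y \<le> 0" if "x \<in> E" "y \<in> E" for x y using dist_le_ediam[OF that] True by simp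
  have "(\<integral>\<^sup>+r\<in>{0<..<R}. hausdorff 3 {p \<in> E \<inter> ball p0 R. ennreal \<epsilon> \<le> vertical_beta E p r} / ennreal r \<partial>lborel) = 0"
    for p0 R
  proof -
    have "hausdorff 3 {p \<in> E \<inter> ball p0 R. ennreal \<epsilon> \<le> vertical_beta E p r} / ennreal r * indicator {0<..<R} r = 0" for r
    proof (cases "0 < r")
      case r: True
      have "\<not> ennreal \<epsilon> \<le> vertical_beta E p r" if "p \<in> E" for p
      proof
        assume "ennreal \<epsilon> \<le> vertical_beta E p r"
        from vertical_beta_le_diameter[OF r that D this e] mult_pos_pos[OF e r] show False by linarith
      qed
      then have "{p \<in> E \<inter> ball p0 R. ennreal \<epsilon> \<le> vertical_beta E p r} = {}" by blast
      then show ?thesis by (simp only: hausdorff_empty) simp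
    qed simp
    then show ?thesis by (simp only: nn_integral_const) simp
  qed
  then show ?thesis by (intro exI[of _ 1]) simp
next
  case False
  \<comment> \<open>The half is the loss in \<open>vertical_beta_doubling\<close>;
    \<open>flat_or_asymmetric\<close> asks for at most 1.\<close>
  define \<epsilon>' where "\<epsilon>' = min 1 (\<epsilon> / 2)"
  have e': "0 < \<epsilon>'" "\<epsilon>' \<le> 1" "\<epsilon>' \<le> \<epsilon> / 2" using e by (auto simp: \<epsilon>'_def)
  define M where "M = hausdorff3_on E"
  obtain A' where "1 \<le> A'" and A'_upper: "\<forall>p\<in>E. \<forall>R>0. hausdorff 3 (E \<inter> ball p R) \<le> ennreal (A' * R ^ 3)"
    using global_upper[OF False] by (elim exE conjE)
  then have A': "1 \<le> A'" "\<And>p R. p \<in> E \<Longrightarrow> 0 < R \<Longrightarrow> hausdorff 3 (E \<inter> ball p R) \<le> ennreal (A' * R ^ 3)"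
    by auto
  have A'0: "0 \<le> A'" using A'(1) by simp
  obtain G N L K where G: "finite G" and N: "1 \<le> N" and L: "1 \<le> L" and K: "0 \<le> K"
    and annular: "\<forall>(\<phi>, n)\<in>G. annular_bump \<phi> n"
    and est: "\<forall>p0\<in>E. \<forall>R>0. \<forall>k. 2 powi k \<le> 2 * R \<longrightarrow> ennreal (N * 2 powi k) \<le> ediam E \<longrightarrow>
      hausdorff 3 {p \<in> E \<inter> ball p0 R. ennreal \<epsilon>' \<le> vertical_beta E p (2 powi k)}
        \<le> ennreal (K * (\<Sum>(\<phi>, n)\<in>G. LINT p|hausdorff3_on E. (bconv E \<phi> p0 (L * R) k p)\<^sup>2))"
    using bad_set_estimate[OF e'(1,2) A'0 A'_upper bd] by (elim exE conjE)
  have "\<exists>C. 0 \<le> C \<and> (\<forall>p0 R. emeasure M (ball p0 R) < \<infinity> \<longrightarrow>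
      (\<forall>l h. (\<Sum>j=l..h. LINT p|M. (bconv E (fst g) p0 R j p)\<^sup>2) \<le> C * measure M (ball p0 R)))" if g: "g \<in> G" for g
  proof -
    have bump: "annular_bump (fst g) (snd g)" using annular g by (cases g) auto
    obtain C where "0 \<le> C" "\<forall>p0 R. emeasure (hausdorff3_on E) (ball p0 R) < \<infinity> \<longrightarrow>
      (\<forall>j. sq_integrable (hausdorff3_on E) (bconv E (fst g) p0 R j)) \<and>
      (\<forall>l h. (\<Sum>j=l..h. LINT p|hausdorff3_on E. (bconv E (fst g) p0 R j p)\<^sup>2) \<le> C * measure (hausdorff3_on E) (ball p0 R))"
      using bconv_carleson[OF bump closed bd] by (elim exE conjE)
    then show ?thesis unfolding M_def by (intro exI[of _ C]) simp
  qed
  then have "\<forall>g\<in>G. \<exists>C. 0 \<le> C \<and> (\<forall>p0 R. emeasure M (ball p0 R) < \<infinity> \<longrightarrow>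
      (\<forall>l h. (\<Sum>j=l..h. LINT p|M. (bconv E (fst g) p0 R j p)\<^sup>2) \<le> C * measure M (ball p0 R)))" by (rule ballI)
  from bchoice[OF this] obtain Cg where Cg': "\<forall>g\<in>G. 0 \<le> Cg g \<and> (\<forall>p0 R. emeasure M (ball p0 R) < \<infinity> \<longrightarrow>
      (\<forall>l h. (\<Sum>j=l..h. LINT p|M. (bconv E (fst g) p0 R j p)\<^sup>2) \<le> Cg g * measure M (ball p0 R)))" by (elim exE)
  have Cg: "0 \<le> Cg g" "emeasure M (ball p0 R) < \<infinity> \<Longrightarrow>
      (\<Sum>j=l..h. LINT p|M. (bconv E (fst g) p0 R j p)\<^sup>2) \<le> Cg g * measure M (ball p0 R)" if "g \<in> G" for g p0 R l h
    using bspec[OF Cg' that] by simp_all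
  define S where "S = {k. \<not> ennreal (N * 2 powi k) \<le> ediam E \<and> (\<exists>p\<in>E. ennreal \<epsilon>' \<le> vertical_beta E p (2 powi k))}"
  have S: "finite S" unfolding S_def using N e' by (intro finite_large_scales) auto
  define C1 where "C1 = K * ((\<Sum>g\<in>G. Cg g) * (A' * L ^ 3))"
  define C2 where "C2 = real (card S) * A'"
  have C1: "0 \<le> C1" unfolding C1_def using K A' L Cg(1) by (intro mult_nonneg_nonneg sum_nonneg) auto
  have C2: "0 \<le> C2" unfolding C2_def using A' by simp
  have "(\<integral>\<^sup>+r\<in>{0<..<R}. hausdorff 3 {p \<in> E \<inter> ball p0 R. ennreal \<epsilon> \<le> vertical_beta E p r} / ennreal r \<partial>lborel)
      \<le> ennreal ((C1 + C2 + 1) * R ^ 3)" if p0: "p0 \<in> E" and R: "0 < R" for p0 R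
  proof -
    define h where "h k = hausdorff 3 {p \<in> E \<inter> ball p0 R. ennreal \<epsilon>' \<le> vertical_beta E p (2 powi k)}" for k
    \<comment> \<open>Radii below \<open>R\<close> lie in dyadic intervals with upper end at most
      \<open>2 powi m\<close>, which is still in the range \<open>2 * R\<close> allowed by
      \<open>est\<close>.\<close>
    define m where "m = \<lfloor>log 2 R\<rfloor> + 1"
    have m: "2 powi m \<le> 2 * R"
      using dyadic_bracket(1)[OF R] by (simp add: m_def power_int_add)
    define I where "I g k = (LINT p|M. (bconv E (fst g) p0 (L * R) k p)\<^sup>2)" for g :: "(real3 \<Rightarrow> real) \<times> real" and k
    have I0: "0 \<le> I g k" for g k unfolding I_def by simp
    define a where "a k = ennreal (K * (\<Sum>g\<in>G. I g k))" for k
    \<comment> \<open>Scales too large for \<open>est\<close> get the trivial bound by the mass of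
      the ball. They are finitely many, and \<open>S\<close> depends neither on \<open>p0\<close>
      nor on \<open>R\<close>.\<close>
    define b where "b k = (if k \<in> S then ennreal (A' * R ^ 3) else 0)" for k
    have h: "h k \<le> a k + b k" if k: "k \<le> m" for k
    proof (cases "ennreal (N * 2 powi k) \<le> ediam E")
      case True
      have "(2 :: real) powi k \<le> 2 powi m" using k by (intro power_int_increasing) auto
      then have "2 powi k \<le> 2 * R" using m by (rule order_trans)
      then have "h k \<le> a k"
        unfolding h_def a_def I_def M_def
        using bspec[OF est p0, rule_format, OF R _ True] by (simp only: case_prod_beta')
      then show ?thesis by (simp add: add_increasing2)
    next
      case large: False
      show ?thesis
      proof (cases "k \<in> S")
        case True
        have "h k \<le> hausdorff 3 (E \<inter> ball p0 R)" unfolding h_def by (intro hausdorff_mono) auto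
        also have "\<dots> \<le> b k" using A'(2)[OF p0 R] True by (simp add: b_def)
        finally show ?thesis by (simp add: add_increasing)
      next
        case False
        then have "{p \<in> E \<inter> ball p0 R. ennreal \<epsilon>' \<le> vertical_beta E p (2 powi k)} = {}"
          using large unfolding S_def by blast
        then show ?thesis by (simp only: h_def hausdorff_empty) simp
      qed
    qed
    have LR: "0 < L * R" using L R by simp
    have ball: "emeasure M (ball p0 (L * R)) \<le> ennreal (A' * (L * R) ^ 3)"
      unfolding M_def using A'(2)[OF p0 LR] by (simp add: emeasure_mu)
    then have fin: "emeasure M (ball p0 (L * R)) < \<infinity>" by (simp add: order.strict_trans1)
    have ball': "measure M (ball p0 (L * R)) \<le> A' * (L * R) ^ 3"
      using ball A'0 LR unfolding measure_def by (intro enn2real_leI) auto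
    have window_a: "(\<Sum>k=l..m. a k) \<le> ennreal (C1 * R ^ 3)" for l
    proof -
      have "(\<Sum>k=l..m. a k) = ennreal (\<Sum>k=l..m. K * (\<Sum>g\<in>G. I g k))"
        unfolding a_def using K I0 by (intro sum_ennreal mult_nonneg_nonneg sum_nonneg) auto
      \<comment> \<open>With the sum over scales inside, the Carleson estimate applies to each bump
        separately.\<close>
      also have "(\<Sum>k=l..m. K * (\<Sum>g\<in>G. I g k)) = K * (\<Sum>g\<in>G. \<Sum>k=l..m. I g k)"
        unfolding sum_distrib_left[symmetric] by (subst sum.swap) (rule refl)
      also have "ennreal \<dots> \<le> ennreal (C1 * R ^ 3)"
      proof (rule ennreal_leI)
        have "(\<Sum>k=l..m. I g k) \<le> Cg g * (A' * (L * R) ^ 3)" if g: "g \<in> G" for g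
          using Cg(2)[OF g fin, of l m] mult_left_mono[OF ball' Cg(1)[OF g]] unfolding I_def by linarith
        then have "(\<Sum>g\<in>G. \<Sum>k=l..m. I g k) \<le> (\<Sum>g\<in>G. Cg g * (A' * (L * R) ^ 3))" by (rule sum_mono)
        then have "K * (\<Sum>g\<in>G. \<Sum>k=l..m. I g k) \<le> K * (\<Sum>g\<in>G. Cg g * (A' * (L * R) ^ 3))"
          using K by (rule mult_left_mono)
        also have "\<dots> = C1 * R ^ 3"
          unfolding C1_def sum_distrib_right[symmetric] power_mult_distrib by (simp only: mult.assoc)
        finally show "K * (\<Sum>g\<in>G. \<Sum>k=l..m. I g k) \<le> C1 * R ^ 3" .
      qed
      finally show ?thesis .
    qed
    have window_b: "(\<Sum>k=l..m. b k) \<le> ennreal (C2 * R ^ 3)" for l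
    proof -
      have "(\<Sum>k=l..m. b k) = (\<Sum>k\<in>{l..m} \<inter> S. ennreal (A' * R ^ 3))"
        unfolding b_def by (rule sum.inter_restrict[symmetric]) simp
      also have "\<dots> \<le> (\<Sum>k\<in>S. ennreal (A' * R ^ 3))" using S by (intro sum_mono2) auto
      also have "\<dots> = ennreal (real (card S) * (A' * R ^ 3))"
        unfolding sum_constant ennreal_of_nat_eq_real_of_nat
        using A'0 R by (intro ennreal_mult[symmetric]) auto
      finally show ?thesis by (simp add: C2_def mult.assoc)
    qed
    have "(\<integral>\<^sup>+r\<in>{0<..<R}. hausdorff 3 {p \<in> E \<inter> ball p0 R. ennreal \<epsilon> \<le> vertical_beta E p r} / ennreal r \<partial>lborel)
        \<le> (\<Sum>n. h (\<lfloor>log 2 R\<rfloor> + 1 - int n))"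
    proof (rule dyadic_integral_bound[OF R])
      fix r :: real and k :: int
      assume r: "0 < r" "r < 2 powi k" "2 powi k \<le> 2 * r"
      have "ennreal \<epsilon>' \<le> vertical_beta E p (2 powi k)" if p: "ennreal \<epsilon> \<le> vertical_beta E p r" for p
      proof -
        have "ennreal \<epsilon>' \<le> ennreal (\<epsilon> / 2)" using e' by (intro ennreal_leI)
        also have "\<dots> \<le> vertical_beta E p (2 powi k)"
          using r by (intro vertical_beta_doubling[OF r(1) _ r(3) p e]) simp
        finally show ?thesis .
      qed
      then show "hausdorff 3 {p \<in> E \<inter> ball p0 R. ennreal \<epsilon> \<le> vertical_beta E p r} \<le> h k"
        unfolding h_def by (intro hausdorff_mono) blast
    qed
    also have "\<dots> = (\<Sum>n. h (m - int n))" by (simp add: m_def)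
    also have "\<dots> \<le> ennreal ((C1 + C2 + 1) * R ^ 3)"
    proof (rule suminf_le_const[OF summableI])
      fix q
      have "(\<Sum>n<q. h (m - int n)) = (\<Sum>k\<in>(\<lambda>n. m - int n) ` {..<q}. h k)"
        by (subst sum.reindex) (auto simp: inj_on_def)
      also have "\<dots> \<le> (\<Sum>k=m - int q..m. h k)" by (intro sum_mono2) auto
      also have "\<dots> \<le> (\<Sum>k=m - int q..m. a k + b k)" by (intro sum_mono h) auto
      also have "\<dots> = (\<Sum>k=m - int q..m. a k) + (\<Sum>k=m - int q..m. b k)" by (rule sum.distrib)
      also have "\<dots> \<le> ennreal (C1 * R ^ 3) + ennreal (C2 * R ^ 3)" by (intro add_mono window_a window_b)
      also have "\<dots> = ennreal ((C1 + C2) * R ^ 3)"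
        using C1 C2 R by (subst ennreal_plus[symmetric]) (auto simp: distrib_right)
      also have "\<dots> \<le> ennreal ((C1 + C2 + 1) * R ^ 3)"
        using R by (intro ennreal_leI mult_right_mono) auto
      finally show "(\<Sum>n<q. h (m - int n)) \<le> ennreal ((C1 + C2 + 1) * R ^ 3)" .
    qed
    finally show ?thesis .
  qed
  \<comment> \<open>The summand 1 makes the constant at least 1.\<close>
  then show ?thesis using C1 C2 by (intro exI[of _ "C1 + C2 + 1"]) auto
qed

end

theorem theorem1p4:
  fixes E :: "heis set"
  assumes "closed E"
    and "three_regular E"
    and "\<And>K. admissible_kernel K \<Longrightarrow> sio_bounded_L2 K (hausdorff3_on E)"
  shows "\<forall>\<epsilon>::real. \<epsilon> > 0 \<longrightarrow> (\<exists>C::real. C \<ge> 1 \<and> (\<forall>p0\<in>E. \<forall>R::real. R > 0 \<longrightarrow>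
    (\<integral>\<^sup>+r\<in>{0<..<R}.
        hausdorff 3 {p \<in> E \<inter> ball p0 R. vertical_beta E p r \<ge> ennreal \<epsilon>} / ennreal r \<partial>lborel)
      \<le> ennreal (C * R ^ 3)))"
proof (intro allI impI)
  fix \<epsilon> :: real assume e: "0 < \<epsilon>"
  obtain A where A: "1 \<le> A" "\<And>p r. p \<in> E \<Longrightarrow> 0 < r \<Longrightarrow> ennreal r \<le> ediam E \<Longrightarrow>
      ennreal (r ^ 3 / A) \<le> hausdorff 3 (E \<inter> ball p r) \<and> hausdorff 3 (E \<inter> ball p r) \<le> ennreal (A * r ^ 3)"
    using assms(2) unfolding three_regular_def by blast
  interpret regular_set E A
    by (rule regular_set.intro) (use assms(1) A in auto)
  show "\<exists>C\<ge>1. \<forall>p0\<in>E. \<forall>R>0. (\<integral>\<^sup>+r\<in>{0<..<R}.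
      hausdorff 3 {p \<in> E \<inter> ball p0 R. ennreal \<epsilon> \<le> vertical_beta E p r} / ennreal r \<partial>lborel) \<le> ennreal (C * R ^ 3)"
    using assms(3) by (intro weak_geometric_lemma[OF e]) blast
qed

end
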